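(* Let $(X,0)$ be a germ of a closed semialgebraic set of dimension $k$. Then there is a bi-Lipschitz and semialgebraic embedding of $(X,0)$ into $(\mathbb{R}^{2k},0)$.
   Context: Here $(X,0)\subset(\mathbb{R}^m,0)$ for some $m$, and sets carry the outer metric, i.e. the restriction of the Euclidean distance. A bi-Lipschitz and semialgebraic embedding $f:(X,0)\to(\mathbb{R}^n,0)$ is a germ at $0$ of a semialgebraic map such that $f((X,0))=(Y,0)$ is a germ of a closed semialgebraic subset of $\mathbb{R}^n$ and $f:(X,0)\to(Y,0)$ is a germ of a bijection with $f$ and $f^{-1}$ Lipschitz and semialgebraic. *)

theory Defs
  imports "HOL-Analysis.Analysis"
begin

text \<open>
  The space \<open>\<real>\<^sup>n\<close> is the carrier of \<^const>\<open>Euclidean_space\<close> \<open>n\<close>, that is, the set of all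
  \<open>x :: nat \<Rightarrow> real\<close> with \<open>x i = 0\<close> for \<open>i \<ge> n\<close>. Thus \<open>n = 0\<close> is allowed, and
  \<open>\<real>\<^sup>m \<subseteq> \<real>\<^sup>n\<close> for \<open>m \<le> n\<close>. The origin of every \<open>\<real>\<^sup>n\<close> is the same function.
\<close>

abbreviation Rn :: "nat \<Rightarrow> (nat \<Rightarrow> real) set" where
  "Rn n \<equiv> topspace (Euclidean_space n)"

definition origin :: "nat \<Rightarrow> real" where
  "origin = (\<lambda>_. 0)"

text \<open>
  The Euclidean metric. The \<^const>\<open>dist\<close> of the type \<^typ>\<open>nat \<Rightarrow> real\<close> is a different one
  (it only metrizes the product topology), so it is not used here.
\<close>

definition Rn_metric :: "nat \<Rightarrow> (nat \<Rightarrow> real) metric" where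
  "Rn_metric n = metric (Rn n, \<lambda>x y. L2_set (\<lambda>i. x i - y i) {..<n})"

lemma Metric_space_Rn: "Metric_space (Rn n) (\<lambda>x y. L2_set (\<lambda>i. x i - y i) {..<n})"
proof
  fix x y z :: "nat \<Rightarrow> real"
  show "L2_set (\<lambda>i. x i - y i) {..<n} = L2_set (\<lambda>i. y i - x i) {..<n}"
    by (simp add: L2_set_def power2_commute)
  show "L2_set (\<lambda>i. x i - y i) {..<n} = 0 \<longleftrightarrow> x = y" if "x \<in> Rn n" "y \<in> Rn n"
    using that by (auto simp: L2_set_eq_0_iff topspace_Euclidean_space fun_eq_iff)
      (metis lessThan_iff not_le)
  show "L2_set (\<lambda>i. x i - z i) {..<n} \<le> L2_set (\<lambda>i. x i - y i) {..<n} + L2_set (\<lambda>i. y i - z i) {..<n}"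
    using L2_set_triangle_ineq[of "\<lambda>i. x i - y i" "\<lambda>i. y i - z i" "{..<n}"] by simp
qed simp

lemma mspace_Rn_metric [simp]: "mspace (Rn_metric n) = Rn n"
  unfolding Rn_metric_def by (rule Metric_space.mspace_metric[OF Metric_space_Rn])

lemma mdist_Rn_metric [simp]: "mdist (Rn_metric n) x y = L2_set (\<lambda>i. x i - y i) {..<n}"
  unfolding Rn_metric_def by (simp add: Metric_space.mdist_metric[OF Metric_space_Rn])

lemma mtopology_of_Rn_metric: "mtopology_of (Rn_metric n) = Euclidean_space n"
proof -
  interpret R: Metric_space "Rn n" "\<lambda>x y. L2_set (\<lambda>i. x i - y i) {..<n}"
    by (rule Metric_space_Rn)
  have mt: "mtopology_of (Rn_metric n) = R.mtopology"
    unfolding Rn_metric_def by simp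
  have 1: "continuous_map (Euclidean_space n) R.mtopology id"
    unfolding R.continuous_map_to_metric
  proof (intro ballI allI impI)
    fix x :: "nat \<Rightarrow> real" and e :: real
    assume x: "x \<in> Rn n" and e: "0 < e"
    have cont: "continuous_on UNIV (\<lambda>y :: nat \<Rightarrow> real. L2_set (\<lambda>i. x i - y i) {..<n})"
      unfolding L2_set_def by (intro continuous_intros continuous_on_product_coordinates)
    have "open {y :: nat \<Rightarrow> real. L2_set (\<lambda>i. x i - y i) {..<n} < e}"
      by (intro open_Collect_less cont continuous_on_const)
    then have "openin (powertop_real UNIV) {y. L2_set (\<lambda>i. x i - y i) {..<n} < e}"
      by (simp add: euclidean_product_topology)
    then have "openin (Euclidean_space n) ({y. L2_set (\<lambda>i. x i - y i) {..<n} < e} \<inter> {x. \<forall>i\<ge>n. x i = 0})"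
      unfolding Euclidean_space_def by (rule openin_subtopology_Int)
    moreover have "L2_set (\<lambda>i. x i - x i) {..<n} < e"
      using e by (simp add: L2_set_def)
    ultimately show "\<exists>U. openin (Euclidean_space n) U \<and> x \<in> U \<and> (\<forall>y\<in>U. id y \<in> R.mball (id x) e)"
      using x unfolding R.in_mball id_def
      by (intro exI[of _ "{y. L2_set (\<lambda>i. x i - y i) {..<n} < e} \<inter> {x. \<forall>i\<ge>n. x i = 0}"])
        (simp_all add: topspace_Euclidean_space)
  qed
  have coord: "continuous_map R.mtopology euclideanreal (\<lambda>x. x i)" for i
    unfolding mtopology_is_euclidean[symmetric] Met_TC.continuous_map_to_metric
  proof (intro ballI allI impI)
    fix x :: "nat \<Rightarrow> real" and e :: real
    assume "x \<in> topspace R.mtopology" and e: "0 < e"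
    then have x: "x \<in> Rn n" by simp
    have "dist (x i) (y i) < e" if "y \<in> R.mball x e" for y
    proof (cases "i < n")
      case True
      have "\<bar>x i - y i\<bar> \<le> L2_set (\<lambda>i. \<bar>x i - y i\<bar>) {..<n}"
        using True by (intro member_le_L2_set) auto
      also have "\<dots> = L2_set (\<lambda>i. x i - y i) {..<n}" by (simp add: L2_set_def)
      also have "\<dots> < e" using that by simp
      finally show ?thesis by (simp add: dist_real_def)
    next
      case False
      have "y \<in> Rn n" using that by simp
      then show ?thesis using False x e by (simp add: topspace_Euclidean_space)
    qed
    then have "\<forall>y\<in>R.mball x e. y i \<in> Met_TC.mball (x i) e"
      unfolding Met_TC.in_mball by blast
    moreover have "x \<in> R.mball x e"
      using x e R.centre_in_mball_iff by blast
    ultimately show "\<exists>U. openin R.mtopology U \<and> x \<in> U \<and> (\<forall>y\<in>U. y i \<in> Met_TC.mball (x i) e)"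
      using R.openin_mball by blast
  qed
  have "continuous_map R.mtopology (powertop_real UNIV) id"
    unfolding continuous_map_componentwise_UNIV id_def using coord by blast
  moreover have "id \<in> topspace R.mtopology \<rightarrow> {x. \<forall>i\<ge>n. x i = 0}"
    unfolding R.topspace_mtopology by (simp add: topspace_Euclidean_space)
  ultimately have "continuous_map R.mtopology (subtopology (powertop_real UNIV) {x. \<forall>i\<ge>n. x i = 0}) id"
    unfolding continuous_map_in_subtopology by blast
  then have 2: "continuous_map R.mtopology (Euclidean_space n) id"
    by (simp only: Euclidean_space_def)
  show ?thesis
    unfolding mt topology_eq
    using topology_finer_continuous_id[THEN iffD2, OF _ 1]
      topology_finer_continuous_id[THEN iffD2, OF _ 2] R.topspace_mtopology by blast
qed

inductive polynomial_fun :: "nat \<Rightarrow> ((nat \<Rightarrow> real) \<Rightarrow> real) \<Rightarrow> bool" for n where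
  const: "polynomial_fun n (\<lambda>x. c)"
| coord: "i < n \<Longrightarrow> polynomial_fun n (\<lambda>x. x i)"
| add: "polynomial_fun n p \<Longrightarrow> polynomial_fun n q \<Longrightarrow> polynomial_fun n (\<lambda>x. p x + q x)"
| mult: "polynomial_fun n p \<Longrightarrow> polynomial_fun n q \<Longrightarrow> polynomial_fun n (\<lambda>x. p x * q x)"

text \<open>
  The Boolean algebra of subsets of \<open>\<real>\<^sup>n\<close> generated by the sets \<open>p > 0\<close>. It contains the
  sets \<open>p = 0\<close>, as these are the complements of \<open>{p > 0} \<union> {- p > 0}\<close>.
\<close>

inductive semialgebraic :: "nat \<Rightarrow> (nat \<Rightarrow> real) set \<Rightarrow> bool" for n where
  pos: "polynomial_fun n p \<Longrightarrow> semialgebraic n {x \<in> Rn n. p x > 0}"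
| compl: "semialgebraic n A \<Longrightarrow> semialgebraic n (Rn n - A)"
| union: "semialgebraic n A \<Longrightarrow> semialgebraic n B \<Longrightarrow> semialgebraic n (A \<union> B)"

text \<open>The pairing \<open>\<real>\<^sup>m \<times> \<real>\<^sup>n \<cong> \<real>\<^sup>m\<^sup>+\<^sup>n\<close>, by which the graph of a map becomes a subset of \<open>\<real>\<^sup>m\<^sup>+\<^sup>n\<close>.\<close>

definition join :: "nat \<Rightarrow> (nat \<Rightarrow> real) \<Rightarrow> (nat \<Rightarrow> real) \<Rightarrow> nat \<Rightarrow> real" where
  "join m x y = (\<lambda>i. if i < m then x i else y (i - m))"

definition semialgebraic_map ::
  "nat \<Rightarrow> nat \<Rightarrow> (nat \<Rightarrow> real) set \<Rightarrow> ((nat \<Rightarrow> real) \<Rightarrow> nat \<Rightarrow> real) \<Rightarrow> bool" where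
  "semialgebraic_map m n A f \<longleftrightarrow>
     semialgebraic m A \<and> f ` A \<subseteq> Rn n \<and> semialgebraic (m + n) ((\<lambda>x. join m x (f x)) ` A)"

definition open_cube :: "nat \<Rightarrow> (nat \<Rightarrow> real) set" where
  "open_cube d = {x \<in> Rn d. \<forall>i<d. 0 < x i \<and> x i < 1}"

text \<open>
  \<open>A\<close> contains a cell of dimension \<open>d\<close>: a semialgebraic subset that is semialgebraically
  homeomorphic to \<open>(0,1)\<^sup>d\<close>. The dimension of a semialgebraic set is the largest dimension of
  the cells in it (the empty set has no dimension here).
\<close>

definition contains_cell :: "nat \<Rightarrow> (nat \<Rightarrow> real) set \<Rightarrow> nat \<Rightarrow> bool" where
  "contains_cell n A d \<longleftrightarrow>
     (\<exists>C h. C \<subseteq> A \<and> semialgebraic n C \<and> semialgebraic_map d n (open_cube d) h \<and>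
        homeomorphic_map (subtopology (Euclidean_space d) (open_cube d))
          (subtopology (Euclidean_space n) C) h)"

definition has_dimension :: "nat \<Rightarrow> (nat \<Rightarrow> real) set \<Rightarrow> nat \<Rightarrow> bool" where
  "has_dimension n A k \<longleftrightarrow> contains_cell n A k \<and> (\<forall>d. contains_cell n A d \<longrightarrow> d \<le> k)"

text \<open>
  Germs at the origin are given by representatives. The dimension of the germ \<open>(X,0)\<close> is that
  of its small representatives, which may be less than the dimension of \<open>X\<close>.
\<close>

definition germ_has_dimension :: "nat \<Rightarrow> (nat \<Rightarrow> real) set \<Rightarrow> nat \<Rightarrow> bool" where
  "germ_has_dimension n X k \<longleftrightarrow>
     (\<forall>\<^sub>F r in at_right 0. has_dimension n (X \<inter> mball_of (Rn_metric n) origin r) k)"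

definition closed_semialgebraic_germ :: "nat \<Rightarrow> (nat \<Rightarrow> real) set \<Rightarrow> bool" where
  "closed_semialgebraic_germ n X \<longleftrightarrow>
     semialgebraic n X \<and> closedin (Euclidean_space n) X \<and> origin \<in> X"

text \<open>
  The germ at \<open>0\<close> of \<open>f\<close> is a bi-Lipschitz and semialgebraic embedding
  \<open>(X,0) \<rightarrow> (\<real>\<^sup>n,0)\<close> with image germ \<open>(Y,0)\<close>. A germ of a bijection \<open>(X,0) \<rightarrow> (Y,0)\<close> whose
  two directions are continuous is a bijection between neighbourhoods \<open>X \<inter> U\<close> and \<open>Y \<inter> V\<close>
  of \<open>0\<close> in \<open>X\<close> and in \<open>Y\<close>; nothing is asked of \<open>f\<close> outside \<open>X \<inter> U\<close>.
\<close>

definition bilipschitz_semialgebraic_embedding ::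
  "nat \<Rightarrow> nat \<Rightarrow> (nat \<Rightarrow> real) set \<Rightarrow> ((nat \<Rightarrow> real) \<Rightarrow> nat \<Rightarrow> real) \<Rightarrow> bool" where
  "bilipschitz_semialgebraic_embedding m n X f \<longleftrightarrow>
     f origin = origin \<and>
     (\<exists>Y U V. closed_semialgebraic_germ n Y \<and>
        openin (Euclidean_space m) U \<and> origin \<in> U \<and>
        openin (Euclidean_space n) V \<and> origin \<in> V \<and>
        bij_betw f (X \<inter> U) (Y \<inter> V) \<and>
        semialgebraic_map m n (X \<inter> U) f \<and>
        semialgebraic_map n m (Y \<inter> V) (inv_into (X \<inter> U) f) \<and>
        Lipschitz_continuous_map
          (submetric (Rn_metric m) (X \<inter> U)) (submetric (Rn_metric n) (Y \<inter> V)) f \<and>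
        Lipschitz_continuous_map
          (submetric (Rn_metric n) (Y \<inter> V)) (submetric (Rn_metric m) (X \<inter> U))
          (inv_into (X \<inter> U) f))"

end

theory Submission
  imports Defs "HOL-Computational_Algebra.Polynomial" "HOL-Library.Multiset"
begin

text \<open>
  A Hilbert function count takes the place of a dimension theory of semialgebraic sets. Let \<open>K\<close> be the part of \<open>X\<close>
  in a small closed ball: it is compact, semialgebraic and contains no cell of dimension \<open>k + 1\<close>.

  \<^item> \<open>image_thin_or_contains_cell\<close>: if \<open>\<pi>\<close> is a polynomial map to \<open>\<real>\<^sup>k\<^sup>+\<^sup>1\<close>, then some nonzero polynomial
    vanishes on \<open>\<pi> ` K\<close>. Otherwise \<open>\<pi> ` K\<close> has interior points, and the lexicographic minima of
    the fibres of \<open>\<pi>\<close> form a semialgebraic section. It is continuous on some box, over which it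
    parametrizes a cell in \<open>K\<close>. Thus any \<open>k + 1\<close> coordinates satisfy a polynomial relation on \<open>K\<close>.
  \<^item> \<open>differences_algebraic_relation\<close>: hence the polynomials of degree at most \<open>N\<close> span a space of
    functions on \<open>K\<close> of dimension \<open>O(N\<^sup>k)\<close>, and those on \<open>K \<times> K\<close> one of dimension \<open>O(N\<^sup>2\<^sup>k)\<close>. If \<open>2 k < m\<close>,
    the \<open>(M + 1)\<^sup>m\<close> monomials in \<open>x - y\<close> with all exponents at most \<open>M\<close> are therefore linearly dependent
    on \<open>K \<times> K\<close> for large \<open>M\<close>: a nonzero polynomial \<open>P\<close> vanishes at all differences of points of \<open>K\<close>.
  \<^item> \<open>secants_avoid_direction\<close>: let \<open>d\<close> be the lowest degree occurring in \<open>P\<close> and \<open>P\<^sub>d\<close> its part of degree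
    \<open>d\<close>. Dividing \<open>P(t u) = 0\<close> by \<open>t\<^sup>d\<close>, one sees that \<open>P\<^sub>d\<close> vanishes at all limits of secant directions,
    so a direction \<open>v\<close> with \<open>P\<^sub>d(v) \<noteq> 0\<close> stays away from the directions of all short secants of \<open>K\<close>.
  \<^item> \<open>flattens_step\<close>: the linear projection along \<open>v\<close> is then bi-Lipschitz on a smaller piece of \<open>X\<close>.
    It lowers the dimension of the target by one, and it can be repeated until \<open>2 k\<close> is reached.

  Semialgebraicity of images and of quantified formulas is the theorem of Tarski and Seidenberg,
  proved in \<open>tarski_seidenberg\<close> by the method of Cohen and Hoermander: the signs of finitely many
  polynomials in the parameters determine, up to an increasing bijection of \<open>\<real>\<close>, the sign pattern
  of a finite family of polynomials in one variable.
\<close>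

section \<open>Polynomial functions and semialgebraic predicates\<close>

text \<open>Polynomial functions of finitely many of the coordinates \<open>x 0, x 1, \<dots>\<close>, with no bound on their number.\<close>

definition polyfun :: "((nat \<Rightarrow> real) \<Rightarrow> real) \<Rightarrow> bool" where
  "polyfun p \<longleftrightarrow> (\<exists>n. polynomial_fun n p)"

lemma polynomial_fun_mono: "polynomial_fun n p \<Longrightarrow> n \<le> n' \<Longrightarrow> polynomial_fun n' p"
  by (induction rule: polynomial_fun.induct) (auto intro: polynomial_fun.intros)

lemma polyfun_const [intro, simp]: "polyfun (\<lambda>x. c)"
  by (auto simp: polyfun_def intro: polynomial_fun.intros)

lemma polyfun_coord [intro, simp]: "polyfun (\<lambda>x. x i)"
  by (auto simp: polyfun_def intro: polynomial_fun.intros)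

lemma polyfun_add [intro]: assumes "polyfun p" "polyfun q" shows "polyfun (\<lambda>x. p x + q x)"
proof -
  obtain m n where "polynomial_fun m p" "polynomial_fun n q" using assms by (auto simp: polyfun_def)
  then have "polynomial_fun (max m n) p" "polynomial_fun (max m n) q" by (auto elim: polynomial_fun_mono)
  then show ?thesis unfolding polyfun_def by (blast intro: polynomial_fun.add)
qed

lemma polyfun_mult [intro]: assumes "polyfun p" "polyfun q" shows "polyfun (\<lambda>x. p x * q x)"
proof -
  obtain m n where "polynomial_fun m p" "polynomial_fun n q" using assms by (auto simp: polyfun_def)
  then have "polynomial_fun (max m n) p" "polynomial_fun (max m n) q" by (auto elim: polynomial_fun_mono)
  then show ?thesis unfolding polyfun_def by (blast intro: polynomial_fun.mult)
qed

lemma polyfun_induct [consumes 1, case_names const coord add mult]: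
  assumes "polyfun p" and "\<And>c. P (\<lambda>x. c)" and "\<And>i. P (\<lambda>x. x i)"
    and "\<And>p q. \<lbrakk>polyfun p; P p; polyfun q; P q\<rbrakk> \<Longrightarrow> P (\<lambda>x. p x + q x)"
    and "\<And>p q. \<lbrakk>polyfun p; P p; polyfun q; P q\<rbrakk> \<Longrightarrow> P (\<lambda>x. p x * q x)"
  shows "P p"
proof -
  obtain n where "polynomial_fun n p" using assms(1) by (auto simp: polyfun_def)
  then show ?thesis
  proof (induction rule: polynomial_fun.induct)
    case (add p q) then show ?case by (intro assms(4)) (auto simp: polyfun_def)
  next
    case (mult p q) then show ?case by (intro assms(5)) (auto simp: polyfun_def)
  qed (simp_all add: assms(2,3))
qed

lemma polyfun_minus [intro]: "polyfun p \<Longrightarrow> polyfun (\<lambda>x. - p x)"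
  using polyfun_mult[OF polyfun_const[of "-1"], of p] by simp

lemma polyfun_diff [intro]: "polyfun p \<Longrightarrow> polyfun q \<Longrightarrow> polyfun (\<lambda>x. p x - q x)"
  using polyfun_add[OF _ polyfun_minus, of p q] by simp

lemma polyfun_power [intro]: "polyfun p \<Longrightarrow> polyfun (\<lambda>x. p x ^ n)" by (induction n) auto

lemma polyfun_sum [intro]: "(\<And>i. i \<in> I \<Longrightarrow> polyfun (p i)) \<Longrightarrow> polyfun (\<lambda>x. \<Sum>i\<in>I. p i x)"
  by (induction I rule: infinite_finite_induct) auto

lemma polyfun_prod [intro]: "(\<And>i. i \<in> I \<Longrightarrow> polyfun (p i)) \<Longrightarrow> polyfun (\<lambda>x. \<Prod>i\<in>I. p i x)"
  by (induction I rule: infinite_finite_induct) auto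

lemma polyfun_divide_const [intro]: "polyfun p \<Longrightarrow> polyfun (\<lambda>x. p x / c)"
  using polyfun_mult[OF _ polyfun_const[of "inverse c"], of p] by (simp add: divide_inverse)

lemma polyfun_compose: "polyfun p \<Longrightarrow> (\<And>i. polyfun (\<lambda>e. T e i)) \<Longrightarrow> polyfun (\<lambda>e. p (T e))"
  by (induction rule: polyfun_induct) auto

text \<open>The projection of all sequences onto \<open>\<real>\<^sup>n\<close>.\<close>

definition trunc :: "nat \<Rightarrow> (nat \<Rightarrow> real) \<Rightarrow> nat \<Rightarrow> real" where
  "trunc n x = (\<lambda>i. if i < n then x i else 0)"

lemma mem_Rn_iff: "x \<in> Rn n \<longleftrightarrow> (\<forall>i\<ge>n. x i = 0)"
  by (simp add: topspace_Euclidean_space)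

lemma trunc_in_Rn [simp]: "trunc n x \<in> Rn n" by (simp add: mem_Rn_iff trunc_def)

lemma trunc_id: "x \<in> Rn n \<Longrightarrow> trunc n x = x" by (auto simp: mem_Rn_iff trunc_def fun_eq_iff)

lemma polyfun_trunc [intro]: "polyfun (\<lambda>e. T e i) \<Longrightarrow> polyfun (\<lambda>e. trunc n (T e) i)"
  by (cases "i < n") (simp_all add: trunc_def)

lemma polynomial_fun_trunc: "polyfun p \<Longrightarrow> polynomial_fun n (\<lambda>x. p (trunc n x))"
proof (induction rule: polyfun_induct)
  case (coord i)
  then show ?case by (cases "i < n") (auto simp: trunc_def intro: polynomial_fun.intros)
qed (auto intro: polynomial_fun.intros)

text \<open>
  A predicate on sequences is semialgebraic if its truth value is determined by the signs of finitely
  many polynomials. In this form the closure under Boolean operations and polynomial substitution is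
  immediate. Sets in \<open>\<real>\<^sup>n\<close> are related to it by \<open>semialgebraic_imp_semialg\<close> and \<open>semialg_imp_semialgebraic\<close>.
\<close>

definition semialg :: "((nat \<Rightarrow> real) \<Rightarrow> bool) \<Rightarrow> bool" where
  "semialg P \<longleftrightarrow> (\<exists>D. finite D \<and> (\<forall>d\<in>D. polyfun d) \<and> (\<forall>x y. (\<forall>d\<in>D. sgn (d x) = sgn (d y)) \<longrightarrow> P x = P y))"

lemma semialg_const [simp]: "semialg (\<lambda>x. c)" by (auto simp: semialg_def)

lemma semialg_not: "semialg P \<Longrightarrow> semialg (\<lambda>x. \<not> P x)" by (auto simp: semialg_def)

lemma semialg_and: assumes "semialg P" "semialg Q" shows "semialg (\<lambda>x. P x \<and> Q x)"
proof -
  obtain D where D: "finite D" "\<forall>d\<in>D. polyfun d" "\<forall>x y. (\<forall>d\<in>D. sgn (d x) = sgn (d y)) \<longrightarrow> P x = P y"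
    using assms(1) unfolding semialg_def by blast
  obtain E where E: "finite E" "\<forall>d\<in>E. polyfun d" "\<forall>x y. (\<forall>d\<in>E. sgn (d x) = sgn (d y)) \<longrightarrow> Q x = Q y"
    using assms(2) unfolding semialg_def by blast
  show ?thesis unfolding semialg_def
  proof (intro exI[of _ "D \<union> E"] conjI allI impI)
    fix x y assume "\<forall>d\<in>D \<union> E. sgn (d x) = sgn (d y)"
    then show "(P x \<and> Q x) = (P y \<and> Q y)" using D(3) E(3) by (metis UnI1 UnI2)
  qed (use D E in auto)
qed

lemma semialg_or: "semialg P \<Longrightarrow> semialg Q \<Longrightarrow> semialg (\<lambda>x. P x \<or> Q x)"
  using semialg_not[OF semialg_and[OF semialg_not semialg_not], of P Q] by simp

lemma semialg_imp: "semialg P \<Longrightarrow> semialg Q \<Longrightarrow> semialg (\<lambda>x. P x \<longrightarrow> Q x)"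
  unfolding imp_conv_disj by (intro semialg_or semialg_not)

lemma semialg_ball: "finite I \<Longrightarrow> (\<And>i. i \<in> I \<Longrightarrow> semialg (\<lambda>x. P x i)) \<Longrightarrow> semialg (\<lambda>x. \<forall>i\<in>I. P x i)"
  by (induction I rule: finite_induct) (auto intro: semialg_and)

lemma semialg_bex: "finite I \<Longrightarrow> (\<And>i. i \<in> I \<Longrightarrow> semialg (\<lambda>x. P x i)) \<Longrightarrow> semialg (\<lambda>x. \<exists>i\<in>I. P x i)"
  by (induction I rule: finite_induct) (auto intro: semialg_or)

lemma semialg_all_less: "(\<And>i. i < (n::nat) \<Longrightarrow> semialg (\<lambda>x. P x i)) \<Longrightarrow> semialg (\<lambda>x. \<forall>i<n. P x i)"
  using semialg_ball[of "{..<n}" P] by (simp add: Ball_def)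

lemma semialg_ex_less: "(\<And>i. i < (n::nat) \<Longrightarrow> semialg (\<lambda>x. P x i)) \<Longrightarrow> semialg (\<lambda>x. \<exists>i<n. P x i)"
  using semialg_bex[of "{..<n}" P] by (simp add: Bex_def)

lemma semialg_less: assumes "polyfun p" "polyfun q" shows "semialg (\<lambda>x. p x < q x)"
  unfolding semialg_def
proof (intro exI[of _ "{\<lambda>x. q x - p x}"] conjI allI impI)
  fix x y assume "\<forall>d\<in>{\<lambda>x. q x - p x}. sgn (d x) = sgn (d y)"
  then show "(p x < q x) = (p y < q y)" by (auto simp: sgn_if split: if_splits)
qed (use assms in auto)

lemma semialg_le: "polyfun p \<Longrightarrow> polyfun q \<Longrightarrow> semialg (\<lambda>x. p x \<le> q x)"
  using semialg_not[OF semialg_less, of q p] by (simp add: not_less)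

lemma semialg_eq: "polyfun p \<Longrightarrow> polyfun q \<Longrightarrow> semialg (\<lambda>x. p x = q x)"
  using semialg_and[OF semialg_le semialg_le, of p q q p] by (simp add: order_eq_iff)

lemma semialg_subst: assumes "semialg P" "\<And>i. polyfun (\<lambda>e. T e i)" shows "semialg (\<lambda>e. P (T e))"
proof -
  obtain D where D: "finite D" "\<forall>d\<in>D. polyfun d" "\<And>x y. (\<forall>d\<in>D. sgn (d x) = sgn (d y)) \<Longrightarrow> P x = P y"
    using assms(1) by (auto simp: semialg_def)
  show ?thesis unfolding semialg_def by (intro exI[of _ "(\<lambda>d e. d (T e)) ` D"] conjI)
       (use D in \<open>auto intro!: polyfun_compose[OF _ assms(2)]\<close>)
qed

lemma semialgebraic_empty: "semialgebraic n {}"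
  using semialgebraic.pos[OF polynomial_fun.const[of n 0]] by simp

lemma semialgebraic_Int:
  assumes "semialgebraic n A" "semialgebraic n B"
  shows "semialgebraic n (A \<inter> B)"
proof -
  have sub: "A \<subseteq> Rn n" if "semialgebraic n A" for A
    using that by induction auto
  have "A \<inter> B = Rn n - ((Rn n - A) \<union> (Rn n - B))"
    using sub[OF assms(1)] sub[OF assms(2)] by auto
  then show ?thesis using assms by (auto intro!: semialgebraic.intros)
qed

lemma semialgebraic_subset_Rn: "semialgebraic n A \<Longrightarrow> A \<subseteq> Rn n"
  by (induction rule: semialgebraic.induct) auto

lemma semialgebraic_imp_semialg: "semialgebraic n A \<Longrightarrow> semialg (\<lambda>x. trunc n x \<in> A)"
proof (induction rule: semialgebraic.induct)
  case (pos p)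
  then have "polyfun p" by (auto simp: polyfun_def)
  then have "polyfun (\<lambda>x. p (trunc n x))" by (rule polyfun_compose[where T = "trunc n"]) (simp add: polyfun_trunc)
  then show ?case using semialg_less[OF polyfun_const[of 0]] by simp
next
  case (compl A) then show ?case by (simp add: semialg_not)
next
  case (union A B) then show ?case by (simp add: semialg_or)
qed

lemma semialg_mem: "semialgebraic n A \<Longrightarrow> (\<And>i. polyfun (\<lambda>e. T e i)) \<Longrightarrow> semialg (\<lambda>e. trunc n (T e) \<in> A)"
  using semialg_subst[OF semialgebraic_imp_semialg] .

lemma semialgebraic_sgn:
  assumes "polyfun d"
  shows "semialgebraic n {x \<in> Rn n. sgn (d x) = s}"
proof -
  have pos: "semialgebraic n {x \<in> Rn n. 0 < p x}" if "polyfun p" for p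
  proof -
    have "{x \<in> Rn n. 0 < p x} = {x \<in> Rn n. 0 < p (trunc n x)}" by (auto simp: trunc_id)
    then show ?thesis using semialgebraic.pos[OF polynomial_fun_trunc[OF that]] by simp
  qed
  note P = pos[OF assms] and N = pos[OF polyfun_minus[OF assms]]
  have Z: "{x \<in> Rn n. sgn (d x) = 0} = Rn n - ({x \<in> Rn n. 0 < d x} \<union> {x \<in> Rn n. 0 < - d x})"
    by (auto simp: sgn_if)
  consider "s = 1" | "s = -1" | "s = 0" | "\<forall>x. sgn (d x) \<noteq> s" by (metis sgn_if)
  then show ?thesis
  proof cases
    case 1 with P show ?thesis by (simp add: sgn_1_pos)
  next
    case 2 with N show ?thesis by (simp add: sgn_1_neg)
  next
    case 3 show ?thesis unfolding 3 Z by (intro semialgebraic.intros P N)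
  qed (simp add: semialgebraic_empty)
qed

lemma semialg_imp_semialgebraic:
  assumes "semialg P"
  shows "semialgebraic n {x \<in> Rn n. P x}"
proof -
  obtain D where D: "finite D" "\<forall>d\<in>D. polyfun d" "\<And>x y. (\<forall>d\<in>D. sgn (d x) = sgn (d y)) \<Longrightarrow> P x = P y"
    using assms by (auto simp: semialg_def)
  have *: "semialgebraic n {x \<in> Rn n. \<exists>y. Q y \<and> (\<forall>d\<in>D. sgn (d x) = sgn (d y))}" for Q
    using D(1,2)
  proof (induction D arbitrary: Q rule: finite_induct)
    case empty
    have "Rn n = Rn n - {}" by simp
    then have "semialgebraic n (Rn n)" by (metis semialgebraic.compl semialgebraic_empty)
    then show ?case by (cases "\<exists>y. Q y") (simp_all add: semialgebraic_empty)
  next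
    case (insert d D)
    define A where "A s = {x \<in> Rn n. sgn (d x) = s} \<inter>
      {x \<in> Rn n. \<exists>y. (Q y \<and> sgn (d y) = s) \<and> (\<forall>d\<in>D. sgn (d x) = sgn (d y))}" for s
    have A: "semialgebraic n (A s)" for s
      unfolding A_def using insert.prems by (intro semialgebraic_Int semialgebraic_sgn insert.IH) auto
    have "sgn (d x) \<in> {-1, 0, 1}" for x by (auto simp: sgn_if)
    then have "{x \<in> Rn n. \<exists>y. Q y \<and> (\<forall>d\<in>insert d D. sgn (d x) = sgn (d y))} = A (-1) \<union> (A 0 \<union> A 1)"
    proof (intro set_eqI iffI)
      fix x assume "x \<in> {x \<in> Rn n. \<exists>y. Q y \<and> (\<forall>d\<in>insert d D. sgn (d x) = sgn (d y))}"
      then have "x \<in> A (sgn (d x))" unfolding A_def by auto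
      then show "x \<in> A (-1) \<union> (A 0 \<union> A 1)" using \<open>\<And>x. sgn (d x) \<in> {-1, 0, 1}\<close>[of x] by auto
    qed (auto simp: A_def)
    then show ?case by (simp only: semialgebraic.union A)
  qed
  have "{x \<in> Rn n. P x} = {x \<in> Rn n. \<exists>y. P y \<and> (\<forall>d\<in>D. sgn (d x) = sgn (d y))}"
    using D(3) by blast
  then show ?thesis using * by simp
qed

section \<open>Real polynomials with the same sign pattern\<close>

text \<open>
  The increasing bijection \<open>\<phi>\<close> of \<open>\<real>\<close> matches the signs of the derivatives of \<open>p\<close> and \<open>q\<close>, and those of
  \<open>p\<close> and \<open>q\<close> themselves on the finite set \<open>Z\<close>, which contains all critical points of \<open>p\<close>. On
  corresponding intervals between points of \<open>Z\<close> and of \<open>\<phi> ` Z\<close> both are strictly monotone, in the same sense. The notion is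
  invariant under negation, reflection of the line and exchange of \<open>p\<close> and \<open>q\<close>.
\<close>

definition matched :: "(real \<Rightarrow> real) \<Rightarrow> real set \<Rightarrow> real poly \<Rightarrow> real poly \<Rightarrow> bool" where
  "matched \<phi> Z p q \<longleftrightarrow> strict_mono \<phi> \<and> surj \<phi> \<and> finite Z \<and> (\<forall>t. poly (pderiv p) t = 0 \<longrightarrow> t \<in> Z) \<and>
     (\<forall>t\<in>Z. sgn (poly p t) = sgn (poly q (\<phi> t))) \<and>
     (\<forall>t. sgn (poly (pderiv p) t) = sgn (poly (pderiv q) (\<phi> t)))"

lemma bij_if_strict_mono_surj: "strict_mono (\<phi> :: real \<Rightarrow> real) \<Longrightarrow> surj \<phi> \<Longrightarrow> bij \<phi>"
  by (simp add: bij_def strict_mono_eq inj_def)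

lemma matched_neg: "matched \<phi> Z p q \<Longrightarrow> matched \<phi> Z (- p) (- q)"
  by (simp add: matched_def pderiv_minus sgn_minus)

lemma matched_inv:
  assumes "matched \<phi> Z p q"
  shows "matched (inv \<phi>) (\<phi> ` Z) q p"
proof -
  have b: "bij \<phi>" "strict_mono \<phi>" using assms by (auto simp: matched_def bij_if_strict_mono_surj)
  have i: "\<phi> (inv \<phi> t) = t" "inv \<phi> (\<phi> t) = t" for t
    using b by (simp_all add: bij_is_surj surj_f_inv_f bij_is_inj)
  have "strict_mono (inv \<phi>)"
    using b(2) by (intro strict_monoI) (metis i(1) strict_mono_less)
  moreover have "surj (inv \<phi>)" using b(1) by (simp add: bij_imp_bij_inv bij_is_surj)
  moreover have "t \<in> \<phi> ` Z" if "poly (pderiv q) t = 0" for t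
  proof -
    have "sgn (poly (pderiv p) (inv \<phi> t)) = 0"
      using assms that i by (simp add: matched_def)
    then have "inv \<phi> t \<in> Z" using assms by (simp add: matched_def sgn_0_0)
    then show ?thesis using i(1)[of t] by (metis imageI)
  qed
  ultimately show ?thesis using assms i by (auto simp: matched_def)
qed

lemma matched_reflect:
  assumes "matched \<phi> Z p q"
  shows "matched (\<lambda>t. - \<phi> (- t)) (uminus ` Z) (pcompose p [:0, -1:]) (pcompose q [:0, -1:])"
proof -
  have m: "strict_mono \<phi>" "surj \<phi>" using assms by (auto simp: matched_def)
  have "strict_mono (\<lambda>t. - \<phi> (- t))"
    using m(1) by (auto simp: strict_mono_def)
  moreover have "surj (\<lambda>t. - \<phi> (- t))"
    by (rule surjI[of _ "\<lambda>t. - inv \<phi> (- t)"]) (simp add: surj_f_inv_f[OF m(2)])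
  moreover have "t \<in> uminus ` Z" if "poly (pderiv (pcompose p [:0, -1:])) t = 0" for t
  proof -
    have "- t \<in> Z" using that assms by (simp add: matched_def pderiv_pcompose poly_pcompose pderiv_pCons)
    then show ?thesis by force
  qed
  ultimately show ?thesis
    using assms by (auto simp: matched_def pderiv_pcompose poly_pcompose pderiv_pCons sgn_minus)
qed

lemma poly_no_root_same_sgn:
  fixes p :: "real poly"
  assumes "\<And>x. \<lbrakk>a \<le> x; x \<le> b\<rbrakk> \<Longrightarrow> poly p x \<noteq> 0" "a \<le> b"
  shows "sgn (poly p a) = sgn (poly p b)"
proof (rule ccontr)
  assume n: "sgn (poly p a) \<noteq> sgn (poly p b)"
  then have "a < b" using assms(2) by (cases "a = b") auto
  moreover have "poly p a * poly p b < 0"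
    using n assms(1)[of a] assms(1)[of b] assms(2) by (auto simp: sgn_if mult_less_0_iff split: if_splits)
  ultimately show False using poly_IVT[of a b p] assms(1) by force
qed

lemma poly_increasing:
  fixes p :: "real poly"
  assumes "\<And>x. \<lbrakk>a < x; x < b\<rbrakk> \<Longrightarrow> 0 < poly (pderiv p) x" "a < b"
  shows "poly p a < poly p b"
  using poly_MVT[OF assms(2), of p] assms by (metis diff_gt_0_iff_gt mult_pos_pos)

lemma poly_increasing_unbounded:
  fixes q :: "real poly"
  assumes "\<And>x. u \<le> x \<Longrightarrow> 0 < poly (pderiv q) x"
  shows "\<exists>s\<ge>u. 0 < poly q s"
proof -
  have "0 < lead_coeff (pderiv q)"
  proof (rule ccontr)
    assume "\<not> ?thesis"
    moreover have "pderiv q \<noteq> 0" using assms[of u] by auto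
    ultimately have "0 < lead_coeff (- pderiv q)" by (simp add: less_le)
    from poly_pinfty_gt_lc[OF this] obtain n where n: "\<And>x. x \<ge> n \<Longrightarrow> lead_coeff (- pderiv q) \<le> poly (- pderiv q) x" by blast
    have "0 < poly (- pderiv q) (max n u)" using n[of "max n u"] \<open>0 < lead_coeff (- pderiv q)\<close> by simp
    then show False using assms[of "max n u"] by simp
  qed
  then have "0 < lead_coeff q"
    by (cases "degree q") (auto simp: degree_pderiv coeff_pderiv zero_less_mult_iff pderiv_eq_0_iff coeff_eq_0)
  from poly_pinfty_gt_lc[OF this] obtain n where "\<And>x. x \<ge> n \<Longrightarrow> lead_coeff q \<le> poly q x" by blast
  then have "0 < poly q (max n u)" using \<open>0 < lead_coeff q\<close> by (metis less_le_trans max.cobounded1)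
  then show ?thesis by (metis max.cobounded2)
qed

text \<open>
  To the right of \<open>\<phi> t\<close>, before the next point of \<open>\<phi> ` Z\<close>, the polynomial \<open>q\<close> becomes positive: there
  it has the sign of \<open>p\<close>, which has increased from \<open>p t\<close>; if there is no such point, \<open>q\<close> increases without bound.
\<close>

lemma matched_right:
  assumes m: "matched \<phi> Z p q" and t: "t \<notin> Z" "0 < poly (pderiv p) t" "0 \<le> poly p t"
  shows "\<exists>s\<ge>\<phi> t. 0 < poly q s \<and> {\<phi> t..<s} \<inter> \<phi> ` Z = {}"
proof -
  note mq = matched_inv[OF m]
  have fin: "finite Z" and mono: "strict_mono \<phi>" and nz: "\<And>x. x \<notin> Z \<Longrightarrow> poly (pderiv p) x \<noteq> 0"
    using m by (auto simp: matched_def)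
  have pos: "0 < poly (pderiv p) x" if "t \<le> x" "{t..x} \<inter> Z = {}" for x
    using poly_no_root_same_sgn[of t x "pderiv p"] that nz t(2)
    by (smt (verit) atLeastAtMost_iff disjoint_iff sgn_1_pos)
  have tq: "0 < poly (pderiv q) (\<phi> t)"
    using m t(2) by (metis matched_def sgn_1_pos)
  have nzq: "x \<in> \<phi> ` Z" if "poly (pderiv q) x = 0" for x
    using mq that by (simp add: matched_def)
  show ?thesis
  proof (cases "Z \<inter> {t..} = {}")
    case True
    have "\<phi> ` Z \<inter> {\<phi> t..} = {}"
      using True mono by (auto simp: strict_mono_less_eq)
    then have "0 < poly (pderiv q) x" if "\<phi> t \<le> x" for x
      using poly_no_root_same_sgn[of "\<phi> t" x "pderiv q"] that nzq tq
      by (smt (verit) atLeast_iff disjoint_iff sgn_1_pos)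
    from poly_increasing_unbounded[OF this] show ?thesis
      using \<open>\<phi> ` Z \<inter> {\<phi> t..} = {}\<close> by fastforce
  next
    case False
    define b where "b = Min (Z \<inter> {t..})"
    have b: "b \<in> Z" "t \<le> b" using Min_in[of "Z \<inter> {t..}"] fin False by (auto simp: b_def)
    have bmin: "b \<le> z" if "z \<in> Z" "t \<le> z" for z
      using that fin by (auto simp: b_def)
    have "t < b" using b t(1) by (cases "t = b") auto
    have "poly p t < poly p b"
    proof (rule poly_increasing[OF _ \<open>t < b\<close>])
      fix x assume "t < x" "x < b"
      then show "0 < poly (pderiv p) x" using bmin by (intro pos) fastforce+
    qed
    then have "0 < poly p b" using t by simp
    then have "0 < poly q (\<phi> b)" using m b(1) by (metis matched_def sgn_1_pos)
    moreover have "{\<phi> t..<\<phi> b} \<inter> \<phi> ` Z = {}"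
      using bmin mono by (auto simp: strict_mono_less_eq strict_mono_less) fastforce
    ultimately show ?thesis using \<open>t < b\<close> mono by (metis less_imp_le strict_monoD)
  qed
qed

lemma matched_left:
  assumes m: "matched \<phi> Z p q" and t: "t \<notin> Z" "0 < poly (pderiv p) t" "poly p t \<le> 0"
  shows "\<exists>s\<le>\<phi> t. poly q s < 0 \<and> {s<..\<phi> t} \<inter> \<phi> ` Z = {}"
proof -
  have "\<exists>s\<ge>- \<phi> (- (- t)). 0 < poly (- pcompose q [:0, -1:]) s \<and>
      {- \<phi> (- (- t))..<s} \<inter> (\<lambda>t. - \<phi> (- t)) ` uminus ` Z = {}"
    using t by (intro matched_right[OF matched_neg[OF matched_reflect[OF m]]])
      (auto simp: poly_pcompose pderiv_pcompose pderiv_minus pderiv_pCons)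
  then obtain s where s: "s \<ge> - \<phi> t" "poly q (- s) < 0" "{- \<phi> t..<s} \<inter> (\<lambda>t. - \<phi> t) ` Z = {}"
    by (auto simp: poly_pcompose image_image)
  have "{- s<..\<phi> t} \<inter> \<phi> ` Z = {}"
  proof (rule equals0I)
    fix y assume "y \<in> {- s<..\<phi> t} \<inter> \<phi> ` Z"
    then have "- y \<in> {- \<phi> t..<s} \<inter> (\<lambda>t. - \<phi> t) ` Z" by auto
    then show False using s(3) by blast
  qed
  then show ?thesis using s by (intro exI[of _ "- s"]) auto
qed

text \<open>A root of \<open>p\<close> outside \<open>Z\<close> has a counterpart among the roots of \<open>q\<close> in the corresponding interval.\<close>

lemma matched_root:
  assumes m: "matched \<phi> Z p q" and t: "t \<notin> Z" "poly p t = 0"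
  shows "\<exists>s. poly q s = 0 \<and> closed_segment (\<phi> t) s \<inter> \<phi> ` Z = {}"
proof -
  have *: "\<exists>s. poly q s = 0 \<and> closed_segment (\<phi> t) s \<inter> \<phi> ` Z = {}"
    if m: "matched \<phi> Z p q" and t: "t \<notin> Z" "poly p t = 0" and pos: "0 < poly (pderiv p) t" for p q
  proof -
    obtain a b where a: "a \<le> \<phi> t" "poly q a < 0" "{a<..\<phi> t} \<inter> \<phi> ` Z = {}"
      and b: "\<phi> t \<le> b" "0 < poly q b" "{\<phi> t..<b} \<inter> \<phi> ` Z = {}"
      using matched_left[OF m] matched_right[OF m] t pos by (metis order_refl)
    have "a < b" using a b by (cases "a = b") auto
    from poly_IVT_pos[OF this a(2) b(2)] obtain s where s: "a < s" "s < b" "poly q s = 0" by blast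
    have "closed_segment (\<phi> t) s \<subseteq> {a<..\<phi> t} \<union> {\<phi> t..<b}"
      using s a b by (auto simp: closed_segment_eq_real_ivl split: if_splits)
    then show ?thesis using a b s by blast
  qed
  have "poly (pderiv p) t \<noteq> 0" using m t by (auto simp: matched_def)
  then consider "0 < poly (pderiv p) t" | "0 < poly (pderiv (- p)) t" by (fastforce simp: pderiv_minus)
  then show ?thesis
    using *[OF m t] *[OF matched_neg[OF m] t(1)] t(2) by cases auto
qed

lemma matched_root_unique:
  assumes m: "matched \<phi> Z p q" and "poly p r = 0" "poly p s = 0" "closed_segment r s \<inter> Z = {}"
  shows "r = s"
proof (rule ccontr)
  assume "r \<noteq> s"
  have *: False if ab: "a < b" "poly p a = 0" "poly p b = 0" "{a..b} \<inter> Z = {}" for a b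
  proof -
    obtain x where x: "a < x" "x < b" "poly (pderiv p) x = 0"
      using poly_MVT[OF ab(1), of p] ab by auto
    then have "x \<in> Z" using m by (simp add: matched_def)
    then show False using x ab(4) by (auto simp: disjoint_iff)
  qed
  show False
    using *[of r s] *[of s r] assms \<open>r \<noteq> s\<close> by (auto simp: closed_segment_eq_real_ivl split: if_splits)
qed

lemma matched_closed_segment_image:
  fixes \<phi> :: "real \<Rightarrow> real"
  assumes "strict_mono \<phi>" "surj \<phi>"
  shows "closed_segment (\<phi> r) (\<phi> s) \<inter> \<phi> ` Z = {} \<longleftrightarrow> closed_segment r s \<inter> Z = {}"
proof -
  have "\<phi> z \<in> closed_segment (\<phi> r) (\<phi> s) \<longleftrightarrow> z \<in> closed_segment r s" for z
    using assms(1) by (auto simp: closed_segment_eq_real_ivl strict_mono_less_eq)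
  then show ?thesis by blast
qed

lemma matched_roots_sgn:
  assumes m: "matched \<phi> Z p q" and roots: "\<And>r. poly p r = 0 \<Longrightarrow> poly q (\<phi> r) = 0"
  shows "sgn (poly p t) = sgn (poly q (\<phi> t))"
proof -
  have root_iff: "poly p t = 0 \<longleftrightarrow> poly q (\<phi> t) = 0"
    if m: "matched \<phi> Z p q" and roots: "\<And>r. poly p r = 0 \<Longrightarrow> poly q (\<phi> r) = 0" for p q t
  proof
    assume q0: "poly q (\<phi> t) = 0"
    have m': "strict_mono \<phi>" "surj \<phi>" using m by (auto simp: matched_def)
    have i: "inv \<phi> (\<phi> t) = t" for t using m' by (simp add: strict_mono_eq inj_def)
    show "poly p t = 0"
    proof (cases "t \<in> Z")
      case True then show ?thesis using m q0 by (metis matched_def sgn_0_0 sgn_zero)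
    next
      case False
      then have "\<phi> t \<notin> \<phi> ` Z" using m' by (auto simp: strict_mono_eq)
      from matched_root[OF matched_inv[OF m] this q0] obtain r where
        r: "poly p r = 0" "closed_segment t r \<inter> Z = {}" by (auto simp: i image_image)
      have "\<phi> t = \<phi> r" by (rule matched_root_unique[OF matched_inv[OF m] q0 roots[OF r(1)]])
          (simp add: matched_closed_segment_image m' r)
      then show ?thesis using r m' by (simp add: strict_mono_eq)
    qed
  qed (use roots in auto)
  have no: "\<not> (0 < poly p t \<and> poly q (\<phi> t) < 0)"
    if m: "matched \<phi> Z p q" and roots: "\<And>r. poly p r = 0 \<longleftrightarrow> poly q (\<phi> r) = 0"
      and d: "0 < poly (pderiv p) t" and tZ: "t \<notin> Z" for \<phi> Z p q t
  proof
    assume c: "0 < poly p t \<and> poly q (\<phi> t) < 0"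
    have m': "strict_mono \<phi>" "surj \<phi>" using m by (auto simp: matched_def)
    obtain s where s: "\<phi> t \<le> s" "0 < poly q s" "{\<phi> t..<s} \<inter> \<phi> ` Z = {}"
      using matched_right[OF m tZ d] c by auto
    have "\<phi> t < s" using s c by (cases "\<phi> t = s") auto
    then obtain y where y: "\<phi> t < y" "y < s" "poly q y = 0" using poly_IVT_pos s c by blast
    obtain x where x: "y = \<phi> x" using m'(2) by auto
    have "poly p x = 0" using roots x y by simp
    have tx: "t < x" using y x m' by (simp add: strict_mono_less)
    have xZ: "{t..x} \<inter> Z = {}"
    proof (rule equals0I)
      fix z assume "z \<in> {t..x} \<inter> Z"
      then have "\<phi> z \<in> {\<phi> t..<s} \<inter> \<phi> ` Z" using y x m' by (auto simp: strict_mono_less_eq) (smt (verit) strict_mono_less_eq)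
      then show False using s by blast
    qed
    have "poly p t < poly p x"
    proof (rule poly_increasing[OF _ tx])
      fix u assume u: "t < u" "u < x"
      have "sgn (poly (pderiv p) t) = sgn (poly (pderiv p) u)"
      proof (rule poly_no_root_same_sgn)
        fix w assume "t \<le> w" "w \<le> u"
        then have "w \<notin> Z" using xZ u by (auto simp: disjoint_iff)
        then show "poly (pderiv p) w \<noteq> 0" using m by (auto simp: matched_def)
      qed (use u in simp)
      then show "0 < poly (pderiv p) u" using d by (simp add: sgn_1_pos)
    qed
    then show False using c \<open>poly p x = 0\<close> by simp
  qed
  have main: "sgn (poly p t) = sgn (poly q (\<phi> t))"
    if m: "matched \<phi> Z p q" and roots: "\<And>r. poly p r = 0 \<longleftrightarrow> poly q (\<phi> r) = 0"
      and d: "0 < poly (pderiv p) t" and tZ: "t \<notin> Z" for p q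
  proof -
    have m': "strict_mono \<phi>" "surj \<phi>" using m by (auto simp: matched_def)
    have i: "inv \<phi> (\<phi> t) = t" "\<phi> (inv \<phi> t) = t" for t using m' by (simp_all add: strict_mono_eq inj_def surj_f_inv_f)
    have "\<not> (0 < poly q (\<phi> t) \<and> poly p (inv \<phi> (\<phi> t)) < 0)"
    proof (rule no[OF matched_inv[OF m]])
      show "poly q r = 0 \<longleftrightarrow> poly p (inv \<phi> r) = 0" for r using roots[of "inv \<phi> r"] by (simp add: i)
      show "0 < poly (pderiv q) (\<phi> t)" using m d by (metis matched_def sgn_1_pos)
      show "\<phi> t \<notin> \<phi> ` Z" using tZ m' by (auto simp: strict_mono_eq)
    qed
    then show ?thesis using no[OF m roots d tZ] roots[of t] by (auto simp: i sgn_if)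
  qed
  show ?thesis
  proof (cases "t \<in> Z")
    case True then show ?thesis using m by (simp add: matched_def)
  next
    case False
    then have "poly (pderiv p) t \<noteq> 0" using m by (auto simp: matched_def)
    then consider "0 < poly (pderiv p) t" | "0 < poly (pderiv (- p)) t" by (fastforce simp: pderiv_minus)
    then show ?thesis
    proof cases
      case 1 then show ?thesis using main[OF m] root_iff[OF m roots] False by blast
    next
      case 2
      then have "sgn (poly (- p) t) = sgn (poly (- q) (\<phi> t))"
        using main[OF matched_neg[OF m] _ 2 False] root_iff[OF m roots] by simp
      then show ?thesis by (simp add: sgn_minus)
    qed
  qed
qed

lemma push_map:
  fixes u v r s :: real
  assumes "u < r" "r < v" "u < s" "s < v"
  shows "\<exists>h. strict_mono h \<and> surj h \<and> h r = s \<and> (\<forall>t. t \<notin> {u<..<v} \<longrightarrow> h t = t) \<and> (\<forall>t\<in>{u<..<v}. h t \<in> {u<..<v})"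
proof -
  \<comment> \<open>piecewise linear on \<open>[u, v]\<close> with one break, at \<open>r\<close>; the inverse of \<open>H r s\<close> is \<open>H s r\<close>\<close>
  define H where "H r s t = (if t \<le> u \<or> v \<le> t then t else if t \<le> r then u + (t - u) * ((s - u) / (r - u))
      else v - (v - t) * ((v - s) / (v - r)))" for r s t :: real
  have in1: "u < H r s t \<and> H r s t \<le> s" if "u < r" "r < v" "u < s" "s < v" "u < t" "t \<le> r" for r s t
  proof -
    have "(t - u) * ((s - u) / (r - u)) \<le> (r - u) * ((s - u) / (r - u))"
      using that by (intro mult_right_mono) auto
    then show ?thesis using that by (auto simp: H_def)
  qed
  have in2: "s < H r s t \<and> H r s t < v" if "u < r" "r < v" "u < s" "s < v" "r < t" "t < v" for r s t
  proof -
    have "(v - t) * ((v - s) / (v - r)) < (v - r) * ((v - s) / (v - r))"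
      using that by (intro mult_strict_right_mono) auto
    then show ?thesis using that by (auto simp: H_def)
  qed
  have inv: "H s r (H r s t) = t" if "u < r" "r < v" "u < s" "s < v" for r s t
  proof -
    consider "t \<le> u \<or> v \<le> t" | "u < t" "t \<le> r" | "r < t" "t < v" by linarith
    then show ?thesis
    proof cases
      case 1 then show ?thesis by (simp add: H_def)
    next
      case 2
      then have "H r s t = u + (t - u) * ((s - u) / (r - u))" using that by (simp add: H_def)
      moreover have "H s r (H r s t) = u + (H r s t - u) * ((r - u) / (s - u))"
        using in1[OF that 2] that by (simp add: H_def[of s r])
      ultimately show ?thesis using that by simp
    next
      case 3
      then have "H r s t = v - (v - t) * ((v - s) / (v - r))" using that by (simp add: H_def)
      moreover have "H s r (H r s t) = v - (v - H r s t) * ((v - r) / (v - s))"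
        using in2[OF that 3] that by (simp add: H_def[of s r])
      ultimately show ?thesis using that by simp
    qed
  qed
  have "strict_mono (H r s)"
  proof (rule strict_monoI)
    fix x y :: real assume xy: "x < y"
    have k: "0 < (s - u) / (r - u)" "0 < (v - s) / (v - r)" using assms by auto
    show "H r s x < H r s y"
    proof (cases "u < x \<and> y < v")
      case True
      then consider "y \<le> r" | "x \<le> r" "r < y" | "r < x" by linarith
      then show ?thesis
      proof cases
        case 1
        then have "(x - u) * ((s - u) / (r - u)) < (y - u) * ((s - u) / (r - u))"
          using xy k by (intro mult_strict_right_mono) auto
        then show ?thesis using 1 True xy assms by (simp add: H_def)
      next
        case 2 then show ?thesis using in1[OF assms, of x] in2[OF assms, of y] True by auto
      next
        case 3
        then have "(v - y) * ((v - s) / (v - r)) < (v - x) * ((v - s) / (v - r))"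
          using xy k by (intro mult_strict_right_mono) auto
        then show ?thesis using 3 True xy assms by (simp add: H_def)
      qed
    next
      case False
      have "H r s x = x \<or> u < x \<and> x < v \<and> u < H r s x \<and> H r s x < v"
        using in1[OF assms, of x] in2[OF assms, of x] assms by (cases "x \<le> u \<or> v \<le> x") (auto simp: H_def[of r s x] not_le)
      moreover have "H r s y = y \<or> u < y \<and> y < v \<and> u < H r s y \<and> H r s y < v"
        using in1[OF assms, of y] in2[OF assms, of y] assms by (cases "y \<le> u \<or> v \<le> y") (auto simp: H_def[of r s y] not_le)
      ultimately show ?thesis using False xy by auto
    qed
  qed
  moreover have "surj (H r s)" using inv[of s r] assms by (metis surjI)
  moreover have "H r s r = s" using assms by (simp add: H_def)
  moreover have "H r s t = t" if "t \<notin> {u<..<v}" for t using that by (auto simp: H_def)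
  moreover have "H r s t \<in> {u<..<v}" if "t \<in> {u<..<v}" for t
    using that in1[OF assms, of t] in2[OF assms, of t] assms by (cases "t \<le> r") auto
  ultimately show ?thesis by blast
qed

lemma finite_avoid_segment:
  fixes F :: "real set"
  assumes "finite F" "{a..b} \<inter> F = {}"
  shows "\<exists>u<a. \<exists>v>b. {u..v} \<inter> F = {}"
proof -
  have "\<exists>u<a. \<forall>x\<in>F. x < a \<longrightarrow> x < u"
    using assms(1)
  proof (induction F)
    case empty show ?case by (auto intro: lt_ex)
  next
    case (insert x F)
    then obtain u where u: "u < a" "\<forall>x\<in>F. x < a \<longrightarrow> x < u" by auto
    show ?case
    proof (cases "x < a")
      case True
      then obtain w where "max x u < w" "w < a" using u dense[of "max x u" a] by auto
      then show ?thesis using u by (intro exI[of _ w]) auto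
    qed (use u in auto)
  qed
  then obtain u where u: "u < a" "\<forall>x\<in>F. x < a \<longrightarrow> x < u" by auto
  have "\<exists>v>b. \<forall>x\<in>F. b < x \<longrightarrow> v < x"
    using assms(1)
  proof (induction F)
    case empty show ?case by (auto intro: gt_ex)
  next
    case (insert x F)
    then obtain v where v: "v > b" "\<forall>x\<in>F. b < x \<longrightarrow> v < x" by auto
    show ?case
    proof (cases "b < x")
      case True
      then obtain w where "b < w" "w < min x v" using v dense[of b "min x v"] by auto
      then show ?thesis using v by (intro exI[of _ w]) auto
    qed (use v in auto)
  qed
  then obtain v where v: "v > b" "\<forall>x\<in>F. b < x \<longrightarrow> v < x" by auto
  have "{u..v} \<inter> F = {}"
    using u v assms(2) by (force simp: disjoint_iff)
  then show ?thesis using u v by blast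
qed

text \<open>
  If \<open>\<phi>\<close> transports the signs of a family containing the derivative of \<open>p\<close>, and the sign of \<open>p\<close> at all roots
  of the family, then a modification of \<open>\<phi>\<close> transports the sign of \<open>p\<close> everywhere. The modification
  moves the image of each root of \<open>p\<close> to the corresponding root of \<open>q\<close>, inside an interval
  on which no member of the family changes sign.
\<close>

lemma matched_extend:
  fixes S :: "(real poly \<times> real poly) set"
  assumes "matched \<phi> Z p q"
    and "\<And>f g t. (f, g) \<in> S \<Longrightarrow> sgn (poly f t) = sgn (poly g (\<phi> t))"
    and "(pderiv p, pderiv q) \<in> S"
    and "\<And>f g t. (f, g) \<in> S \<Longrightarrow> f \<noteq> 0 \<Longrightarrow> poly f t = 0 \<Longrightarrow> t \<in> Z"
  shows "\<exists>\<psi>. strict_mono \<psi> \<and> surj \<psi> \<and> (\<forall>(f, g)\<in>insert (p, q) S. \<forall>t. sgn (poly f t) = sgn (poly g (\<psi> t)))"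
proof -
  have finr: "finite {r. poly p r = 0}"
  proof (rule poly_roots_finite)
    show "p \<noteq> 0"
    proof
      assume "p = 0"
      then have "Z = UNIV" using assms(1) by (auto simp: matched_def)
      then show False using assms(1) infinite_UNIV_char_0[where 'a=real] by (simp add: matched_def)
    qed
  qed
  \<comment> \<open>the number of roots of \<open>p\<close> not yet mapped to roots of \<open>q\<close> decreases\<close>
  show ?thesis using assms
  proof (induction "card {r. poly p r = 0 \<and> poly q (\<phi> r) \<noteq> 0}" arbitrary: \<phi> rule: less_induct)
    case less
    note m = less.prems(1) and S = less.prems(2) and SZ = less.prems(4)
    have m': "strict_mono \<phi>" "surj \<phi>" "finite Z" using m by (auto simp: matched_def)
    show ?case
    proof (cases "{r. poly p r = 0 \<and> poly q (\<phi> r) \<noteq> 0} = {}")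
      case True
      then have "sgn (poly p t) = sgn (poly q (\<phi> t))" for t by (intro matched_roots_sgn[OF m]) auto
      then show ?thesis using m' S by (intro exI[of _ \<phi>]) auto
    next
      case False
      then obtain r where r: "poly p r = 0" "poly q (\<phi> r) \<noteq> 0" by blast
      have "r \<notin> Z" using m r by (metis matched_def sgn_0_0 sgn_zero)
      from matched_root[OF m this r(1)] obtain s where
        s: "poly q s = 0" "closed_segment (\<phi> r) s \<inter> \<phi> ` Z = {}" by blast
      define a b where "a = min (\<phi> r) s" and "b = max (\<phi> r) s"
      have "{a..b} \<inter> \<phi> ` Z = {}"
        using s(2) by (auto simp: a_def b_def closed_segment_eq_real_ivl min_def max_def split: if_splits)
      then obtain u v where uv: "u < a" "b < v" "{u..v} \<inter> \<phi> ` Z = {}"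
        using finite_avoid_segment[of "\<phi> ` Z" a b] m' by auto
      have lt: "u < \<phi> r" "\<phi> r < v" "u < s" "s < v" using uv by (auto simp: a_def b_def)
      obtain h where h: "strict_mono h" "surj h" "h (\<phi> r) = s"
        "\<forall>t. t \<notin> {u<..<v} \<longrightarrow> h t = t" "\<forall>t\<in>{u<..<v}. h t \<in> {u<..<v}"
        using push_map[OF lt] by (elim exE conjE)
      define \<psi> where "\<psi> = h \<circ> \<phi>"
      have \<psi>: "strict_mono \<psi>" "surj \<psi>"
        unfolding \<psi>_def using strict_mono_o[OF h(1) m'(1)] comp_surj[OF m'(2) h(2)] by auto
      have \<psi>S: "sgn (poly f t) = sgn (poly g (\<psi> t))" if fg: "(f, g) \<in> S" for f g t
      proof (cases "f = 0")
        case True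
        then have "poly g (\<phi> x) = 0" for x using S[OF fg, of x] by (simp add: sgn_0_0)
        then have "poly g x = 0" for x using m'(2) by (metis surj_def)
        then show ?thesis using True by simp
      next
        case False
        show ?thesis
        proof (cases "\<phi> t \<in> {u<..<v}")
          case True
          have nr: "poly g x \<noteq> 0" if x: "x \<in> {u<..<v}" for x
          proof
            assume g0: "poly g x = 0"
            obtain y where y: "x = \<phi> y" using m'(2) by (metis surj_def)
            then have "poly f y = 0" using S[OF fg, of y] g0 by (simp add: sgn_0_0)
            then have "y \<in> Z" using SZ[OF fg False] by blast
            then have "x \<in> {u..v} \<inter> \<phi> ` Z" using x y by auto
            then show False using uv(3) by blast
          qed
          have "sgn (poly g x) = sgn (poly g y)" if "x \<in> {u<..<v}" "y \<in> {u<..<v}" "x \<le> y" for x y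
            using that by (intro poly_no_root_same_sgn nr) auto
          then have "sgn (poly g (\<phi> t)) = sgn (poly g (h (\<phi> t)))"
            using True h(5) by (metis linear)
          then show ?thesis using S[OF fg, of t] by (simp add: \<psi>_def)
        next
          case False then show ?thesis using h(4) S[OF fg, of t] by (simp add: \<psi>_def)
        qed
      qed
      have "\<psi> t = \<phi> t" if "t \<in> Z" for t
      proof -
        have "\<phi> t \<notin> {u<..<v}" using imageI[OF that, of \<phi>] uv(3) greaterThanLessThan_subseteq_atLeastAtMost_iff[of u v u v] by blast
        then show ?thesis using h(4) by (simp add: \<psi>_def)
      qed
      then have m\<psi>: "matched \<psi> Z p q"
        using m \<psi> \<psi>S[OF less.prems(3)] by (auto simp: matched_def)
      have "{r. poly p r = 0 \<and> poly q (\<psi> r) \<noteq> 0} \<subset> {r. poly p r = 0 \<and> poly q (\<phi> r) \<noteq> 0}"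
      proof
        show "{r. poly p r = 0 \<and> poly q (\<psi> r) \<noteq> 0} \<noteq> {r. poly p r = 0 \<and> poly q (\<phi> r) \<noteq> 0}"
          using r s h(3) by (auto simp: \<psi>_def set_eq_iff)
        show "{r. poly p r = 0 \<and> poly q (\<psi> r) \<noteq> 0} \<subseteq> {r. poly p r = 0 \<and> poly q (\<phi> r) \<noteq> 0}"
        proof safe
          fix r' assume r': "poly p r' = 0" "poly q (\<psi> r') \<noteq> 0" "poly q (\<phi> r') = 0"
          have "\<phi> r' \<in> {u<..<v}" using r' h(4) by (auto simp: \<psi>_def)
          then have "closed_segment (\<phi> r) (\<phi> r') \<inter> \<phi> ` Z = {}"
            using lt uv(3) by (force simp: closed_segment_eq_real_ivl disjoint_iff split: if_splits)
          then have "r = r'"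
            using matched_root_unique[OF m r(1) r'(1)] m' by (simp add: matched_closed_segment_image)
          then show False using r r' by simp
        qed
      qed
      then have "card {r. poly p r = 0 \<and> poly q (\<psi> r) \<noteq> 0} < card {r. poly p r = 0 \<and> poly q (\<phi> r) \<noteq> 0}"
        by (intro psubset_card_mono finite_subset[OF _ finr]) auto
      then show ?thesis by (rule less.hyps[OF _ m\<psi>]) (fact \<psi>S less.prems(3) SZ)+
    qed
  qed
qed

section \<open>Tarski--Seidenberg\<close>

text \<open>
  A pair \<open>(n, F)\<close>: the polynomial \<open>F x\<close> in one variable depends polynomially on the parameters \<open>x\<close>, and
  \<open>n\<close> is a strict bound on its degree; the coefficient of index \<open>n - 1\<close> may vanish for some \<open>x\<close>.
\<close>

definition param_poly :: "nat \<times> ((nat \<Rightarrow> real) \<Rightarrow> real poly) \<Rightarrow> bool" where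
  "param_poly = (\<lambda>(n, F). (\<forall>i. polyfun (\<lambda>x. coeff (F x) i)) \<and> (\<forall>x. \<forall>i\<ge>n. coeff (F x) i = 0))"

text \<open>
  One step of pseudo-division of \<open>F\<close> by \<open>G\<close>. The multiplier of \<open>F\<close> is a square, so at the roots of \<open>G\<close> the
  sign of \<open>F\<close> is kept as long as the coefficient of index \<open>m - 1\<close> of \<open>G\<close> is nonzero.
\<close>

definition cancel :: "nat \<Rightarrow> ((nat \<Rightarrow> real) \<Rightarrow> real poly) \<Rightarrow> nat \<Rightarrow> ((nat \<Rightarrow> real) \<Rightarrow> real poly) \<Rightarrow> (nat \<Rightarrow> real) \<Rightarrow> real poly" where
  "cancel n F m G x = smult ((coeff (G x) (m - 1))\<^sup>2) (F x) -
     monom (coeff (G x) (m - 1) * coeff (F x) (n - 1)) (n - m) * G x"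

lemma param_poly_cancel:
  assumes F: "param_poly (n, F)" and G: "param_poly (m, G)" and "m \<le> n"
  shows "param_poly (n - 1, cancel n F m G)"
proof -
  have "polyfun (\<lambda>x. coeff (cancel n F m G x) i)" for i
  proof -
    have "polyfun (\<lambda>x. (coeff (G x) (m - 1))\<^sup>2 * coeff (F x) i -
       coeff (G x) (m - 1) * coeff (F x) (n - 1) * coeff (G x) (i - (n - m)))"
      "polyfun (\<lambda>x. (coeff (G x) (m - 1))\<^sup>2 * coeff (F x) i)"
      using F G by (auto simp: param_poly_def intro!: polyfun_diff polyfun_mult polyfun_power)
    then show ?thesis by (cases "i < n - m") (simp_all add: cancel_def coeff_monom_mult)
  qed
  moreover have "coeff (cancel n F m G x) i = 0" if "n - 1 \<le> i" for x i
  proof (cases "m = 0")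
    case True
    then have "G x = 0" using G by (auto simp: param_poly_def poly_eq_iff)
    then show ?thesis by (simp add: cancel_def)
  next
    case False
    show ?thesis
    proof (cases "n \<le> i")
      case True
      then have "coeff (F x) i = 0" "coeff (G x) (i - (n - m)) = 0" using F G assms(3) by (auto simp: param_poly_def)
      then show ?thesis by (simp add: cancel_def coeff_monom_mult)
    next
      case False': False
      then have "i = n - 1" "i - (n - m) = m - 1" "\<not> i < n - m" using that False assms(3) by auto
      then show ?thesis by (simp add: cancel_def coeff_monom_mult power2_eq_square)
    qed
  qed
  ultimately show ?thesis by (auto simp: param_poly_def)
qed

lemma sgn_cancel_root:
  assumes "poly (G x) t = 0" "coeff (G x) (m - 1) \<noteq> 0"
  shows "sgn (poly (cancel n F m G x) t) = sgn (poly (F x) t)"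
proof -
  have "0 < (coeff (G x) (m - 1))\<^sup>2" using assms(2) by simp
  then have "sgn ((coeff (G x) (m - 1))\<^sup>2) = 1" by (rule sgn_pos)
  then show ?thesis using assms by (simp only: cancel_def poly_diff poly_smult poly_mult) (simp add: sgn_mult)
qed

lemma param_poly_pderiv:
  assumes "param_poly (n, F)"
  shows "param_poly (n - 1, \<lambda>x. pderiv (F x))"
proof -
  have "polyfun (\<lambda>x. of_nat (Suc i) * coeff (F x) (Suc i))" for i
    using assms by (intro polyfun_mult polyfun_const) (simp add: param_poly_def)
  then show ?thesis using assms by (simp add: param_poly_def coeff_pderiv)
qed

lemma param_poly_drop:
  assumes "param_poly (m, G)"
  shows "param_poly (m - 1, \<lambda>x. G x - monom (coeff (G x) (m - 1)) (m - 1))"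
proof -
  have "coeff (G x) i = 0" if "m - 1 \<le> i" "i \<noteq> m - 1" for x i
    using assms that by (auto simp: param_poly_def)
  moreover have "polyfun (\<lambda>x. coeff (G x - monom (coeff (G x) (m - 1)) (m - 1)) i)" for i
    using assms by (cases "i = m - 1") (auto simp: param_poly_def)
  ultimately show ?thesis by (auto simp: param_poly_def)
qed

text \<open>The family \<open>L\<close> has the same sign pattern on the line at the parameters \<open>x\<close> and \<open>y\<close>.\<close>

definition sign_equiv :: "(nat \<times> ((nat \<Rightarrow> real) \<Rightarrow> real poly)) set \<Rightarrow> (nat \<Rightarrow> real) \<Rightarrow> (nat \<Rightarrow> real) \<Rightarrow> bool" where
  "sign_equiv L x y \<longleftrightarrow> (\<exists>\<phi>. strict_mono \<phi> \<and> surj \<phi> \<and>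
      (\<forall>(n, F)\<in>L. \<forall>t. sgn (poly (F x) t) = sgn (poly (F y) (\<phi> t))))"

text \<open>
  When no formal leading coefficient vanishes, \<open>F\<close> may be traded for its derivative and for its reductions
  modulo the derivative and the other members: the reductions give the sign of \<open>F\<close> at the roots of these.
\<close>

lemma sign_equiv_step:
  assumes F: "param_poly (n, F)" "2 \<le> n" and M: "\<And>m G. (m, G) \<in> M \<Longrightarrow> param_poly (m, G)" "finite M"
    and lead: "coeff (F x) (n - 1) \<noteq> 0" "coeff (F y) (n - 1) \<noteq> 0"
      "\<And>m G. (m, G) \<in> M \<Longrightarrow> 1 \<le> m \<Longrightarrow> coeff (G x) (m - 1) \<noteq> 0 \<and> coeff (G y) (m - 1) \<noteq> 0"
    and eq: "sign_equiv (insert (n - 1, \<lambda>x. pderiv (F x)) (insert (n - 1, cancel n F (n - 1) (\<lambda>x. pderiv (F x)))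
      (M \<union> (\<lambda>(m, G). (n - 1, cancel n F m G)) ` M))) x y"
  shows "sign_equiv (insert (n, F) M) x y"
proof -
  define M' where "M' = insert (n - 1, \<lambda>x. pderiv (F x)) M"
  obtain \<phi> where \<phi>: "strict_mono \<phi>" "surj \<phi>"
    and sg: "\<And>m G t. (m, G) \<in> M' \<Longrightarrow> sgn (poly (G x) t) = sgn (poly (G y) (\<phi> t))"
    and sc: "\<And>m G t. (m, G) \<in> M' \<Longrightarrow> sgn (poly (cancel n F m G x) t) = sgn (poly (cancel n F m G y) (\<phi> t))"
    using eq unfolding sign_equiv_def M'_def by fast
  have lead': "coeff (G x) (m - 1) \<noteq> 0 \<and> coeff (G y) (m - 1) \<noteq> 0" if "(m, G) \<in> M'" "1 \<le> m" for m G
  proof -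
    have "Suc (n - 1 - 1) = n - 1" using F(2) by simp
    then show ?thesis using that lead unfolding M'_def by (auto simp: coeff_pderiv simp del: of_nat_Suc)
  qed
  have pp: "param_poly (m, G)" if "(m, G) \<in> M'" for m G
    using that M(1) param_poly_pderiv[OF F(1)] by (auto simp: M'_def)
  define Z where "Z = (\<Union>(m, G)\<in>{(m, G) \<in> M'. G x \<noteq> 0}. {t. poly (G x) t = 0})"
  have finZ: "finite Z" unfolding Z_def using M(2) by (auto simp: M'_def intro!: finite_subset[of "{(m, G). _ m G}" M'] poly_roots_finite)
  have pd: "pderiv (F x) \<noteq> 0"
  proof
    assume "pderiv (F x) = 0"
    then have "coeff (pderiv (F x)) (n - 2) = 0" by simp
    then show False using lead(1) F(2) by (simp add: coeff_pderiv numeral_2_eq_2 Suc_diff_Suc)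
  qed
  have "\<exists>\<psi>. strict_mono \<psi> \<and> surj \<psi> \<and> (\<forall>(f, g)\<in>insert (F x, F y) ((\<lambda>(m, G). (G x, G y)) ` M').
      \<forall>t. sgn (poly f t) = sgn (poly g (\<psi> t)))"
  proof (rule matched_extend)
    show "matched \<phi> Z (F x) (F y)"
      unfolding matched_def
    proof (intro conjI allI ballI impI)
      fix t assume "poly (pderiv (F x)) t = 0"
      then show "t \<in> Z" using pd by (auto simp: Z_def M'_def)
    next
      fix t assume "t \<in> Z"
      then obtain m G where G: "(m, G) \<in> M'" "G x \<noteq> 0" "poly (G x) t = 0" by (auto simp: Z_def)
      then have "poly (G y) (\<phi> t) = 0" using sg[OF G(1), of t] by (simp add: sgn_0_0)
      moreover have "1 \<le> m" using pp[OF G(1)] G(2) by (auto simp: param_poly_def poly_eq_iff Suc_le_eq intro!: Nat.gr0I)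
      ultimately show "sgn (poly (F x) t) = sgn (poly (F y) (\<phi> t))"
        using sgn_cancel_root[of G x t m n F] sgn_cancel_root[of G y "\<phi> t" m n F] lead'[OF G(1)] sc[OF G(1), of t] G by simp
    next
      fix t show "sgn (poly (pderiv (F x)) t) = sgn (poly (pderiv (F y)) (\<phi> t))"
        using sg[of "n - 1" "\<lambda>x. pderiv (F x)"] by (simp add: M'_def)
    qed (use \<phi> finZ in auto)
  qed (use sg in \<open>auto simp: M'_def Z_def\<close>)
  then show ?thesis unfolding sign_equiv_def M'_def by fastforce
qed

text \<open>
  Induction on the multiset of degree bounds. If a leading coefficient vanishes, it is dropped;
  otherwise a polynomial of largest degree bound is replaced by several with a smaller bound.
\<close>

lemma sign_equiv_finite_tests:
  fixes L :: "(nat \<times> ((nat \<Rightarrow> real) \<Rightarrow> real poly)) multiset"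
  assumes "\<And>p. p \<in># L \<Longrightarrow> param_poly p"
  shows "\<exists>D. finite D \<and> (\<forall>d\<in>D. polyfun d) \<and>
    (\<forall>x y. (\<forall>d\<in>D. sgn (d x) = sgn (d y)) \<longrightarrow> sign_equiv (set_mset L) x y)"
proof -
  have "wf (inv_image (mult less_than) (image_mset fst) :: ((nat \<times> ((nat \<Rightarrow> real) \<Rightarrow> real poly)) multiset \<times> _) set)"
    by (intro wf_inv_image wf_mult wf_less_than)
  then show ?thesis using assms
  proof (induction L rule: wf_induct_rule)
    case (less L)
    let ?T = "\<lambda>D L. finite D \<and> (\<forall>d\<in>D. polyfun d) \<and>
      (\<forall>x y. (\<forall>d\<in>D. sgn (d x) = sgn (d y)) \<longrightarrow> sign_equiv (set_mset L) x y)"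
    show ?case
    \<comment> \<open>for constant polynomials the identity is a suitable bijection\<close>
    proof (cases "\<forall>(n, F)\<in>#L. n \<le> 1")
      case True
      define D where "D = (\<lambda>(n, F) x. coeff (F x) 0) ` set_mset L"
      have "sign_equiv (set_mset L) x y" if D: "\<forall>d\<in>D. sgn (d x) = sgn (d y)" for x y
        unfolding sign_equiv_def
      proof (intro exI[of _ id] conjI ballI; clarify?)
        fix n F t assume nF: "(n, F) \<in># L"
        have "n \<le> 1" using True nF by auto
        then have "coeff (F x) i = 0" if "i \<ge> 1" for x i
          using less.prems[OF nF] that by (auto simp: param_poly_def)
        then have "F x = [:coeff (F x) 0:]" for x by (auto simp: poly_eq_iff coeff_pCons split: nat.splits)
        then have "poly (F x) t = poly [:coeff (F x) 0:] t" for x t by metis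
        then have "poly (F x) t = coeff (F x) 0" for x t by simp
        then show "sgn (poly (F x) t) = sgn (poly (F y) (id t))"
          using D nF by (force simp: D_def)
      qed (auto simp: strict_mono_def)
      moreover have "finite D" "\<forall>d\<in>D. polyfun d"
        using less.prems by (auto simp: D_def param_poly_def)
      ultimately show ?thesis by blast
    next
      case False
      define n where "n = Max (fst ` set_mset L)"
      have nmax: "m \<le> n" if "(m, G) \<in># L" for m G using imageI[OF that, of fst] by (simp add: n_def)
      have n2: "2 \<le> n" using False nmax by fastforce
      have "n \<in> fst ` set_mset L" unfolding n_def by (rule Max_in) (use False in auto)
      then obtain F where F: "(n, F) \<in># L" by auto
      define M where "M = L - {#(n, F)#}"
      have L: "L = add_mset (n, F) M" using F by (simp add: M_def)
      have pF: "param_poly (n, F)" using less.prems F by blast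
      define N where "N = {#(n - 1, \<lambda>x. pderiv (F x)), (n - 1, cancel n F (n - 1) (\<lambda>x. pderiv (F x)))#} +
        image_mset (\<lambda>(m, G). (n - 1, cancel n F m G)) M"
      have "\<exists>D. ?T D (M + N)"
      proof (rule less.IH)
        show "(M + N, L) \<in> inv_image (mult less_than) (image_mset fst)"
          using one_step_implies_mult[of "{#n#}" "image_mset fst N" less_than "image_mset fst M"] n2
          by (auto simp: in_inv_image L N_def case_prod_beta)
        show "param_poly p" if "p \<in># M + N" for p
        proof -
          have M: "param_poly (m, G) \<and> m \<le> n" if "(m, G) \<in># M" for m G
            using that less.prems[of "(m, G)"] nmax[of m G] by (simp add: L)
          have a: "param_poly (n - 1, \<lambda>x. pderiv (F x))" by (rule param_poly_pderiv[OF pF])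
          have b: "param_poly (n - 1, cancel n F (n - 1) (\<lambda>x. pderiv (F x)))"
            by (rule param_poly_cancel[OF pF a]) simp
          have c: "param_poly (n - 1, cancel n F m G)" if "(m, G) \<in># M" for m G
            using M[OF that] by (intro param_poly_cancel[OF pF]) auto
          have "p \<in># M \<or> p = (n - 1, \<lambda>x. pderiv (F x)) \<or> p = (n - 1, cancel n F (n - 1) (\<lambda>x. pderiv (F x))) \<or>
             (\<exists>(m, G)\<in>#M. p = (n - 1, cancel n F m G))"
            using that by (auto simp: N_def)
          then show ?thesis using a b c M by (cases p) (auto simp del: One_nat_def)
        qed
      qed
      then obtain D0 where D0: "?T D0 (M + N)" by blast
      define tr where "tr = (\<lambda>(m, G :: (nat \<Rightarrow> real) \<Rightarrow> real poly). (m - 1, \<lambda>x. G x - monom (coeff (G x) (m - 1)) (m - 1)))"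
      have "\<exists>D. ?T D (L - {#p#} + {#tr p#})" if p: "p \<in># L" "1 \<le> fst p" for p
      proof (rule less.IH)
        have "L = add_mset p (L - {#p#})" using p by simp
        then have "image_mset fst L = add_mset (fst p) (image_mset fst (L - {#p#}))" by (metis image_mset_add_mset)
        then show "(L - {#p#} + {#tr p#}, L) \<in> inv_image (mult less_than) (image_mset fst)"
          using one_step_implies_mult[of "{#fst p#}" "{#fst (tr p)#}" less_than "image_mset fst (L - {#p#})"] p(2)
          by (simp add: in_inv_image tr_def case_prod_beta)
        show "param_poly q" if "q \<in># L - {#p#} + {#tr p#}" for q
        proof -
          have "param_poly (tr p)"
            using param_poly_drop[of "fst p" "snd p"] less.prems[OF p(1)] by (simp add: tr_def case_prod_beta)
          moreover have "q \<in># L \<or> q = tr p" using that by (auto dest: in_diffD)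
          ultimately show ?thesis using less.prems by blast
        qed
      qed
      then obtain Dt where Dt: "\<And>p. p \<in># L \<Longrightarrow> 1 \<le> fst p \<Longrightarrow> ?T (Dt p) (L - {#p#} + {#tr p#})" by metis
      define D where "D = (\<lambda>(m, G) x. coeff (G x) (m - 1)) ` set_mset L \<union> D0 \<union>
        (\<Union>p\<in>{p \<in> set_mset L. 1 \<le> fst p}. Dt p)"
      have "finite D" using D0 Dt by (auto simp: D_def)
      moreover have "\<forall>d\<in>D. polyfun d"
        using D0 Dt less.prems by (auto simp: D_def param_poly_def)
      moreover have "sign_equiv (set_mset L) x y" if D: "\<forall>d\<in>D. sgn (d x) = sgn (d y)" for x y
      proof (cases "\<exists>p\<in>#L. 1 \<le> fst p \<and> coeff (snd p x) (fst p - 1) = 0")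
        case True
        then obtain m G where p: "(m, G) \<in># L" "1 \<le> m" "coeff (G x) (m - 1) = 0" by auto
        have "coeff (G y) (m - 1) = 0"
        proof -
          have "(\<lambda>x. coeff (G x) (m - 1)) \<in> D"
            using imageI[OF p(1), of "\<lambda>(m, G) x. coeff (G x) (m - 1)"] by (simp add: D_def)
          from bspec[OF D this] have "sgn (coeff (G x) (m - 1)) = sgn (coeff (G y) (m - 1))" by simp
          then show ?thesis using p(3) by (simp add: sgn_0_0)
        qed
        moreover have "sign_equiv (set_mset (L - {#(m, G)#} + {#tr (m, G)#})) x y"
        proof -
          have "Dt (m, G) \<subseteq> D" unfolding D_def using p(1,2) by fastforce
          then have 1: "\<forall>d\<in>Dt (m, G). sgn (d x) = sgn (d y)" using D by blast
          have "1 \<le> fst (m, G)" using p(2) by simp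
          from Dt[OF p(1) this] 1 show ?thesis by blast
        qed
        moreover have "set_mset L = insert (m, G) (set_mset (L - {#(m, G)#}))"
          using p(1) by (metis insert_DiffM set_mset_add_mset_insert)
        ultimately show ?thesis using p(3) unfolding sign_equiv_def tr_def by auto
      next
        case False
        have sx: "coeff (G x) (m - 1) \<noteq> 0 \<and> coeff (G y) (m - 1) \<noteq> 0" if "(m, G) \<in># L" "1 \<le> m" for m G
        proof -
          have "(\<lambda>x. coeff (G x) (m - 1)) \<in> D"
            using imageI[OF that(1), of "\<lambda>(m, G) x. coeff (G x) (m - 1)"] by (simp add: D_def)
          from bspec[OF D this] have "sgn (coeff (G x) (m - 1)) = sgn (coeff (G y) (m - 1))" by simp
          moreover have "coeff (G x) (m - 1) \<noteq> 0" using False that by auto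
          ultimately show ?thesis by (metis sgn_0_0 sgn_zero)
        qed
        have "sign_equiv (set_mset (M + N)) x y" using D0 D by (auto simp: D_def)
        then have "sign_equiv (insert (n, F) (set_mset M)) x y"
        proof (intro sign_equiv_step[OF pF n2])
          assume "sign_equiv (set_mset (M + N)) x y"
          moreover have "set_mset (M + N) = insert (n - 1, \<lambda>x. pderiv (F x))
             (insert (n - 1, cancel n F (n - 1) (\<lambda>x. pderiv (F x)))
               (set_mset M \<union> (\<lambda>(m, G). (n - 1, cancel n F m G)) ` set_mset M))" (is "_ = ?S")
            unfolding N_def by auto
          ultimately show "sign_equiv ?S x y" by simp
          show "param_poly (m, G)" if "(m, G) \<in> set_mset M" for m G
            using less.prems[of "(m, G)"] that by (simp add: L)
          show "coeff (F x) (n - 1) \<noteq> 0" "coeff (F y) (n - 1) \<noteq> 0"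
            using sx[OF F] n2 by auto
          show "coeff (G x) (m - 1) \<noteq> 0 \<and> coeff (G y) (m - 1) \<noteq> 0" if "(m, G) \<in> set_mset M" "1 \<le> m" for m G
            using sx[of m G] that by (simp add: L)
        qed simp
        then show ?thesis by (simp add: L)
      qed
      ultimately show ?thesis by blast
    qed
  qed
qed

lemma polyfun_update_param_poly:
  "polyfun d \<Longrightarrow> \<exists>n F. param_poly (n, F) \<and> (\<forall>x t. d (x(i := t)) = poly (F x) t)"
proof (induction rule: polyfun_induct)
  case (const c)
  show ?case by (rule exI[of _ 1], rule exI[of _ "\<lambda>_. [:c:]"]) (auto simp: param_poly_def coeff_pCons split: nat.splits)
next
  case (coord j)
  show ?case
  proof (cases "i = j")
    case True
    then show ?thesis
      by (intro exI[of _ 2] exI[of _ "\<lambda>_. [:0, 1:]"]) (auto simp: param_poly_def coeff_pCons split: nat.splits)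
  next
    case False
    have "polyfun (\<lambda>x. coeff [:x j:] k)" for k by (cases k) auto
    then show ?thesis using False
      by (intro exI[of _ 1] exI[of _ "\<lambda>x. [:x j:]"]) (auto simp: param_poly_def coeff_pCons split: nat.splits)
  qed
next
  case (add p q)
  then obtain m F n G where "param_poly (m, F)" "\<And>x t. p (x(i := t)) = poly (F x) t"
    "param_poly (n, G)" "\<And>x t. q (x(i := t)) = poly (G x) t" by blast
  then show ?case
    by (intro exI[of _ "max m n"] exI[of _ "\<lambda>x. F x + G x"]) (auto simp: param_poly_def simp del: fun_upd_apply)
next
  case (mult p q)
  then obtain m F n G where *: "param_poly (m, F)" "\<And>x t. p (x(i := t)) = poly (F x) t"
    "param_poly (n, G)" "\<And>x t. q (x(i := t)) = poly (G x) t" by blast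
  have "coeff (F x) j * coeff (G x) (k - j) = 0" if "m + n \<le> k" "j \<le> k" for x k j
    using * that by (cases "m \<le> j") (auto simp: param_poly_def)
  moreover have "polyfun (\<lambda>x. \<Sum>j\<le>k. coeff (F x) j * coeff (G x) (k - j))" for k
    using * by (intro polyfun_sum polyfun_mult) (auto simp: param_poly_def)
  ultimately show ?case using *
    by (intro exI[of _ "m + n"] exI[of _ "\<lambda>x. F x * G x"]) (auto simp: param_poly_def coeff_mult simp del: fun_upd_apply intro!: sum.neutral)
qed

theorem tarski_seidenberg:
  assumes "semialg P"
  shows "semialg (\<lambda>x. \<exists>t. P (x(i := t)))"
proof -
  obtain D where D: "finite D" "\<forall>d\<in>D. polyfun d" "\<And>x y. (\<forall>d\<in>D. sgn (d x) = sgn (d y)) \<Longrightarrow> P x = P y"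
    using assms by (auto simp: semialg_def)
  obtain h where h: "\<And>d. d \<in> D \<Longrightarrow> param_poly (h d) \<and> (\<forall>x t. d (x(i := t)) = poly (snd (h d) x) t)"
  proof -
    have "\<forall>d\<in>D. \<exists>p. param_poly p \<and> (\<forall>x t. d (x(i := t)) = poly (snd p x) t)"
      using polyfun_update_param_poly[of _ i] D(2) by fastforce
    from bchoice[OF this] show ?thesis using that by blast
  qed
  have "\<exists>E. finite E \<and> (\<forall>d\<in>E. polyfun d) \<and> (\<forall>x y. (\<forall>d\<in>E. sgn (d x) = sgn (d y)) \<longrightarrow>
      sign_equiv (set_mset (mset_set (h ` D))) x y)" by (rule sign_equiv_finite_tests) (use h D(1) in auto)
  then obtain E where E: "finite E" "\<forall>d\<in>E. polyfun d"
    "\<And>x y. (\<forall>d\<in>E. sgn (d x) = sgn (d y)) \<Longrightarrow> sign_equiv (h ` D) x y"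
    using D(1) by auto
  have half: "\<exists>t. P (y(i := t))" if xy: "\<forall>d\<in>E. sgn (d x) = sgn (d y)" and t: "P (x(i := t))" for x y t
  proof -
    obtain \<phi> where \<phi>: "\<And>n F t. (n, F) \<in> h ` D \<Longrightarrow> sgn (poly (F x) t) = sgn (poly (F y) (\<phi> t))"
      using E(3)[OF xy] unfolding sign_equiv_def by fast
    have "sgn (d (x(i := t))) = sgn (d (y(i := \<phi> t)))" if "d \<in> D" for d
      using h[OF that] \<phi>[of "fst (h d)" "snd (h d)" t] that by simp
    then show ?thesis using D(3) t by blast
  qed
  show ?thesis unfolding semialg_def
  proof (intro exI[of _ E] conjI allI impI)
    fix x y assume xy: "\<forall>d\<in>E. sgn (d x) = sgn (d y)"
    then have yx: "\<forall>d\<in>E. sgn (d y) = sgn (d x)" by simp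
    show "(\<exists>t. P (x(i := t))) = (\<exists>t. P (y(i := t)))"
      using half[OF xy] half[OF yx] by blast
  qed (use E in auto)
qed

section \<open>Quantifiers and local constancy of semialgebraic predicates\<close>

text \<open>
  A sequence encodes a pair of sequences, so a predicate with two arguments is semialgebraic if
  \<open>\<lambda>e. P (even_part e) (odd_part e)\<close> is. The rules for quantifiers below use this encoding, and iterate.
\<close>

definition even_part :: "(nat \<Rightarrow> real) \<Rightarrow> nat \<Rightarrow> real" where "even_part e = (\<lambda>i. e (2 * i))"
definition odd_part :: "(nat \<Rightarrow> real) \<Rightarrow> nat \<Rightarrow> real" where "odd_part e = (\<lambda>i. e (2 * i + 1))"

lemma polyfun_even_part: "(\<And>i. polyfun (\<lambda>e. T e i)) \<Longrightarrow> polyfun (\<lambda>e. even_part (T e) i)" by (simp add: even_part_def)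
lemma polyfun_odd_part: "(\<And>i. polyfun (\<lambda>e. T e i)) \<Longrightarrow> polyfun (\<lambda>e. odd_part (T e) i)" by (simp add: odd_part_def)

lemma semialg_ex_coords:
  "finite S \<Longrightarrow> semialg Q \<Longrightarrow> semialg (\<lambda>e. \<exists>f. Q (\<lambda>i. if i \<in> S then f i else e i))"
proof (induction S rule: finite_induct)
  case empty then show ?case by simp
next
  case (insert s S)
  have eq: "(\<exists>f. Q (\<lambda>i. if i \<in> insert s S then f i else e i)) \<longleftrightarrow>
     (\<exists>t f. Q (\<lambda>i. if i \<in> S then f i else (e(s := t)) i))" (is "?L \<longleftrightarrow> ?R") for e
  proof
    assume ?L
    then obtain f where "Q (\<lambda>i. if i \<in> insert s S then f i else e i)" by blast
    moreover have "(\<lambda>i. if i \<in> insert s S then f i else e i) = (\<lambda>i. if i \<in> S then f i else (e(s := f s)) i)"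
      using insert.hyps by auto
    ultimately show ?R by (intro exI[of _ "f s"] exI[of _ f]) simp
  next
    assume ?R
    then obtain t f where "Q (\<lambda>i. if i \<in> S then f i else (e(s := t)) i)" by blast
    moreover have "(\<lambda>i. if i \<in> S then f i else (e(s := t)) i) = (\<lambda>i. if i \<in> insert s S then (f(s := t)) i else e i)"
      using insert.hyps by auto
    ultimately show ?L by (intro exI[of _ "f(s := t)"]) simp
  qed
  show ?case unfolding eq using tarski_seidenberg[OF insert.IH[OF insert.prems], of s] by simp
qed

lemma semialg_ex:
  assumes "semialg (\<lambda>e. P (even_part e) (trunc m (odd_part e)))"
  shows "semialg (\<lambda>e. \<exists>z\<in>Rn m. P e z)"
proof -
  let ?S = "(\<lambda>i. 2 * i + 1) ` {..<m}"
  let ?T = "\<lambda>(e :: nat \<Rightarrow> real) i. if even i then e (i div 2) else 0"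
  have "semialg (\<lambda>e. \<exists>f. P (even_part (\<lambda>i. if i \<in> ?S then f i else e i)) (trunc m (odd_part (\<lambda>i. if i \<in> ?S then f i else e i))))"
    by (rule semialg_ex_coords[OF _ assms]) simp
  moreover have "polyfun (\<lambda>e. ?T e i)" for i by (cases "even i") auto
  ultimately have A: "semialg (\<lambda>e. \<exists>f. P (even_part (\<lambda>i. if i \<in> ?S then f i else ?T e i)) (trunc m (odd_part (\<lambda>i. if i \<in> ?S then f i else ?T e i))))"
    by (rule semialg_subst)
  have "(\<exists>f. P (even_part (\<lambda>i. if i \<in> ?S then f i else ?T e i)) (trunc m (odd_part (\<lambda>i. if i \<in> ?S then f i else ?T e i)))) =
      (\<exists>z\<in>Rn m. P e z)" for e
  proof -
    have 1: "even_part (\<lambda>i. if i \<in> ?S then f i else ?T e i) = e" for f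
      by (auto simp: even_part_def fun_eq_iff) presburger
    have 2: "trunc m (odd_part (\<lambda>i. if i \<in> ?S then f i else ?T e i)) = trunc m (\<lambda>i. f (2 * i + 1))" for f
      by (auto simp: odd_part_def trunc_def fun_eq_iff)
    have "(\<exists>f. P e (trunc m (\<lambda>i. f (2 * i + 1)))) = (\<exists>z\<in>Rn m. P e z)"
    proof
      assume "\<exists>z\<in>Rn m. P e z"
      then obtain z where z: "z \<in> Rn m" "P e z" by blast
      show "\<exists>f. P e (trunc m (\<lambda>i. f (2 * i + 1)))"
        by (rule exI[of _ "\<lambda>i. z (i div 2)"]) (use z in \<open>simp add: trunc_id\<close>)
    qed (use trunc_in_Rn in blast)
    then show ?thesis unfolding 1 2 .
  qed
  then show ?thesis using A by simp
qed

lemma semialg_ex_real: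
  assumes "semialg (\<lambda>e. P (even_part e) (odd_part e 0))"
  shows "semialg (\<lambda>e. \<exists>t. P e t)"
proof -
  have "(\<exists>t. P e t) \<longleftrightarrow> (\<exists>z\<in>Rn 1. P e (z 0))" for e
  proof
    assume "\<exists>t. P e t"
    then obtain t where "P e t" ..
    then show "\<exists>z\<in>Rn 1. P e (z 0)"
      by (intro bexI[of _ "\<lambda>i. if i = 0 then t else 0"]) (auto simp: mem_Rn_iff)
  qed blast
  moreover have "semialg (\<lambda>e. \<exists>z\<in>Rn 1. P e (z 0))"
    by (rule semialg_ex) (use assms in \<open>simp add: trunc_def\<close>)
  ultimately show ?thesis by simp
qed

lemma semialg_all:
  assumes "semialg (\<lambda>e. P (even_part e) (trunc m (odd_part e)))"
  shows "semialg (\<lambda>e. \<forall>z\<in>Rn m. P e z)"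
proof -
  have "semialg (\<lambda>e. \<not> (\<exists>z\<in>Rn m. \<not> P e z))"
    by (rule semialg_not, rule semialg_ex, rule semialg_not, rule assms)
  then show ?thesis by simp
qed

lemma semialg_all_real:
  assumes "semialg (\<lambda>e. P (even_part e) (odd_part e 0))"
  shows "semialg (\<lambda>e. \<forall>t. P e t)"
proof -
  have "semialg (\<lambda>e. \<not> (\<exists>z. \<not> P e z))"
    by (rule semialg_not, rule semialg_ex_real, rule semialg_not, rule assms)
  then show ?thesis by simp
qed

lemma semialg_abs_less: "semialg (\<lambda>x. \<bar>p x\<bar> < q x)" if "polyfun p" "polyfun q"
proof -
  have "semialg (\<lambda>x. p x < q x \<and> - p x < q x)" using that by (intro semialg_and semialg_less) auto
  then show ?thesis by (simp add: abs_less_iff)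
qed

lemma polyfun_continuous: "polyfun p \<Longrightarrow> continuous_on UNIV p"
  by (induction rule: polyfun_induct) (auto intro: continuous_intros continuous_on_product_coordinates)

text \<open>The open cube in \<open>\<real>\<^sup>n\<close> with centre \<open>b\<close>.\<close>

definition cube :: "nat \<Rightarrow> (nat \<Rightarrow> real) \<Rightarrow> real \<Rightarrow> (nat \<Rightarrow> real) set" where
  "cube n b \<epsilon> = {y \<in> Rn n. \<forall>i<n. \<bar>y i - b i\<bar> < \<epsilon>}"

lemma Rn_nbhd:
  assumes "open U" "b \<in> U" "b \<in> Rn n"
  shows "\<exists>\<epsilon>>0. cube n b \<epsilon> \<subseteq> U"
proof -
  have "openin (product_topology (\<lambda>i. euclideanreal) UNIV) U"
    using assms(1) by (simp add: euclidean_product_topology)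
  from product_topology_open_contains_basis[OF this assms(2)] obtain X where
    X: "b \<in> Pi\<^sub>E UNIV X" "\<And>i. open (X i)" "Pi\<^sub>E UNIV X \<subseteq> U" by auto
  have "\<exists>\<epsilon>>0. \<forall>t. \<bar>t - b i\<bar> < \<epsilon> \<longrightarrow> t \<in> X i" for i
    using X(1,2) unfolding open_dist by (force simp: dist_real_def)
  then obtain E where E: "\<And>i. E i > 0" "\<And>i t. \<bar>t - b i\<bar> < E i \<Longrightarrow> t \<in> X i" by metis
  define \<epsilon> where "\<epsilon> = Min (insert 1 (E ` {..<n}))"
  have "\<epsilon> > 0" using E(1) by (simp add: \<epsilon>_def)
  moreover have "cube n b \<epsilon> \<subseteq> U"
  proof
    fix y assume y: "y \<in> cube n b \<epsilon>"
    have "y i \<in> X i" for i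
    proof (cases "i < n")
      case True
      then have "\<epsilon> \<le> E i" by (simp add: \<epsilon>_def)
      then show ?thesis using y True by (intro E(2)) (auto simp: cube_def)
    next
      case False
      then have "y i = b i" using y assms(3) by (simp add: cube_def mem_Rn_iff)
      then show ?thesis using E by simp
    qed
    then show "y \<in> U" using X(3) by auto
  qed
  ultimately show ?thesis by blast
qed

text \<open>
  Countably many hypersurfaces do not cover a box. The coordinates are chosen one after the
  other, each outside the countably many roots that would make one of the polynomials vanish.
\<close>

lemma polynomials_avoid_zero:
  assumes "countable F" "\<And>p. p \<in> F \<Longrightarrow> polyfun p \<and> (\<exists>y\<in>Rn d. p y \<noteq> 0)" "b \<in> Rn d" "\<epsilon> > 0"
  shows "\<exists>y\<in>cube d b \<epsilon>. \<forall>p\<in>F. p y \<noteq> 0"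
  using assms
proof (induction d arbitrary: F b)
  case 0
  have "y = b" if "y \<in> Rn 0" for y using that 0(3) by (auto simp: mem_Rn_iff)
  then have "\<forall>p\<in>F. p b \<noteq> 0" using 0(2) by metis
  then show ?case using 0(3) by (auto simp: cube_def)
next
  case (Suc d)
  have "\<exists>G y. y \<in> Rn d \<and> G \<noteq> 0 \<and> (\<forall>t. p (y(d := t)) = poly G t)" if p: "p \<in> F" for p
  proof -
    obtain y where y: "y \<in> Rn (Suc d)" "p y \<noteq> 0" using Suc.prems(2)[OF p] by blast
    obtain G where G: "\<And>x t. p (x(d := t)) = poly (G x) t"
      using polyfun_update_param_poly[of p d] Suc.prems(2)[OF p] by blast
    have "(trunc d y)(d := y d) = y"
      using y(1) by (auto simp: trunc_def mem_Rn_iff fun_eq_iff)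
    then have "G (trunc d y) \<noteq> 0" using G[of "trunc d y" "y d"] y(2) by auto
    then show ?thesis using G trunc_in_Rn by blast
  qed
  then obtain G Y where GY: "\<And>p. p \<in> F \<Longrightarrow> Y p \<in> Rn d \<and> G p \<noteq> 0 \<and> (\<forall>t. p ((Y p)(d := t)) = poly (G p) t)"
    by metis
  have "countable (\<Union>p\<in>F. {t. poly (G p) t = 0})"
    using Suc.prems(1) GY by (intro countable_UN[OF Suc.prems(1)] countable_finite[OF poly_roots_finite]) auto
  moreover have "uncountable {b d - \<epsilon><..<b d + \<epsilon>}"
    using Suc.prems(4) by (simp add: uncountable_open_interval)
  ultimately have "{b d - \<epsilon><..<b d + \<epsilon>} - (\<Union>p\<in>F. {t. poly (G p) t = 0}) \<noteq> {}"
    using uncountable_minus_countable[of "{b d - \<epsilon><..<b d + \<epsilon>}"] by (metis countable_empty)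
  then obtain c where c': "c \<in> {b d - \<epsilon><..<b d + \<epsilon>}" "\<forall>p\<in>F. poly (G p) c \<noteq> 0" by blast
  then have c: "\<bar>c - b d\<bar> < \<epsilon>" "\<And>p. p \<in> F \<Longrightarrow> poly (G p) c \<noteq> 0" by (auto simp: abs_less_iff)
  have pfu: "polyfun (\<lambda>x. p (x(d := c)))" if "polyfun p" for p
  proof (rule polyfun_compose[OF that, where T = "\<lambda>x. x(d := c)"])
    show "polyfun (\<lambda>x. (x(d := c)) i)" for i by (cases "i = d") auto
  qed
  have "\<exists>y\<in>cube d (trunc d b) \<epsilon>. \<forall>q\<in>(\<lambda>p x. p (x(d := c))) ` F. q y \<noteq> 0"
  proof (rule Suc.IH)
    fix q assume "q \<in> (\<lambda>p x. p (x(d := c))) ` F"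
    then obtain p where p: "p \<in> F" "q = (\<lambda>x. p (x(d := c)))" by blast
    then show "polyfun q \<and> (\<exists>y\<in>Rn d. q y \<noteq> 0)"
      using GY[OF p(1)] c(2)[OF p(1)] pfu[of p] Suc.prems(2)[OF p(1)] by (auto intro!: bexI[of _ "Y p"])
  qed (use Suc.prems in auto)
  then obtain y where y: "y \<in> cube d (trunc d b) \<epsilon>" "\<And>p. p \<in> F \<Longrightarrow> p (y(d := c)) \<noteq> 0" by auto
  have "y(d := c) \<in> cube (Suc d) b \<epsilon>"
    using y(1) c(1) by (auto simp: cube_def mem_Rn_iff trunc_def less_Suc_eq)
  then show ?case using y(2) by blast
qed

text \<open>
  A semialgebraic predicate on \<open>\<real>\<^sup>d\<close> is locally constant off a hypersurface, namely the union of the zero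
  sets of those of its defining polynomials that do not vanish identically on \<open>\<real>\<^sup>d\<close>.
\<close>

lemma semialg_locally_constant:
  assumes "semialg P"
  shows "\<exists>Q. polyfun Q \<and> (\<exists>y\<in>Rn d. Q y \<noteq> 0) \<and> (\<forall>b\<in>Rn d. Q b \<noteq> 0 \<longrightarrow> (\<exists>\<epsilon>>0. \<forall>y\<in>cube d b \<epsilon>. P y = P b))"
proof -
  obtain D where D: "finite D" "\<forall>d\<in>D. polyfun d" "\<And>x y. (\<forall>d\<in>D. sgn (d x) = sgn (d y)) \<Longrightarrow> P x = P y"
    using assms by (auto simp: semialg_def)
  define D' where "D' = {p\<in>D. \<exists>y\<in>Rn d. p y \<noteq> 0}"
  have D': "finite D'" using D by (simp add: D'_def)
  have "\<exists>y\<in>cube d (\<lambda>_. 0) 1. \<forall>p\<in>D'. p y \<noteq> 0"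
    by (rule polynomials_avoid_zero) (use D D' in \<open>auto simp: D'_def mem_Rn_iff countable_finite\<close>)
  then obtain y0 where y0: "y0 \<in> Rn d" "\<forall>p\<in>D'. p y0 \<noteq> 0" by (auto simp: cube_def)
  have "\<exists>\<epsilon>>0. \<forall>y\<in>cube d b \<epsilon>. P y = P b" if b: "b \<in> Rn d" "(\<Prod>p\<in>D'. p b) \<noteq> 0" for b
  proof -
    let ?U = "\<Inter>p\<in>D'. {y. 0 < p y * p b}"
    have "open {y. 0 < p y * p b}" if "p \<in> D'" for p
    proof -
      have "continuous_on UNIV (\<lambda>y. p y * p b)"
        using that D by (intro continuous_intros polyfun_continuous) (auto simp: D'_def)
      then show ?thesis by (intro open_Collect_less continuous_on_const)
    qed
    then have "open ?U" using D' by (intro open_INT) auto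
    moreover have "p b \<noteq> 0" if "p \<in> D'" for p
      using b(2) that D' by (metis prod_zero_iff)
    then have "b \<in> ?U" by (auto simp: zero_less_mult_iff linorder_neq_iff)
    ultimately obtain \<epsilon> where \<epsilon>: "\<epsilon> > 0" "cube d b \<epsilon> \<subseteq> ?U" using Rn_nbhd b(1) by meson
    have "P y = P b" if y: "y \<in> cube d b \<epsilon>" for y
    proof (rule D(3), rule ballI)
      fix p assume p: "p \<in> D"
      show "sgn (p y) = sgn (p b)"
      proof (cases "p \<in> D'")
        case True
        then have "0 < p y * p b" using y \<epsilon> by auto
        then show ?thesis by (auto simp: zero_less_mult_iff)
      next
        case False
        then have "p y = 0" "p b = 0" using p y b(1) by (auto simp: D'_def cube_def)
        then show ?thesis by simp
      qed
    qed
    then show ?thesis using \<epsilon> by blast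
  qed
  moreover have "polyfun (\<lambda>x. \<Prod>p\<in>D'. p x)" using D by (intro polyfun_prod) (auto simp: D'_def)
  moreover have "(\<Prod>p\<in>D'. p y0) \<noteq> 0" using y0 D' by simp
  ultimately show ?thesis using y0(1) by (intro exI[of _ "\<lambda>x. \<Prod>p\<in>D'. p x"]) blast
qed

lemma semialgebraic_image:
  assumes "semialgebraic m A" "\<And>i. polyfun (\<lambda>x. T x i)" "\<And>x. x \<in> A \<Longrightarrow> T x \<in> Rn n"
  shows "semialgebraic n (T ` A)"
proof -
  have "semialg (\<lambda>e. \<exists>x\<in>Rn m. x \<in> A \<and> (\<forall>i<n. T x i = e i))"
    by (intro semialg_ex semialg_and semialg_mem[OF assms(1)] semialg_all_less semialg_eq polyfun_compose[OF assms(2)] polyfun_trunc polyfun_even_part polyfun_odd_part polyfun_coord)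
  then have "semialgebraic n {y \<in> Rn n. \<exists>x\<in>Rn m. x \<in> A \<and> (\<forall>i<n. T x i = y i)}"
    by (rule semialg_imp_semialgebraic)
  moreover have "{y \<in> Rn n. \<exists>x\<in>Rn m. x \<in> A \<and> (\<forall>i<n. T x i = y i)} = T ` A"
  proof (intro set_eqI iffI)
    fix y assume "y \<in> {y \<in> Rn n. \<exists>x\<in>Rn m. x \<in> A \<and> (\<forall>i<n. T x i = y i)}"
    then obtain x where x: "y \<in> Rn n" "x \<in> A" "\<forall>i<n. T x i = y i" by blast
    then have "T x = y" using assms(3)[of x] by (intro ext) (metis mem_Rn_iff not_le)
    then show "y \<in> T ` A" using x by blast
  next
    fix y assume "y \<in> T ` A"
    then show "y \<in> {y \<in> Rn n. \<exists>x\<in>Rn m. x \<in> A \<and> (\<forall>i<n. T x i = y i)}"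
      using assms(3) semialgebraic_subset_Rn[OF assms(1)] by blast
  qed
  ultimately show ?thesis by simp
qed

section \<open>Linear algebra of spans of functions\<close>

text \<open>On \<open>K\<close> the function \<open>f\<close> is a linear combination of the functions \<open>b s\<close> with \<open>s \<in> S\<close>.\<close>

definition in_span :: "'a set \<Rightarrow> 'b set \<Rightarrow> ('b \<Rightarrow> 'a \<Rightarrow> real) \<Rightarrow> ('a \<Rightarrow> real) \<Rightarrow> bool" where
  "in_span K S b f \<longleftrightarrow> (\<exists>a. \<forall>x\<in>K. f x = (\<Sum>s\<in>S. a s * b s x))"

lemma in_span_base: "finite S \<Longrightarrow> s \<in> S \<Longrightarrow> in_span K S b (b s)"
  unfolding in_span_def by (rule exI[of _ "\<lambda>t. if t = s then 1 else 0"]) (simp add: if_distrib[of "\<lambda>a. a * _"] cong: if_cong)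

lemma in_span_zero: "in_span K S b (\<lambda>x. 0)"
  unfolding in_span_def by (rule exI[of _ "\<lambda>t. 0"]) simp

lemma in_span_add: "in_span K S b f \<Longrightarrow> in_span K S b g \<Longrightarrow> in_span K S b (\<lambda>x. f x + g x)"
proof -
  assume "in_span K S b f" "in_span K S b g"
  then obtain a a' where "\<forall>x\<in>K. f x = (\<Sum>s\<in>S. a s * b s x)" "\<forall>x\<in>K. g x = (\<Sum>s\<in>S. a' s * b s x)"
    by (auto simp: in_span_def)
  then show ?thesis unfolding in_span_def
    by (intro exI[of _ "\<lambda>s. a s + a' s"]) (simp add: distrib_right sum.distrib)
qed

lemma in_span_scale: "in_span K S b f \<Longrightarrow> in_span K S b (\<lambda>x. r * f x)"
proof -
  assume "in_span K S b f"
  then obtain a where "\<forall>x\<in>K. f x = (\<Sum>s\<in>S. a s * b s x)" by (auto simp: in_span_def)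
  then show ?thesis unfolding in_span_def
    by (intro exI[of _ "\<lambda>s. r * a s"]) (simp add: sum_distrib_left mult.assoc)
qed

lemma in_span_sum: "(\<And>i. i \<in> I \<Longrightarrow> in_span K S b (f i)) \<Longrightarrow> in_span K S b (\<lambda>x. \<Sum>i\<in>I. f i x)"
  by (induction I rule: infinite_finite_induct) (auto intro: in_span_zero in_span_add)

lemma in_span_cong: "in_span K S b f \<Longrightarrow> (\<And>x. x \<in> K \<Longrightarrow> g x = f x) \<Longrightarrow> in_span K S b g"
  by (simp add: in_span_def)

lemma in_span_trans:
  assumes f: "in_span K S b f" and b: "\<And>s. s \<in> S \<Longrightarrow> in_span K T c (b s)"
  shows "in_span K T c f"
proof -
  obtain a where "\<forall>x\<in>K. f x = (\<Sum>s\<in>S. a s * b s x)" using f by (auto simp: in_span_def)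
  moreover have "in_span K T c (\<lambda>x. \<Sum>s\<in>S. a s * b s x)"
    by (rule in_span_sum, rule in_span_scale, rule b)
  ultimately show ?thesis by (simp add: in_span_def)
qed

lemma in_span_mono: "in_span K S b f \<Longrightarrow> S \<subseteq> T \<Longrightarrow> finite T \<Longrightarrow> in_span K T b f"
  by (rule in_span_trans[of K S b]) (auto intro: in_span_base)

lemma in_span_mult:
  assumes "in_span K S b f" "in_span L T c g"
  shows "in_span (K \<times> L) (S \<times> T) (\<lambda>(s, t) (x, y). b s x * c t y) (\<lambda>(x, y). f x * g y)"
proof -
  obtain a a' where a: "\<forall>x\<in>K. f x = (\<Sum>s\<in>S. a s * b s x)" "\<forall>x\<in>L. g x = (\<Sum>s\<in>T. a' s * c s x)"
    using assms by (auto simp: in_span_def)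
  have "f x * g y = (\<Sum>(s, t)\<in>S \<times> T. (a s * a' t) * (b s x * c t y))" if "x \<in> K" "y \<in> L" for x y
    using a that by (simp add: sum_product sum.cartesian_product mult_ac)
  then show ?thesis unfolding in_span_def
    by (intro exI[of _ "\<lambda>(s, t). a s * a' t"]) (auto simp: case_prod_beta)
qed

lemma in_span_pullback: "in_span K S b f \<Longrightarrow> h ` L \<subseteq> K \<Longrightarrow> in_span L S (\<lambda>s x. b s (h x)) (\<lambda>x. f (h x))"
  by (auto simp: in_span_def)

lemma homogeneous_system_nontrivial_solution:
  fixes M :: "'b \<Rightarrow> 'a \<Rightarrow> real"
  assumes "finite B" "finite A" "card B < card A"
  shows "\<exists>c. (\<exists>a\<in>A. c a \<noteq> 0) \<and> (\<forall>b\<in>B. (\<Sum>a\<in>A. M b a * c a) = 0)"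
  using assms
proof (induction B arbitrary: A M rule: finite_induct)
  case empty
  then obtain a where "a \<in> A" by fastforce
  then show ?case by (intro exI[of _ "\<lambda>_. 1"]) auto
next
  case (insert b B)
  show ?case
  proof (cases "\<forall>a\<in>A. M b a = 0")
    case True
    have "card B < card A" using insert by simp
    from insert.IH[OF insert.prems(1) this, of M] True show ?thesis by auto
  next
    case False
    then obtain p where p: "p \<in> A" "M b p \<noteq> 0" by blast
    define A' where "A' = A - {p}"
    have A': "finite A'" "card B < card A'" "A = insert p A'" "p \<notin> A'"
      using insert p(1) by (auto simp: A'_def)
    obtain c where c: "\<exists>a\<in>A'. c a \<noteq> 0"
      "\<forall>b'\<in>B. (\<Sum>a\<in>A'. (M b' a - M b' p * M b a / M b p) * c a) = 0"
      using insert.IH[OF A'(1,2), of "\<lambda>b' a. M b' a - M b' p * M b a / M b p"] by blast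
    define s where "s = (\<Sum>a\<in>A'. M b a * c a)"
    define c' where "c' = c(p := - s / M b p)"
    have eq: "(\<Sum>a\<in>A. M b' a * c' a) = M b' p * (- s / M b p) + (\<Sum>a\<in>A'. M b' a * c a)" for b'
    proof -
      have "(\<Sum>a\<in>A'. M b' a * c' a) = (\<Sum>a\<in>A'. M b' a * c a)"
        using A'(4) by (intro sum.cong) (auto simp: c'_def)
      then show ?thesis using A' by (simp add: c'_def)
    qed
    have "(\<Sum>a\<in>A. M b' a * c' a) = 0" if "b' \<in> insert b B" for b'
    proof (cases "b' = b")
      case True then show ?thesis unfolding eq using p(2) by (simp add: s_def)
    next
      case False
      have "(\<Sum>a\<in>A'. M b' a * c a) - (M b' p / M b p) * s =
          (\<Sum>a\<in>A'. (M b' a - M b' p * M b a / M b p) * c a)"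
        unfolding s_def sum_distrib_left sum_subtractf[symmetric]
        by (intro sum.cong refl) (simp add: algebra_simps)
      then have "(\<Sum>a\<in>A'. M b' a * c a) - (M b' p / M b p) * s = 0"
        using c(2) that False by auto
      then show ?thesis unfolding eq by simp
    qed
    moreover have "\<exists>a\<in>A. c' a \<noteq> 0" using c(1) A'(3,4) by (auto simp: c'_def)
    ultimately show ?thesis by blast
  qed
qed

section \<open>Algebraic relations between differences\<close>

text \<open>The monomial in the first \<open>m\<close> variables with exponents \<open>\<alpha>\<close>; the values of \<open>\<alpha>\<close> from \<open>m\<close> on are immaterial.\<close>

definition monomial :: "nat \<Rightarrow> (nat \<Rightarrow> nat) \<Rightarrow> (nat \<Rightarrow> real) \<Rightarrow> real" where
  "monomial m \<alpha> x = (\<Prod>i<m. x i ^ \<alpha> i)"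

text \<open>The exponents bounded by \<open>c\<close>, normalized to vanish from \<open>m\<close> on.\<close>

definition exponents :: "nat \<Rightarrow> (nat \<Rightarrow> nat) \<Rightarrow> (nat \<Rightarrow> nat) set" where
  "exponents m c = {\<alpha>. (\<forall>i<m. \<alpha> i \<le> c i) \<and> (\<forall>i\<ge>m. \<alpha> i = 0)}"

text \<open>
  The variable with index \<open>i\<close> has weight \<open>B ^ i\<close>. The weight is additive, and injective on exponents with
  all entries below \<open>B\<close>, as these are the digits in base \<open>B\<close>. It takes the role of a monomial order.
\<close>

definition weight :: "nat \<Rightarrow> nat \<Rightarrow> (nat \<Rightarrow> nat) \<Rightarrow> nat" where
  "weight B m \<alpha> = (\<Sum>i<m. \<alpha> i * B ^ i)"

text \<open>The exponents of monomials in the variables with index in \<open>I\<close>, bounded by \<open>D\<close>.\<close>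

abbreviation exponents_on :: "nat \<Rightarrow> nat set \<Rightarrow> nat \<Rightarrow> (nat \<Rightarrow> nat) set" where
  "exponents_on m I D \<equiv> exponents m (\<lambda>i. if i \<in> I then D else 0)"

text \<open>Products of monomials in two groups of variables, for polynomial functions on \<open>K \<times> K\<close>.\<close>

abbreviation bimonomial ::
  "nat \<Rightarrow> (nat \<Rightarrow> nat) \<times> (nat \<Rightarrow> nat) \<Rightarrow> (nat \<Rightarrow> real) \<times> (nat \<Rightarrow> real) \<Rightarrow> real" where
  "bimonomial m \<equiv> \<lambda>(\<sigma>, \<tau>) (x, y). monomial m \<sigma> x * monomial m \<tau> y"

lemma exponents_mono: "(\<And>i. i < m \<Longrightarrow> c i \<le> d i) \<Longrightarrow> exponents m c \<subseteq> exponents m d"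
  by (force simp: exponents_def)

lemma bij_betw_exponents: "bij_betw (\<lambda>f. restrict f {..<m}) (exponents m c) (PiE {..<m} (\<lambda>i. {..c i}))"
  by (rule bij_betwI[where g = "\<lambda>f i. if i < m then f i else 0"])
     (auto simp: exponents_def fun_eq_iff PiE_iff extensional_def)

lemma finite_exponents [simp]: "finite (exponents m c)"
  using bij_betw_finite[OF bij_betw_exponents[of m c]] by (simp add: finite_PiE)

lemma card_exponents: "card (exponents m c) = (\<Prod>i<m. Suc (c i))"
  using bij_betw_same_card[OF bij_betw_exponents[of m c]] by (simp add: card_PiE)

lemma monomial_add: "monomial m (\<lambda>i. \<alpha> i + \<beta> i) x = monomial m \<alpha> x * monomial m \<beta> x"
  by (simp add: monomial_def power_add prod.distrib)

lemma weight_add: "weight B m (\<lambda>i. \<alpha> i + \<beta> i) = weight B m \<alpha> + weight B m \<beta>"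
  by (simp add: weight_def distrib_right sum.distrib)

lemma weight_less: "\<forall>i<m. \<alpha> i \<le> D \<Longrightarrow> weight (Suc D) m \<alpha> < Suc D ^ m"
proof (induction m)
  case 0 then show ?case by (simp add: weight_def)
next
  case (Suc m)
  have "\<alpha> m * Suc D ^ m \<le> D * Suc D ^ m" using Suc.prems by (intro mult_right_mono) auto
  moreover have "weight (Suc D) m \<alpha> < Suc D ^ m" using Suc by simp
  ultimately have "weight (Suc D) m \<alpha> + \<alpha> m * Suc D ^ m < Suc D ^ m + D * Suc D ^ m" by linarith
  then show ?case by (simp add: weight_def)
qed

lemma weight_inj: "\<forall>i<m. \<alpha> i \<le> D \<Longrightarrow> \<forall>i<m. \<beta> i \<le> D \<Longrightarrow> weight (Suc D) m \<alpha> = weight (Suc D) m \<beta> \<Longrightarrow> \<forall>i<m. \<alpha> i = \<beta> i"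
proof (induction m)
  case (Suc m)
  have less: "weight (Suc D) m \<alpha> < Suc D ^ m" "weight (Suc D) m \<beta> < Suc D ^ m"
    using Suc.prems by (auto intro: weight_less)
  have eq: "weight (Suc D) m \<alpha> + \<alpha> m * Suc D ^ m = weight (Suc D) m \<beta> + \<beta> m * Suc D ^ m"
    using Suc.prems(3) by (simp add: weight_def)
  have d: "(weight (Suc D) m \<gamma> + \<gamma> m * Suc D ^ m) div Suc D ^ m = \<gamma> m" if "weight (Suc D) m \<gamma> < Suc D ^ m" for \<gamma>
    using that by (simp add: div_mult_self1)
  have "\<alpha> m = \<beta> m" using d[OF less(1)] d[OF less(2)] eq by metis
  moreover have "\<forall>i<m. \<alpha> i = \<beta> i" using Suc eq calculation by simp
  ultimately show ?case by (simp add: less_Suc_eq)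
qed simp

text \<open>
  If \<open>T\<close> substitutes variables with index in \<open>I\<close> or zero, then \<open>p \<circ> T\<close> is a combination of monomials in
  these variables.
\<close>

lemma poly_expand:
  assumes "polyfun p" and T: "\<And>j. (\<exists>i\<in>I. \<forall>u. T u j = u i) \<or> (\<forall>u. T u j = 0)" and I: "I \<subseteq> {..<m}"
  shows "\<exists>D. in_span UNIV (exponents_on m I D) (monomial m) (\<lambda>u. p (T u))"
  using assms(1)
proof (induction rule: polyfun_induct)
  case (const c)
  have "in_span UNIV (exponents_on m I 0) (monomial m) (\<lambda>u. c * monomial m (\<lambda>_. 0) u)"
    by (intro in_span_scale in_span_base finite_exponents) (auto simp: exponents_def)
  then show ?case by (intro exI[of _ 0]) (simp add: monomial_def[of m "\<lambda>_. 0"])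
next
  case (coord j)
  show ?case
  proof (cases "\<forall>u. T u j = 0")
    case True then show ?thesis by (auto intro: in_span_zero)
  next
    case False
    then obtain i where i: "i \<in> I" "\<And>u. T u j = u i" using T by blast
    define \<alpha> where "\<alpha> = (\<lambda>l. if l = i then 1 else 0 :: nat)"
    have "i < m" using i I by auto
    have "(\<Prod>l<m. u l ^ \<alpha> l) = (\<Prod>l\<in>{i}. u l)" for u :: "nat \<Rightarrow> real"
      using \<open>i < m\<close> by (intro prod.mono_neutral_cong_right) (auto simp: \<alpha>_def)
    then have monomial: "monomial m \<alpha> = (\<lambda>u. u i)" by (simp add: monomial_def fun_eq_iff)
    have "in_span UNIV (exponents_on m I 1) (monomial m) (monomial m \<alpha>)"
      using i \<open>i < m\<close> by (intro in_span_base finite_exponents) (auto simp: exponents_def \<alpha>_def)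
    then show ?thesis unfolding monomial i(2) by blast
  qed
next
  case (add p q)
  then obtain D E where
    "in_span UNIV (exponents_on m I D) (monomial m) (\<lambda>u. p (T u))"
    "in_span UNIV (exponents_on m I E) (monomial m) (\<lambda>u. q (T u))" by blast
  then show ?case by (intro exI[of _ "max D E"] in_span_add; elim in_span_mono) (auto intro!: exponents_mono)
next
  case (mult p q)
  then obtain D E where DE:
    "in_span UNIV (exponents_on m I D) (monomial m) (\<lambda>u. p (T u))"
    "in_span UNIV (exponents_on m I E) (monomial m) (\<lambda>u. q (T u))" by blast
  from in_span_pullback[OF in_span_mult[OF DE], of "\<lambda>u. (u, u)" UNIV]
  have "in_span UNIV (exponents_on m I D \<times> exponents_on m I E)
     (\<lambda>s x. monomial m (fst s) x * monomial m (snd s) x) (\<lambda>u. p (T u) * q (T u))"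
    by (simp add: case_prod_beta)
  then have "in_span UNIV (exponents_on m I (D + E)) (monomial m) (\<lambda>u. p (T u) * q (T u))"
  proof (rule in_span_trans)
    fix s assume s: "s \<in> exponents_on m I D \<times> exponents_on m I E"
    have "(\<lambda>x. monomial m (fst s) x * monomial m (snd s) x) = monomial m (\<lambda>i. fst s i + snd s i)"
      by (simp add: monomial_add fun_eq_iff)
    then show "in_span UNIV (exponents_on m I (D + E)) (monomial m) (\<lambda>x. monomial m (fst s) x * monomial m (snd s) x)"
      using s by (simp only:) (rule in_span_base[OF finite_exponents], auto simp: exponents_def intro!: add_mono)
  qed
  then show ?case by blast
qed

text \<open>The coordinates with index in \<open>I\<close> satisfy a nontrivial polynomial relation on \<open>K\<close>.\<close>

definition dependent_coords :: "nat \<Rightarrow> nat set \<Rightarrow> (nat \<Rightarrow> real) set \<Rightarrow> bool" where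
  "dependent_coords m I K \<longleftrightarrow> (\<exists>D c. (\<exists>\<gamma>\<in>exponents_on m I D. c \<gamma> \<noteq> 0) \<and>
     (\<forall>x\<in>K. (\<Sum>\<gamma>\<in>exponents_on m I D. c \<gamma> * monomial m \<gamma> x) = 0))"

text \<open>
  The relation expresses its monomial of largest weight by monomials of smaller weight; it is
  unique, because \<open>E\<close> bounds all exponents that occur.
\<close>

lemma dependent_coords_leading:
  assumes c: "\<exists>\<gamma>\<in>exponents_on m I D. c \<gamma> \<noteq> 0"
    and rel: "\<forall>x\<in>K. (\<Sum>\<gamma>\<in>exponents_on m I D. c \<gamma> * monomial m \<gamma> x) = 0"
    and "D \<le> E"
  shows "\<exists>\<beta>\<in>exponents_on m I E.
    in_span K {\<gamma> \<in> exponents m (\<lambda>_. E). weight (Suc E) m \<gamma> < weight (Suc E) m \<beta>} (monomial m) (monomial m \<beta>)"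
proof -
  let ?X = "exponents_on m I D" and ?w = "weight (Suc E) m"
  define S where "S = {\<gamma> \<in> ?X. c \<gamma> \<noteq> 0}"
  have S: "finite S" "S \<noteq> {}" using c by (auto simp: S_def)
  obtain \<beta> where \<beta>: "\<beta> \<in> S" "\<And>\<gamma>. \<gamma> \<in> S \<Longrightarrow> ?w \<gamma> \<le> ?w \<beta>"
  proof -
    have "Max (?w ` S) \<in> ?w ` S" using S by simp
    then obtain \<beta> where "\<beta> \<in> S" "?w \<beta> = Max (?w ` S)" by auto
    then show ?thesis using that S(1) by simp
  qed
  have XE: "?X \<subseteq> exponents_on m I E" "?X \<subseteq> exponents m (\<lambda>_. E)"
    using assms(3) by (auto intro!: exponents_mono)
  have less: "?w \<gamma> < ?w \<beta>" if "\<gamma> \<in> S - {\<beta>}" for \<gamma>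
  proof -
    have "?w \<gamma> \<noteq> ?w \<beta>"
    proof
      assume "?w \<gamma> = ?w \<beta>"
      moreover have "\<gamma> \<in> exponents m (\<lambda>_. E)" "\<beta> \<in> exponents m (\<lambda>_. E)" using that \<beta>(1) XE by (auto simp: S_def)
      ultimately have "\<gamma> = \<beta>" using weight_inj[of m \<gamma> E \<beta>] by (auto simp: exponents_def fun_eq_iff) (metis not_le)
      then show False using that by simp
    qed
    then show ?thesis using \<beta>(2)[of \<gamma>] that by simp
  qed
  have "in_span K {\<gamma> \<in> exponents m (\<lambda>_. E). ?w \<gamma> < ?w \<beta>} (monomial m) (\<lambda>x. \<Sum>\<gamma>\<in>S - {\<beta>}. (- c \<gamma> / c \<beta>) * monomial m \<gamma> x)"
    using less XE by (intro in_span_sum in_span_scale in_span_base) (auto simp: S_def)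
  moreover have "monomial m \<beta> x = (\<Sum>\<gamma>\<in>S - {\<beta>}. (- c \<gamma> / c \<beta>) * monomial m \<gamma> x)" if "x \<in> K" for x
  proof -
    have "0 = (\<Sum>\<gamma>\<in>?X. c \<gamma> * monomial m \<gamma> x)" using rel that by simp
    also have "\<dots> = (\<Sum>\<gamma>\<in>S. c \<gamma> * monomial m \<gamma> x)"
      by (rule sum.mono_neutral_right) (auto simp: S_def)
    also have "\<dots> = c \<beta> * monomial m \<beta> x + (\<Sum>\<gamma>\<in>S - {\<beta>}. c \<gamma> * monomial m \<gamma> x)"
      by (rule sum.remove[OF S(1) \<beta>(1)])
    finally have "monomial m \<beta> x = - (\<Sum>\<gamma>\<in>S - {\<beta>}. c \<gamma> * monomial m \<gamma> x) / c \<beta>"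
      using \<beta>(1) by (simp add: S_def field_simps eq_neg_iff_add_eq_0)
    then show ?thesis by (simp add: sum_negf[symmetric] sum_divide_distrib)
  qed
  ultimately have "in_span K {\<gamma> \<in> exponents m (\<lambda>_. E). ?w \<gamma> < ?w \<beta>} (monomial m) (monomial m \<beta>)"
    by (rule in_span_cong)
  then show ?thesis using \<beta>(1) XE by (auto simp: S_def)
qed

text \<open>The exponents of weight at most \<open>N\<close> with at most \<open>k\<close> entries above \<open>D\<close>. There are \<open>O(N\<^sup>k)\<close> of them.\<close>

definition standard :: "nat \<Rightarrow> nat \<Rightarrow> nat \<Rightarrow> nat \<Rightarrow> (nat \<Rightarrow> nat) set" where
  "standard m D k N = {\<sigma>. (\<forall>i\<ge>m. \<sigma> i = 0) \<and> weight (Suc D) m \<sigma> \<le> N \<and> card {i. i < m \<and> D < \<sigma> i} \<le> k}"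

lemma exponent_le_weight: "i < m \<Longrightarrow> \<sigma> i \<le> weight (Suc D) m \<sigma>"
proof -
  assume "i < m"
  then have "\<sigma> i * Suc D ^ i \<le> (\<Sum>i<m. \<sigma> i * Suc D ^ i)" by (intro member_le_sum) auto
  moreover have "\<sigma> i * 1 \<le> \<sigma> i * Suc D ^ i" by (intro mult_left_mono) auto
  ultimately show ?thesis unfolding weight_def by linarith
qed

lemma standard_subset:
  "standard m D k N \<subseteq> (\<Union>J\<in>{J. J \<subseteq> {..<m} \<and> card J \<le> k}. exponents m (\<lambda>i. if i \<in> J then N else D))"
proof
  fix \<sigma> assume s: "\<sigma> \<in> standard m D k N"
  let ?J = "{i. i < m \<and> D < \<sigma> i}"
  have "\<sigma> i \<le> N" if "i < m" for i
    using exponent_le_weight[OF that, of \<sigma> D] s by (simp add: standard_def)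
  then have "\<sigma> \<in> exponents m (\<lambda>i. if i \<in> ?J then N else D)" using s by (auto simp: exponents_def standard_def)
  moreover have "?J \<subseteq> {..<m} \<and> card ?J \<le> k" using s by (auto simp: standard_def)
  ultimately show "\<sigma> \<in> (\<Union>J\<in>{J. J \<subseteq> {..<m} \<and> card J \<le> k}. exponents m (\<lambda>i. if i \<in> J then N else D))"
    by blast
qed

lemma finite_subsets_card_le: "finite {J. J \<subseteq> {..<m::nat} \<and> card J \<le> k}"
  by (rule finite_subset[of _ "Pow {..<m}"]) auto

lemma finite_standard [simp]: "finite (standard m D k N)"
  by (rule finite_subset[OF standard_subset]) (simp add: finite_subsets_card_le)

lemma card_standard_le: "card (standard m D k N) \<le> 2 ^ m * Suc D ^ m * Suc N ^ k"
proof -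
  let ?\<J> = "{J. J \<subseteq> {..<m} \<and> card J \<le> k}"
  have fin: "finite ?\<J>" by (rule finite_subsets_card_le)
  have "card (exponents m (\<lambda>i. if i \<in> J then N else D)) \<le> Suc D ^ m * Suc N ^ k" if J: "J \<in> ?\<J>" for J
  proof -
    have finJ: "finite J" using J finite_subset by auto
    have "card (exponents m (\<lambda>i. if i \<in> J then N else D)) = (\<Prod>i<m. Suc (if i \<in> J then N else D))"
      by (rule card_exponents)
    also have "\<dots> \<le> (\<Prod>i<m. Suc D * (if i \<in> J then Suc N else 1))" by (intro prod_mono) auto
    also have "\<dots> = Suc D ^ m * (\<Prod>i<m. if i \<in> J then Suc N else 1)"
      by (simp only: prod.distrib) simp
    also have "(\<Prod>i<m. if i \<in> J then Suc N else 1) = Suc N ^ card J"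
    proof -
      have "(\<Prod>i<m. if i \<in> J then Suc N else 1) = (\<Prod>i\<in>J. Suc N)"
        using J by (intro prod.mono_neutral_cong_right) auto
      then show ?thesis by simp
    qed
    also have "Suc D ^ m * Suc N ^ card J \<le> Suc D ^ m * Suc N ^ k"
      using J by (intro mult_left_mono power_increasing) auto
    finally show ?thesis .
  qed
  then have "card (\<Union>J\<in>?\<J>. exponents m (\<lambda>i. if i \<in> J then N else D)) \<le> (\<Sum>J\<in>?\<J>. Suc D ^ m * Suc N ^ k)"
    by (intro order_trans[OF card_UN_le[OF fin]] sum_mono)
  also have "\<dots> = card ?\<J> * (Suc D ^ m * Suc N ^ k)" by simp
  also have "card ?\<J> \<le> 2 ^ m"
    using card_mono[of "Pow {..<m}" ?\<J>] by (auto simp: card_Pow)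
  finally have "card (\<Union>J\<in>?\<J>. exponents m (\<lambda>i. if i \<in> J then N else D)) \<le> 2 ^ m * (Suc D ^ m * Suc N ^ k)"
    by simp
  moreover have "card (standard m D k N) \<le> card (\<Union>J\<in>?\<J>. exponents m (\<lambda>i. if i \<in> J then N else D))"
    by (rule card_mono[OF _ standard_subset]) (simp add: fin)
  ultimately show ?thesis by simp
qed

lemma standard_mono: "N \<le> N' \<Longrightarrow> standard m D k N \<subseteq> standard m D k N'"
  by (auto simp: standard_def)

text \<open>
  An exponent with more than \<open>k\<close> large entries is divisible by the leading monomial of one of the
  relations, so it can be reduced to smaller weight.
\<close>

lemma monomials_in_standard_span:
  assumes dep: "\<And>I. I \<subseteq> {..<m} \<Longrightarrow> card I = Suc k \<Longrightarrow> dependent_coords m I K"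
  shows "\<exists>D. \<forall>\<alpha>. (\<forall>i\<ge>m. \<alpha> i = 0) \<longrightarrow> in_span K (standard m D k (weight (Suc D) m \<alpha>)) (monomial m) (monomial m \<alpha>)"
proof -
  let ?\<I> = "{I. I \<subseteq> {..<m} \<and> card I = Suc k}"
  have fin: "finite ?\<I>" by (rule finite_subset[of _ "Pow {..<m}"]) auto
  define rel where "rel I D c \<longleftrightarrow> (\<exists>\<gamma>\<in>exponents_on m I D. c \<gamma> \<noteq> 0) \<and>
     (\<forall>x\<in>K. (\<Sum>\<gamma>\<in>exponents_on m I D. c \<gamma> * monomial m \<gamma> x) = 0)" for I D c
  have "\<exists>Dc. rel I (fst Dc) (snd Dc)" if "I \<in> ?\<I>" for I
  proof -
    have "dependent_coords m I K" using dep that by simp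
    then obtain D c where "rel I D c" unfolding dependent_coords_def rel_def by (elim exE)
    then show ?thesis by (intro exI[of _ "(D, c)"]) simp
  qed
  then have "\<forall>I\<in>?\<I>. \<exists>Dc. rel I (fst Dc) (snd Dc)" by blast
  from bchoice[OF this] obtain Dc where Dc: "\<forall>I\<in>?\<I>. rel I (fst (Dc I)) (snd (Dc I))" by (elim exE)
  define D c where "D I = fst (Dc I)" and "c I = snd (Dc I)" for I
  have rel: "rel I (D I) (c I)" if "I \<in> ?\<I>" for I using Dc that by (simp add: D_def c_def)
  define E where "E = Max (insert 0 (D ` ?\<I>))"
  have DE: "D I \<le> E" if "I \<in> ?\<I>" for I using that fin by (simp add: E_def)
  let ?w = "weight (Suc E) m"
  have "\<exists>\<beta>\<in>exponents_on m I E.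
      in_span K {\<gamma> \<in> exponents m (\<lambda>_. E). ?w \<gamma> < ?w \<beta>} (monomial m) (monomial m \<beta>)" if "I \<in> ?\<I>" for I
    using dependent_coords_leading[of m I "D I" "c I" K E] rel[OF that] DE[OF that] unfolding rel_def by blast
  then have "\<forall>I\<in>?\<I>. \<exists>\<beta>. \<beta> \<in> exponents_on m I E \<and>
      in_span K {\<gamma> \<in> exponents m (\<lambda>_. E). ?w \<gamma> < ?w \<beta>} (monomial m) (monomial m \<beta>)" by blast
  from bchoice[OF this] obtain b where b: "\<And>I. I \<in> ?\<I> \<Longrightarrow> b I \<in> exponents_on m I E"
    "\<And>I. I \<in> ?\<I> \<Longrightarrow> in_span K {\<gamma> \<in> exponents m (\<lambda>_. E). ?w \<gamma> < ?w (b I)} (monomial m) (monomial m (b I))"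
    by blast
  have "in_span K (standard m E k (?w \<alpha>)) (monomial m) (monomial m \<alpha>)" if "\<forall>i\<ge>m. \<alpha> i = 0" for \<alpha>
    using that
  proof (induction "?w \<alpha>" arbitrary: \<alpha> rule: less_induct)
    case less
    let ?J = "{i. i < m \<and> E < \<alpha> i}"
    show ?case
    proof (cases "card ?J \<le> k")
      case True
      then show ?thesis using less.prems by (intro in_span_base finite_standard) (auto simp: standard_def)
    next
      case False
      then obtain I where I: "I \<subseteq> ?J" "card I = Suc k"
        using obtain_subset_with_card_n[of "Suc k" ?J] by auto
      then have II: "I \<in> ?\<I>" by auto
      define \<beta> where "\<beta> = b I"
      have \<beta>le: "\<beta> i \<le> \<alpha> i" for i
        using b(1)[OF II] I(1) less.prems unfolding \<beta>_def exponents_def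
        by (cases "i < m"; cases "i \<in> I") (force simp: subset_iff)+
      define \<delta> where "\<delta> = (\<lambda>i. \<alpha> i - \<beta> i)"
      have \<alpha>: "\<alpha> = (\<lambda>i. \<delta> i + \<beta> i)" using \<beta>le by (simp add: \<delta>_def fun_eq_iff)
      define G where "G = {\<gamma> \<in> exponents m (\<lambda>_. E). ?w \<gamma> < ?w \<beta>}"
      obtain a where a: "\<And>x. x \<in> K \<Longrightarrow> monomial m \<beta> x = (\<Sum>\<gamma>\<in>G. a \<gamma> * monomial m \<gamma> x)"
        using b(2)[OF II] unfolding in_span_def \<beta>_def G_def by blast
      have "in_span K (standard m E k (?w \<alpha>)) (monomial m) (\<lambda>x. \<Sum>\<gamma>\<in>G. a \<gamma> * monomial m (\<lambda>i. \<delta> i + \<gamma> i) x)"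
      proof (intro in_span_sum in_span_scale)
        fix \<gamma> assume \<gamma>: "\<gamma> \<in> G"
        have less': "?w (\<lambda>i. \<delta> i + \<gamma> i) < ?w \<alpha>"
          using \<gamma> by (subst \<alpha>) (simp add: weight_add G_def)
        have "in_span K (standard m E k (?w (\<lambda>i. \<delta> i + \<gamma> i))) (monomial m) (monomial m (\<lambda>i. \<delta> i + \<gamma> i))"
          using \<gamma> less.prems by (intro less.hyps[OF less']) (auto simp: \<delta>_def G_def exponents_def)
        then show "in_span K (standard m E k (?w \<alpha>)) (monomial m) (monomial m (\<lambda>i. \<delta> i + \<gamma> i))"
          by (rule in_span_mono) (use less' in \<open>auto intro!: standard_mono\<close>)
      qed
      then show ?thesis
      proof (rule in_span_cong)
        fix x assume "x \<in> K"
        show "monomial m \<alpha> x = (\<Sum>\<gamma>\<in>G. a \<gamma> * monomial m (\<lambda>i. \<delta> i + \<gamma> i) x)"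
          using a[OF \<open>x \<in> K\<close>] by (subst \<alpha>) (simp add: monomial_add sum_distrib_left mult_ac)
      qed
    qed
  qed
  then show ?thesis by blast
qed

lemma monomial_diff_in_span:
  assumes "\<forall>i\<ge>m. \<alpha> i = 0"
  shows "in_span UNIV (exponents m \<alpha> \<times> exponents m \<alpha>) (bimonomial m)
    (\<lambda>(x, y). monomial m \<alpha> (\<lambda>i. x i - y i))"
proof -
  define C where "C g = (\<Prod>i<m. of_nat (\<alpha> i choose g i) * (-1) ^ (\<alpha> i - g i) :: real)" for g :: "nat \<Rightarrow> nat"
  define e where "e g = (\<lambda>i. if i < m then g i else 0)" for g :: "nat \<Rightarrow> nat"
  let ?P = "PiE {..<m} (\<lambda>i. {..\<alpha> i})"
  have eq: "monomial m \<alpha> (\<lambda>i. x i - y i) = (\<Sum>g\<in>?P. C g * (monomial m (e g) x * monomial m (\<lambda>i. \<alpha> i - e g i) y))" for x y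
  proof -
    have "(x i - y i) ^ \<alpha> i = (\<Sum>j\<le>\<alpha> i. of_nat (\<alpha> i choose j) * (-1) ^ (\<alpha> i - j) * (x i ^ j * y i ^ (\<alpha> i - j)))" for i
    proof -
      have "(x i - y i) ^ \<alpha> i = (x i + (-1) * y i) ^ \<alpha> i" by simp
      also have "\<dots> = (\<Sum>j\<le>\<alpha> i. of_nat (\<alpha> i choose j) * x i ^ j * ((-1) * y i) ^ (\<alpha> i - j))"
        by (rule binomial_ring)
      also have "\<dots> = (\<Sum>j\<le>\<alpha> i. of_nat (\<alpha> i choose j) * (-1) ^ (\<alpha> i - j) * (x i ^ j * y i ^ (\<alpha> i - j)))"
        by (intro sum.cong refl) (simp only: power_mult_distrib mult_ac)
      finally show ?thesis .
    qed
    then have "monomial m \<alpha> (\<lambda>i. x i - y i) =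
        (\<Prod>i<m. \<Sum>j\<in>{..\<alpha> i}. of_nat (\<alpha> i choose j) * (-1) ^ (\<alpha> i - j) * (x i ^ j * y i ^ (\<alpha> i - j)))"
      by (simp add: monomial_def)
    also have "\<dots> = (\<Sum>g\<in>?P. \<Prod>i<m. of_nat (\<alpha> i choose g i) * (-1) ^ (\<alpha> i - g i) * (x i ^ g i * y i ^ (\<alpha> i - g i)))"
      by (rule prod_sum_PiE) auto
    also have "\<dots> = (\<Sum>g\<in>?P. C g * (monomial m (e g) x * monomial m (\<lambda>i. \<alpha> i - e g i) y))"
      by (intro sum.cong refl) (simp add: C_def monomial_def e_def prod.distrib)
    finally show ?thesis .
  qed
  define B where "B = bimonomial m"
  have "in_span UNIV (exponents m \<alpha> \<times> exponents m \<alpha>) B (\<lambda>z. C g * B (e g, \<lambda>i. \<alpha> i - e g i) z)" if "g \<in> ?P" for g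
  proof -
    have "(e g, \<lambda>i. \<alpha> i - e g i) \<in> exponents m \<alpha> \<times> exponents m \<alpha>"
      using that assms by (auto simp: exponents_def e_def PiE_iff)
    then have "in_span UNIV (exponents m \<alpha> \<times> exponents m \<alpha>) B (B (e g, \<lambda>i. \<alpha> i - e g i))"
      by (intro in_span_base finite_cartesian_product finite_exponents)
    then show ?thesis by (rule in_span_scale)
  qed
  then have "in_span UNIV (exponents m \<alpha> \<times> exponents m \<alpha>) B (\<lambda>z. \<Sum>g\<in>?P. C g * B (e g, \<lambda>i. \<alpha> i - e g i) z)"
    by (rule in_span_sum)
  then have "in_span UNIV (exponents m \<alpha> \<times> exponents m \<alpha>) B (\<lambda>(x, y). monomial m \<alpha> (\<lambda>i. x i - y i))"
    by (rule in_span_cong) (simp add: B_def eq case_prod_beta)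
  then show ?thesis unfolding B_def .
qed

lemma weight_mono: "(\<And>i. i < m \<Longrightarrow> \<sigma> i \<le> \<alpha> i) \<Longrightarrow> weight B m \<sigma> \<le> weight B m \<alpha>"
  unfolding weight_def by (intro sum_mono mult_right_mono) auto

lemma differences_algebraic_relation:
  assumes dep: "\<And>I. I \<subseteq> {..<m} \<Longrightarrow> card I = Suc k \<Longrightarrow> dependent_coords m I K"
    and "2 * k < m"
  shows "\<exists>M c. (\<exists>\<alpha>\<in>exponents m (\<lambda>_. M). c \<alpha> \<noteq> 0) \<and>
    (\<forall>x\<in>K. \<forall>y\<in>K. (\<Sum>\<alpha>\<in>exponents m (\<lambda>_. M). c \<alpha> * monomial m \<alpha> (\<lambda>i. x i - y i)) = 0)"
proof -
  obtain D where D: "\<And>\<alpha>. \<forall>i\<ge>m. \<alpha> i = 0 \<Longrightarrow> in_span K (standard m D k (weight (Suc D) m \<alpha>)) (monomial m) (monomial m \<alpha>)"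
    using monomials_in_standard_span[OF dep] by blast
  let ?w = "weight (Suc D) m"
  define W where "W = ?w (\<lambda>_. 1)"
  \<comment> \<open>\<open>C\<close> serves both as the constant in the bound \<open>C * Suc M ^ (2 * k)\<close> and as the bound \<open>M\<close> on the exponents\<close>
  define C where "C = (2 ^ m * Suc D ^ m * Suc W ^ k) ^ 2"
  define S where "S = standard m D k (C * W)"
  have S: "card S \<le> 2 ^ m * Suc D ^ m * Suc W ^ k * Suc C ^ k"
  proof -
    have "Suc (C * W) \<le> Suc W * Suc C" by simp
    then have "Suc (C * W) ^ k \<le> (Suc W * Suc C) ^ k" by (rule power_mono) simp
    then have "2 ^ m * Suc D ^ m * Suc (C * W) ^ k \<le> 2 ^ m * Suc D ^ m * (Suc W ^ k * Suc C ^ k)"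
      by (intro mult_left_mono) (auto simp only: power_mult_distrib)
    then have "card S \<le> 2 ^ m * Suc D ^ m * (Suc W ^ k * Suc C ^ k)"
      using card_standard_le[of m D k "C * W"] unfolding S_def by linarith
    then show ?thesis by (simp only: mult.assoc)
  qed
  have "card (S \<times> S) = card S ^ 2" by (simp add: card_cartesian_product power2_eq_square)
  also have "\<dots> \<le> (2 ^ m * Suc D ^ m * Suc W ^ k * Suc C ^ k) ^ 2" by (rule power_mono[OF S]) simp
  also have "\<dots> = C * Suc C ^ (2 * k)" by (simp only: C_def power_mult_distrib power_mult[symmetric] mult.commute[of k 2])
  also have "\<dots> < Suc C * Suc C ^ (2 * k)" by (rule mult_strict_right_mono) auto
  also have "\<dots> = Suc C ^ Suc (2 * k)" by simp
  also have "\<dots> \<le> Suc C ^ m" using assms(2) by (intro power_increasing) auto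
  also have "\<dots> = card (exponents m (\<lambda>_. C))" by (simp add: card_exponents)
  finally have card: "card (S \<times> S) < card (exponents m (\<lambda>_. C))" .
  have span: "in_span (K \<times> K) (S \<times> S) (bimonomial m)
      (\<lambda>(x, y). monomial m \<alpha> (\<lambda>i. x i - y i))" if \<alpha>: "\<alpha> \<in> exponents m (\<lambda>_. C)" for \<alpha>
  proof (rule in_span_trans)
    have \<alpha>0: "\<forall>i\<ge>m. \<alpha> i = 0" using \<alpha> by (simp add: exponents_def)
    show "in_span (K \<times> K) (exponents m \<alpha> \<times> exponents m \<alpha>) (bimonomial m)
        (\<lambda>(x, y). monomial m \<alpha> (\<lambda>i. x i - y i))"
      using in_span_pullback[OF monomial_diff_in_span[OF \<alpha>0], of id "K \<times> K"] by simp
    have one: "in_span K S (monomial m) (monomial m \<sigma>)" if \<sigma>: "\<sigma> \<in> exponents m \<alpha>" for \<sigma>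
    proof -
      have "?w \<sigma> \<le> ?w (\<lambda>_. C)" using \<sigma> \<alpha> by (intro weight_mono) (auto simp: exponents_def intro: order_trans)
      also have "\<dots> = C * W" by (simp add: W_def weight_def sum_distrib_left)
      finally have "?w \<sigma> \<le> C * W" .
      then show ?thesis
        using in_span_mono[OF D[of \<sigma>] standard_mono finite_standard] \<sigma> by (simp add: S_def exponents_def)
    qed
    fix s assume "s \<in> exponents m \<alpha> \<times> exponents m \<alpha>"
    then show "in_span (K \<times> K) (S \<times> S) (bimonomial m)
        ((bimonomial m) s)"
      using in_span_mult[OF one one] by auto
  qed
  define B where "B = bimonomial m"
  have "\<forall>\<alpha>\<in>exponents m (\<lambda>_. C). \<exists>a. \<forall>z\<in>K \<times> K.
      (\<lambda>(x, y). monomial m \<alpha> (\<lambda>i. x i - y i)) z = (\<Sum>s\<in>S \<times> S. a s * B s z)"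
    using span unfolding in_span_def B_def by blast
  from bchoice[OF this] obtain a where a': "\<forall>\<alpha>\<in>exponents m (\<lambda>_. C). \<forall>z\<in>K \<times> K.
      (\<lambda>(x, y). monomial m \<alpha> (\<lambda>i. x i - y i)) z = (\<Sum>s\<in>S \<times> S. a \<alpha> s * B s z)"
    by (elim exE)
  have a: "monomial m \<alpha> (\<lambda>i. x i - y i) = (\<Sum>s\<in>S \<times> S. a \<alpha> s * B s (x, y))"
    if "\<alpha> \<in> exponents m (\<lambda>_. C)" "x \<in> K" "y \<in> K" for \<alpha> x y
    using bspec[OF bspec[OF a' that(1)], of "(x, y)"] that by simp
  obtain c where c: "\<exists>\<alpha>\<in>exponents m (\<lambda>_. C). c \<alpha> \<noteq> 0"
    "\<forall>s\<in>S \<times> S. (\<Sum>\<alpha>\<in>exponents m (\<lambda>_. C). a \<alpha> s * c \<alpha>) = 0"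
    using homogeneous_system_nontrivial_solution[OF _ _ card, of "\<lambda>s \<alpha>. a \<alpha> s"] by (auto simp: S_def)
  have "(\<Sum>\<alpha>\<in>exponents m (\<lambda>_. C). c \<alpha> * monomial m \<alpha> (\<lambda>i. x i - y i)) = 0" if "x \<in> K" "y \<in> K" for x y
  proof -
    let ?B = "\<lambda>s. B s (x, y)"
    have "(\<Sum>\<alpha>\<in>exponents m (\<lambda>_. C). c \<alpha> * monomial m \<alpha> (\<lambda>i. x i - y i)) =
        (\<Sum>\<alpha>\<in>exponents m (\<lambda>_. C). \<Sum>s\<in>S \<times> S. c \<alpha> * (a \<alpha> s * ?B s))"
      using a[OF _ that] by (intro sum.cong refl) (simp only: sum_distrib_left)
    also have "\<dots> = (\<Sum>s\<in>S \<times> S. \<Sum>\<alpha>\<in>exponents m (\<lambda>_. C). c \<alpha> * (a \<alpha> s * ?B s))"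
      by (rule sum.swap)
    also have "\<dots> = (\<Sum>s\<in>S \<times> S. (\<Sum>\<alpha>\<in>exponents m (\<lambda>_. C). a \<alpha> s * c \<alpha>) * ?B s)"
      unfolding sum_distrib_right by (intro sum.cong refl) (simp only: mult_ac)
    also have "\<dots> = 0" using c(2) by (intro sum.neutral) auto
    finally show ?thesis .
  qed
  then show ?thesis using c(1) by blast
qed

text \<open>
  The direction \<open>v\<close> comes from Kronecker's substitution \<open>v i = s ^ (B ^ i)\<close> with \<open>B = M + 1\<close>, which turns
  distinct monomials into distinct powers of \<open>s\<close>. Close to \<open>v\<close> and for small \<open>t \<noteq> 0\<close>, the polynomial with
  coefficients \<open>c\<close> does not vanish at \<open>t u\<close>.
\<close>

lemma secants_avoid_direction:
  assumes c: "\<exists>\<alpha>\<in>exponents m (\<lambda>_. M). c \<alpha> \<noteq> 0"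
    and rel: "\<And>x y. x \<in> K \<Longrightarrow> y \<in> K \<Longrightarrow> (\<Sum>\<alpha>\<in>exponents m (\<lambda>_. M). c \<alpha> * monomial m \<alpha> (\<lambda>i. x i - y i)) = 0"
  shows "\<exists>v \<epsilon>. v \<in> Rn m \<and> (\<forall>i<m. v i \<noteq> 0) \<and> \<epsilon> > 0 \<and>
    (\<forall>x\<in>K. \<forall>y\<in>K. \<forall>t. t \<noteq> 0 \<and> \<bar>t\<bar> < \<epsilon> \<longrightarrow> (\<exists>i<m. \<epsilon> * \<bar>t\<bar> \<le> \<bar>x i - y i - t * v i\<bar>))"
proof -
  let ?X = "exponents m (\<lambda>_. M)" and ?w = "weight (Suc M) m"
  define S where "S = {\<alpha> \<in> ?X. c \<alpha> \<noteq> 0}"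
  define deg where "deg \<alpha> = (\<Sum>i<m. \<alpha> i)" for \<alpha> :: "nat \<Rightarrow> nat"
  have S: "finite S" "S \<noteq> {}" using c by (auto simp: S_def)
  define d where "d = Min (deg ` S)"
  have dmin: "d \<le> deg \<alpha>" if "\<alpha> \<in> S" for \<alpha> using that S by (simp add: d_def)
  obtain \<alpha>0 where \<alpha>0: "\<alpha>0 \<in> S" "deg \<alpha>0 = d"
  proof -
    have "d \<in> deg ` S" using Min_in[of "deg ` S"] S by (simp add: d_def)
    then show ?thesis using that by auto
  qed
  \<comment> \<open>the lowest homogeneous part under Kronecker's substitution, as a polynomial in \<open>s\<close>\<close>
  define q where "q = (\<Sum>\<alpha>\<in>{\<alpha>\<in>S. deg \<alpha> = d}. monom (c \<alpha>) (?w \<alpha>))"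
  have "coeff q (?w \<alpha>0) = (\<Sum>\<alpha>\<in>{\<alpha>\<in>S. deg \<alpha> = d}. if \<alpha> = \<alpha>0 then c \<alpha> else 0)"
    unfolding q_def coeff_sum coeff_monom
  proof (intro sum.cong refl)
    fix \<alpha> assume "\<alpha> \<in> {\<alpha>\<in>S. deg \<alpha> = d}"
    then have "\<alpha> = \<alpha>0" if "?w \<alpha> = ?w \<alpha>0"
      using weight_inj[of m \<alpha> M \<alpha>0] that \<alpha>0(1) by (auto simp: S_def exponents_def fun_eq_iff) (metis not_le)
    then show "(if ?w \<alpha> = ?w \<alpha>0 then c \<alpha> else 0) = (if \<alpha> = \<alpha>0 then c \<alpha> else 0)" by auto
  qed
  also have "\<dots> = c \<alpha>0" using S \<alpha>0 by simp
  finally have "q \<noteq> 0" using \<alpha>0 by (auto simp: S_def)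
  then have "finite {s. poly ([:0, 1:] * q) s = 0}" by (intro poly_roots_finite) simp
  then obtain s where "poly ([:0, 1:] * q) s \<noteq> 0"
    using infinite_UNIV_char_0[where 'a=real] by (metis (mono_tags, lifting) UNIV_eq_I mem_Collect_eq)
  then have s: "s \<noteq> 0" "poly q s \<noteq> 0" by auto
  define v where "v = trunc m (\<lambda>i. s ^ (Suc M ^ i))"
  have monv: "monomial m \<alpha> v = s ^ ?w \<alpha>" for \<alpha>
    by (simp add: monomial_def v_def trunc_def weight_def power_sum power_mult[symmetric] mult.commute)
  \<comment> \<open>the quotient by \<open>t ^ d\<close> of the value at \<open>t u\<close>, where \<open>e\<close> consists of \<open>u\<close> and of \<open>t\<close> at index \<open>m\<close>\<close>
  define G where "G e = (\<Sum>\<alpha>\<in>S. c \<alpha> * (e m ^ (deg \<alpha> - d) * monomial m \<alpha> e))" for e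
  have "polyfun G" unfolding G_def monomial_def by (intro polyfun_sum polyfun_mult polyfun_prod polyfun_power polyfun_const polyfun_coord)
  have "v m = 0" by (simp add: v_def trunc_def)
  then have "G v = (\<Sum>\<alpha>\<in>S. if deg \<alpha> = d then c \<alpha> * s ^ ?w \<alpha> else 0)"
    unfolding G_def by (intro sum.cong refl) (use dmin in \<open>auto simp: monv power_0_left le_antisym\<close>)
  also have "\<dots> = poly q s"
    unfolding q_def sum.inter_filter[OF S(1)] poly_sum by (intro sum.cong refl) (simp add: poly_monom)
  finally have "G v \<noteq> 0" using s by simp
  have "open {e. G e \<noteq> 0}"
    using open_Collect_neq[OF polyfun_continuous[OF \<open>polyfun G\<close>] continuous_on_const] .
  moreover have "v \<in> Rn (Suc m)" by (simp add: v_def trunc_def mem_Rn_iff)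
  ultimately obtain \<epsilon> where \<epsilon>: "\<epsilon> > 0" "cube (Suc m) v \<epsilon> \<subseteq> {e. G e \<noteq> 0}"
    using Rn_nbhd[of "{e. G e \<noteq> 0}" v "Suc m"] \<open>G v \<noteq> 0\<close> by auto
  have "\<exists>i<m. \<epsilon> * \<bar>t\<bar> \<le> \<bar>x i - y i - t * v i\<bar>" if xy: "x \<in> K" "y \<in> K" and t: "t \<noteq> 0" "\<bar>t\<bar> < \<epsilon>" for x y t
  proof (rule ccontr)
    assume "\<not> ?thesis"
    then have close: "\<bar>x i - y i - t * v i\<bar> < \<epsilon> * \<bar>t\<bar>" if "i < m" for i using that by force
    define e where "e = (\<lambda>i. if i < m then (x i - y i) / t else if i = m then t else 0)"
    have "\<bar>e i - v i\<bar> < \<epsilon>" if "i < Suc m" for i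
    proof (cases "i = m")
      case True then show ?thesis using t \<open>v m = 0\<close> by (simp add: e_def)
    next
      case False
      then have "i < m" using that by simp
      have "e i - v i = (x i - y i - t * v i) / t" using t \<open>i < m\<close> by (simp add: e_def field_simps)
      then have "\<bar>e i - v i\<bar> = \<bar>x i - y i - t * v i\<bar> / \<bar>t\<bar>" by (simp add: abs_divide)
      then show ?thesis using close[OF \<open>i < m\<close>] t by (simp add: pos_divide_less_eq)
    qed
    then have "e \<in> cube (Suc m) v \<epsilon>" by (auto simp: cube_def mem_Rn_iff e_def)
    then have "G e \<noteq> 0" using \<epsilon> by blast
    moreover have "t ^ d * G e = 0"
    proof -
      have "t ^ d * (c \<alpha> * (e m ^ (deg \<alpha> - d) * monomial m \<alpha> e)) = c \<alpha> * monomial m \<alpha> (\<lambda>i. x i - y i)" if "\<alpha> \<in> S" for \<alpha>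
      proof -
        have "t ^ d * t ^ (deg \<alpha> - d) = t ^ deg \<alpha>"
          using dmin[OF that] by (simp add: power_add[symmetric])
        moreover have "t ^ deg \<alpha> * monomial m \<alpha> e = monomial m \<alpha> (\<lambda>i. x i - y i)"
        proof -
          have "t ^ deg \<alpha> * monomial m \<alpha> e = (\<Prod>i<m. t ^ \<alpha> i * e i ^ \<alpha> i)"
            by (simp add: deg_def monomial_def power_sum prod.distrib)
          also have "\<dots> = monomial m \<alpha> (\<lambda>i. x i - y i)"
            unfolding monomial_def using t by (intro prod.cong refl) (simp add: e_def power_mult_distrib[symmetric])
          finally show ?thesis .
        qed
        moreover have "e m = t" by (simp add: e_def)
        ultimately show ?thesis by (metis mult.assoc mult.left_commute)
      qed
      then have "t ^ d * G e = (\<Sum>\<alpha>\<in>S. c \<alpha> * monomial m \<alpha> (\<lambda>i. x i - y i))"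
        unfolding G_def sum_distrib_left by (intro sum.cong refl)
      also have "\<dots> = (\<Sum>\<alpha>\<in>?X. c \<alpha> * monomial m \<alpha> (\<lambda>i. x i - y i))"
        by (rule sum.mono_neutral_left) (auto simp: S_def)
      finally show ?thesis using rel[OF xy] by simp
    qed
    ultimately show False using t by simp
  qed
  moreover have "\<forall>i<m. v i \<noteq> 0" using s by (simp add: v_def trunc_def)
  ultimately show ?thesis using \<epsilon>(1) v_def by (intro exI[of _ v] exI[of _ \<epsilon>]) simp
qed

section \<open>Cells in compact semialgebraic sets\<close>

text \<open>The lexicographic order of the first \<open>m\<close> coordinates.\<close>

definition lex_le :: "nat \<Rightarrow> (nat \<Rightarrow> real) \<Rightarrow> (nat \<Rightarrow> real) \<Rightarrow> bool" where
  "lex_le m x z \<longleftrightarrow> (\<forall>i<m. (\<exists>j<i. x j \<noteq> z j) \<or> x i \<le> z i)"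

lemma lex_le_antisym:
  assumes "x \<in> Rn m" "z \<in> Rn m" "lex_le m x z" "lex_le m z x"
  shows "x = z"
proof
  fix i show "x i = z i"
  proof (induction i rule: less_induct)
    case (less i)
    show ?case
    proof (cases "i < m")
      case True then show ?thesis using less assms(3,4) by (force simp: lex_le_def)
    next
      case False then show ?thesis using assms(1,2) by (simp add: mem_Rn_iff)
    qed
  qed
qed

lemma lex_minimum_exists:
  assumes "compact A" "A \<noteq> {}"
  shows "\<exists>x\<in>A. \<forall>z\<in>A. lex_le n x z"
proof (induction n)
  case 0 then show ?case using assms(2) by (auto simp: lex_le_def)
next
  case (Suc n)
  then obtain x where x: "x \<in> A" "\<And>z. z \<in> A \<Longrightarrow> lex_le n x z" by blast
  define A' where "A' = A \<inter> (\<Inter>j<n. {z. z j = x j})"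
  have "closed {z. z j = x j}" for j
    by (intro closed_Collect_eq continuous_on_const continuous_on_product_coordinates)
  then have "compact A'" unfolding A'_def using assms(1) by (intro compact_Int_closed closed_INT) auto
  moreover have "x \<in> A'" using x by (simp add: A'_def)
  moreover have "continuous_on A' (\<lambda>z. z n)"
    by (rule continuous_on_subset[OF continuous_on_product_coordinates]) simp
  ultimately obtain x' where x': "x' \<in> A'" "\<And>z. z \<in> A' \<Longrightarrow> x' n \<le> z n"
    using continuous_attains_inf[of A' "\<lambda>z. z n"] by blast
  have eq: "x' j = x j" if "j < n" for j using x'(1) that by (simp add: A'_def)
  have "lex_le (Suc n) x' z" if z: "z \<in> A" for z
    unfolding lex_le_def
  proof (intro allI impI)
    fix i assume "i < Suc n"
    then consider "i < n" | "i = n" by linarith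
    then show "(\<exists>j<i. x' j \<noteq> z j) \<or> x' i \<le> z i"
    proof cases
      case 1
      then have "\<forall>j\<le>i. x' j = x j" using eq by simp
      moreover have "(\<exists>j<i. x j \<noteq> z j) \<or> x i \<le> z i" using x(2)[OF z] 1 by (simp add: lex_le_def)
      ultimately show ?thesis by (metis less_imp_le order_refl)
    next
      case 2
      show ?thesis
      proof (cases "\<exists>j<n. x' j \<noteq> z j")
        case False
        then have "z \<in> A'" using z eq by (auto simp: A'_def)
        then show ?thesis using x'(2) 2 by blast
      qed (use 2 in auto)
    qed
  qed
  then show ?case using x'(1) by (auto simp: A'_def)
qed

text \<open>\<open>x\<close> is the lexicographic minimum of the fibre over \<open>y\<close> of the map \<open>\<pi>\<close>, restricted to \<open>K\<close>.\<close>

definition lex_section :: "nat \<Rightarrow> nat \<Rightarrow> (nat \<Rightarrow> real) set \<Rightarrow> ((nat \<Rightarrow> real) \<Rightarrow> nat \<Rightarrow> real) \<Rightarrow> (nat \<Rightarrow> real) \<Rightarrow> (nat \<Rightarrow> real) \<Rightarrow> bool" where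
  "lex_section m d K \<pi> y x \<longleftrightarrow> x \<in> K \<and> (\<forall>i<d. \<pi> x i = y i) \<and>
     (\<forall>z\<in>Rn m. z \<in> K \<longrightarrow> (\<forall>i<d. \<pi> z i = y i) \<longrightarrow> lex_le m x z)"

lemma semialg_lex_le:
  assumes "\<And>i. polyfun (\<lambda>e. A e i)" "\<And>i. polyfun (\<lambda>e. B e i)"
  shows "semialg (\<lambda>e. lex_le m (A e) (B e))"
  unfolding lex_le_def by (intro semialg_all_less semialg_or semialg_ex_less semialg_not semialg_eq semialg_le assms)

lemma semialg_lex_section:
  assumes K: "semialgebraic m K" and \<pi>: "\<And>i. polyfun (\<lambda>x. \<pi> x i)"
    and T: "\<And>i. polyfun (\<lambda>e. T e i)" and S: "\<And>i. polyfun (\<lambda>e. S e i)"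
  shows "semialg (\<lambda>e. lex_section m d K \<pi> (T e) (trunc m (S e)))"
proof -
  have \<pi>': "polyfun (\<lambda>e. \<pi> (A e) i)" if "\<And>i. polyfun (\<lambda>e. A e i)" for A i
    by (rule polyfun_compose[OF \<pi>, where T = A]) (rule that)
  have even_part: "polyfun (\<lambda>e. A (even_part e) i)" if "\<And>i. polyfun (\<lambda>e. A e i)" for A :: "(nat \<Rightarrow> real) \<Rightarrow> nat \<Rightarrow> real" and i
    by (rule polyfun_compose[OF that, where T = even_part]) (rule polyfun_even_part, rule polyfun_coord)
  have odd_part: "polyfun (\<lambda>e. odd_part e i)" for i by (rule polyfun_odd_part) (rule polyfun_coord)
  have "semialg (\<lambda>e. \<forall>z\<in>Rn m. z \<in> K \<longrightarrow> (\<forall>i<d. \<pi> z i = T e i) \<longrightarrow> lex_le m (trunc m (S e)) z)"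
    by (rule semialg_all) (intro semialg_imp semialg_mem[OF K] semialg_all_less semialg_eq semialg_lex_le \<pi>' polyfun_trunc even_part T S odd_part)
  moreover have "semialg (\<lambda>e. trunc m (S e) \<in> K)" by (rule semialg_mem[OF K S])
  moreover have "semialg (\<lambda>e. \<forall>i<d. \<pi> (trunc m (S e)) i = T e i)"
    by (intro semialg_all_less semialg_eq \<pi>' polyfun_trunc T S)
  ultimately show ?thesis unfolding lex_section_def by (intro semialg_and)
qed

lemma subtopology_Euclidean_space: "S \<subseteq> Rn n \<Longrightarrow> subtopology (Euclidean_space n) S = top_of_set S"
  by (simp add: Euclidean_space_def subtopology_subtopology euclidean_product_topology topspace_Euclidean_space Int_absorb1)

lemma open_coord_box: "open {y :: nat \<Rightarrow> real. \<forall>i<d. \<bar>y i - b i\<bar> < \<epsilon>}"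
proof -
  have "{y :: nat \<Rightarrow> real. \<forall>i<d. \<bar>y i - b i\<bar> < \<epsilon>} = (\<Inter>i<d. {y. \<bar>y i - b i\<bar> < \<epsilon>})" by auto
  moreover have "open {y :: nat \<Rightarrow> real. \<bar>y i - b i\<bar> < \<epsilon>}" for i
    by (intro open_Collect_less continuous_intros continuous_on_product_coordinates)
  ultimately show ?thesis by (simp add: open_INT)
qed

lemma cube_shrink:
  assumes "y \<in> cube d b \<epsilon>"
  shows "\<exists>\<rho>>0. cube d y \<rho> \<subseteq> cube d b \<epsilon>"
proof -
  obtain \<rho> where "\<rho> > 0" "cube d y \<rho> \<subseteq> {y. \<forall>i<d. \<bar>y i - b i\<bar> < \<epsilon>}"
    using Rn_nbhd[OF open_coord_box, of y d b \<epsilon> d] assms by (auto simp: cube_def)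
  then show ?thesis by (auto simp: cube_def)
qed

lemma cube_mono: "\<epsilon> \<le> \<epsilon>' \<Longrightarrow> cube d b \<epsilon> \<subseteq> cube d b \<epsilon>'"
  by (force simp: cube_def)

lemma join_trunc: "e \<in> Rn (d + m) \<Longrightarrow> join d (trunc d e) (trunc m (\<lambda>i. e (d + i))) = e"
  by (auto simp: join_def trunc_def mem_Rn_iff fun_eq_iff)

lemma trunc_join:
  assumes "z \<in> Rn d" "x \<in> Rn m"
  shows "trunc d (join d z x) = z" "trunc m (\<lambda>i. join d z x (d + i)) = x" "join d z x \<in> Rn (d + m)"
  using assms by (auto simp: join_def trunc_def mem_Rn_iff fun_eq_iff)

text \<open>The relation \<open>R\<close> describes the graph of \<open>f\<close>.\<close>

lemma semialgebraic_mapI: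
  assumes A: "semialgebraic d A" and f: "\<And>z. z \<in> A \<Longrightarrow> f z \<in> Rn m"
    and R: "\<And>z x. z \<in> A \<Longrightarrow> x \<in> Rn m \<Longrightarrow> R z x \<longleftrightarrow> x = f z"
    and semialg: "semialg (\<lambda>e. R (trunc d e) (trunc m (\<lambda>i. e (d + i))))"
  shows "semialgebraic_map d m A f"
proof -
  have "semialg (\<lambda>e. trunc d e \<in> A \<and> R (trunc d e) (trunc m (\<lambda>i. e (d + i))))"
    by (intro semialg_and semialg semialg_mem[OF A] polyfun_coord)
  then have "semialgebraic (d + m) {e \<in> Rn (d + m). trunc d e \<in> A \<and> R (trunc d e) (trunc m (\<lambda>i. e (d + i)))}"
    by (rule semialg_imp_semialgebraic)
  moreover have "{e \<in> Rn (d + m). trunc d e \<in> A \<and> R (trunc d e) (trunc m (\<lambda>i. e (d + i)))} =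
      (\<lambda>z. join d z (f z)) ` A"
  proof (intro set_eqI iffI)
    fix e assume "e \<in> {e \<in> Rn (d + m). trunc d e \<in> A \<and> R (trunc d e) (trunc m (\<lambda>i. e (d + i)))}"
    then have e: "e \<in> Rn (d + m)" "trunc d e \<in> A" "R (trunc d e) (trunc m (\<lambda>i. e (d + i)))" by auto
    then have "e = join d (trunc d e) (f (trunc d e))"
      using join_trunc[OF e(1)] R by simp
    then show "e \<in> (\<lambda>z. join d z (f z)) ` A" using e(2) by blast
  next
    fix e assume "e \<in> (\<lambda>z. join d z (f z)) ` A"
    then obtain z where z: "z \<in> A" "e = join d z (f z)" by blast
    moreover have "z \<in> Rn d" using semialgebraic_subset_Rn[OF A] z(1) by blast
    ultimately show "e \<in> {e \<in> Rn (d + m). trunc d e \<in> A \<and> R (trunc d e) (trunc m (\<lambda>i. e (d + i)))}"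
      using trunc_join[of z d "f z" m] f[OF z(1)] R[OF z(1)] by auto
  qed
  ultimately show ?thesis using A f by (auto simp: semialgebraic_map_def)
qed

lemma semialgebraic_open_cube: "semialgebraic d (open_cube d)"
  unfolding open_cube_def
  by (intro semialg_imp_semialgebraic semialg_all_less semialg_and semialg_less polyfun_const polyfun_coord)

lemma contains_cell_of_section:
  assumes K: "semialgebraic m K" and \<pi>: "\<And>i. polyfun (\<lambda>x. \<pi> x i)" "\<And>x. \<pi> x \<in> Rn d"
    and b: "b \<in> Rn d" "\<rho> > 0"
    and \<sigma>: "\<And>y. y \<in> cube d b \<rho> \<Longrightarrow> lex_section m d K \<pi> y (\<sigma> y)"
    and cont: "continuous_on (cube d b \<rho>) \<sigma>"
  shows "contains_cell m K d"
proof -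
  let ?LS = "lex_section m d K \<pi>"
  have KR: "K \<subseteq> Rn m" by (rule semialgebraic_subset_Rn[OF K])
  have \<sigma>K: "\<sigma> y \<in> K" and \<pi>\<sigma>: "\<pi> (\<sigma> y) = y" if "y \<in> cube d b \<rho>" for y
  proof -
    show "\<sigma> y \<in> K" using \<sigma>[OF that] by (simp add: lex_section_def)
    show "\<pi> (\<sigma> y) = y"
    proof
      fix i
      show "\<pi> (\<sigma> y) i = y i"
        using \<sigma>[OF that] \<pi>(2)[of "\<sigma> y"] that by (cases "i < d") (auto simp: lex_section_def cube_def mem_Rn_iff)
    qed
  qed
  have uniq: "x = \<sigma> y" if "y \<in> cube d b \<rho>" "?LS y x" for x y
  proof (rule lex_le_antisym)
    show "x \<in> Rn m" "\<sigma> y \<in> Rn m" using that \<sigma>K KR by (auto simp: lex_section_def)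
    show "lex_le m x (\<sigma> y)" "lex_le m (\<sigma> y) x"
      using that \<sigma>[OF that(1)] KR by (auto simp: lex_section_def)
  qed
  \<comment> \<open>the affine bijection from the unit cube onto the box, and its inverse\<close>
  define A where "A z = trunc d (\<lambda>i. b i + \<rho> * (2 * z i - 1))" for z
  define A' where "A' y = trunc d (\<lambda>i. ((y i - b i) / \<rho> + 1) / 2)" for y
  have pfA: "polyfun (\<lambda>z. A z i)" "polyfun (\<lambda>z. A' z i)" for i
    unfolding A_def A'_def by (intro polyfun_trunc polyfun_add polyfun_mult polyfun_diff polyfun_divide_const polyfun_const polyfun_coord)+
  have A: "A z \<in> cube d b \<rho>" if "z \<in> open_cube d" for z
  proof -
    have "\<bar>\<rho> * (2 * z i - 1)\<bar> < \<rho>" if "i < d" for i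
    proof -
      have "\<bar>2 * z i - 1\<bar> < 1" using that \<open>z \<in> open_cube d\<close> by (auto simp: open_cube_def abs_less_iff)
      then show ?thesis using b(2) by (simp add: abs_mult)
    qed
    then show ?thesis unfolding cube_def A_def by (auto simp: trunc_def mem_Rn_iff)
  qed
  have A': "A' y \<in> open_cube d" if "y \<in> cube d b \<rho>" for y
  proof -
    have "-1 < (y i - b i) / \<rho> \<and> (y i - b i) / \<rho> < 1" if "i < d" for i
    proof -
      have "\<bar>y i - b i\<bar> < \<rho>" using that \<open>y \<in> cube d b \<rho>\<close> by (simp add: cube_def)
      then show ?thesis using b(2) by (auto simp: pos_less_divide_eq pos_divide_less_eq abs_less_iff)
    qed
    then have "0 < ((y i - b i) / \<rho> + 1) / 2 \<and> ((y i - b i) / \<rho> + 1) / 2 < 1" if "i < d" for i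
      using that by force
    then show ?thesis unfolding open_cube_def A'_def by (auto simp: trunc_def mem_Rn_iff)
  qed
  have A'A: "A' (A z) = z" if "z \<in> open_cube d" for z
    using that b(2) by (auto simp: A_def A'_def trunc_def open_cube_def mem_Rn_iff fun_eq_iff)
  have AA': "A (A' y) = y" if "y \<in> cube d b \<rho>" for y
  proof
    fix i
    have half: "2 * ((w + 1) / 2) - 1 = w" for w :: real by (simp add: field_simps)
    have "b i + \<rho> * (2 * (((y i - b i) / \<rho> + 1) / 2) - 1) = y i" unfolding half using b(2) by simp
    then show "A (A' y) i = y i"
      using that by (cases "i < d") (simp_all add: A_def A'_def trunc_def cube_def mem_Rn_iff)
  qed
  define h where "h z = \<sigma> (A z)" for z
  define C where "C = h ` open_cube d"
  have hK: "h z \<in> K" if "z \<in> open_cube d" for z using \<sigma>K A that by (simp add: h_def)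
  have CK: "C \<subseteq> K" using hK by (auto simp: C_def)
  have cubeR: "open_cube d \<subseteq> Rn d" by (auto simp: open_cube_def)
  have map: "semialgebraic_map d m (open_cube d) h"
  proof (rule semialgebraic_mapI[where R = "\<lambda>z x. ?LS (A z) x"])
    show "semialg (\<lambda>e. ?LS (A (trunc d e)) (trunc m (\<lambda>i. e (d + i))))"
    proof (rule semialg_lex_section[OF K \<pi>(1)])
      show "polyfun (\<lambda>e. A (trunc d e) i)" for i
        by (rule polyfun_compose[OF pfA(1), where T = "trunc d"]) (rule polyfun_trunc, rule polyfun_coord)
    qed (rule polyfun_coord)
    show "?LS (A z) x \<longleftrightarrow> x = h z" if "z \<in> open_cube d" for z x
    proof
      assume "?LS (A z) x"
      then show "x = h z" unfolding h_def by (rule uniq[OF A[OF that]])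
    next
      assume "x = h z"
      then show "?LS (A z) x" using \<sigma>[OF A[OF that]] by (simp only: h_def)
    qed
  qed (use hK KR semialgebraic_open_cube in auto)
  have Csa: "semialgebraic m C"
  proof -
    have "semialg (\<lambda>e. \<exists>z\<in>Rn d. z \<in> open_cube d \<and> ?LS (A z) (trunc m e))"
    proof (rule semialg_ex, rule semialg_and)
      show "semialg (\<lambda>e. trunc d (odd_part e) \<in> open_cube d)"
        by (rule semialg_mem[OF semialgebraic_open_cube]) (rule polyfun_odd_part, rule polyfun_coord)
      show "semialg (\<lambda>e. ?LS (A (trunc d (odd_part e))) (trunc m (even_part e)))"
      proof (rule semialg_lex_section[OF K \<pi>(1)])
        show "polyfun (\<lambda>e. A (trunc d (odd_part e)) i)" for i
          by (rule polyfun_compose[OF pfA(1), where T = "\<lambda>e. trunc d (odd_part e)"]) (rule polyfun_trunc, rule polyfun_odd_part, rule polyfun_coord)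
        show "polyfun (\<lambda>e. even_part e i)" for i by (rule polyfun_even_part) (rule polyfun_coord)
      qed
    qed
    then have "semialgebraic m {x \<in> Rn m. \<exists>z\<in>Rn d. z \<in> open_cube d \<and> ?LS (A z) (trunc m x)}"
      by (rule semialg_imp_semialgebraic)
    moreover have "{x \<in> Rn m. \<exists>z\<in>Rn d. z \<in> open_cube d \<and> ?LS (A z) (trunc m x)} = C"
    proof (intro set_eqI iffI)
      fix x assume "x \<in> {x \<in> Rn m. \<exists>z\<in>Rn d. z \<in> open_cube d \<and> ?LS (A z) (trunc m x)}"
      then obtain z where "z \<in> open_cube d" "?LS (A z) x" by (auto simp: trunc_id)
      then show "x \<in> C" using uniq[OF A] by (auto simp: C_def h_def)
    next
      fix x assume "x \<in> C"
      then obtain z where z: "z \<in> open_cube d" "x = h z" by (auto simp: C_def)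
      then show "x \<in> {x \<in> Rn m. \<exists>z\<in>Rn d. z \<in> open_cube d \<and> ?LS (A z) (trunc m x)}"
        using hK KR cubeR \<sigma>[OF A[OF z(1)]] by (auto simp: h_def trunc_id subset_iff)
    qed
    ultimately show ?thesis by simp
  qed
  have cont_pf: "continuous_on S T" if "\<And>i. polyfun (\<lambda>x. T x i)" for S and T :: "(nat \<Rightarrow> real) \<Rightarrow> nat \<Rightarrow> real"
    by (rule continuous_on_coordinatewise_then_product)
       (rule continuous_on_subset[OF polyfun_continuous[OF that]], simp)
  have "homeomorphic_maps (top_of_set (open_cube d)) (top_of_set C) h (\<lambda>x. A' (\<pi> x))"
    unfolding homeomorphic_maps_def continuous_map_subtopology_eu
  proof (intro conjI ballI)
    show "continuous_on (open_cube d) h"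
      unfolding h_def using cont_pf[OF pfA(1)] A by (intro continuous_on_compose2[OF cont]) auto
    show "continuous_on C (\<lambda>x. A' (\<pi> x))"
      by (intro cont_pf polyfun_compose[OF pfA(2), where T = \<pi>] \<pi>(1))
    show "h \<in> open_cube d \<rightarrow> C" by (auto simp: C_def)
    have inv: "A' (\<pi> (h z)) = z" if "z \<in> open_cube d" for z
      using that by (simp add: h_def \<pi>\<sigma> A A'A)
    then show "A' (\<pi> (h z)) = z" if "z \<in> topspace (top_of_set (open_cube d))" for z
      using that by simp
    show "(\<lambda>x. A' (\<pi> x)) \<in> C \<rightarrow> open_cube d" using inv by (auto simp: C_def)
    show "h (A' (\<pi> x)) = x" if "x \<in> topspace (top_of_set C)" for x
      using that inv by (auto simp: C_def)
  qed
  then have "homeomorphic_map (subtopology (Euclidean_space d) (open_cube d)) (subtopology (Euclidean_space m) C) h"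
    using subtopology_Euclidean_space[OF cubeR] subtopology_Euclidean_space[of C m] CK KR
    by (metis homeomorphic_maps_imp_map subset_trans)
  then show ?thesis using map Csa CK unfolding contains_cell_def by blast
qed

text \<open>
  Let \<open>\<sigma>\<close> be the section of lexicographic minima over a box contained in \<open>\<pi> ` K\<close>. The sets where a
  coordinate of \<open>\<sigma>\<close> is above or below a given rational number are semialgebraic, so off
  countably many hypersurfaces \<open>\<sigma>\<close> is continuous. The set of continuity points is semialgebraic
  and not contained in a hypersurface, so it contains a box.
\<close>

lemma image_thin_or_contains_cell:
  assumes K: "semialgebraic m K" "compact K" and \<pi>: "\<And>i. polyfun (\<lambda>x. \<pi> x i)" "\<And>x. \<pi> x \<in> Rn d"
    and nocell: "\<not> contains_cell m K d"
  shows "\<exists>Q. polyfun Q \<and> (\<exists>y\<in>Rn d. Q y \<noteq> 0) \<and> (\<forall>x\<in>K. Q (\<pi> x) = 0)"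
proof -
  have KR: "K \<subseteq> Rn m" by (rule semialgebraic_subset_Rn[OF K(1)])
  define LS where "LS = lex_section m d K \<pi>"
  have evod: "\<And>i. polyfun (\<lambda>e. even_part e i)" "\<And>i. polyfun (\<lambda>e. odd_part e i)" by (simp_all add: even_part_def odd_part_def)
  have LSsa: "semialg (\<lambda>e. LS (T e) (trunc m (S e)))" if "\<And>i. polyfun (\<lambda>e. T e i)" "\<And>i. polyfun (\<lambda>e. S e i)" for T S
    unfolding LS_def by (rule semialg_lex_section[OF K(1) \<pi>(1) that])
  have uniq: "x = x'" if "LS y x" "LS y x'" for x x' y
  proof (rule lex_le_antisym)
    show "x \<in> Rn m" "x' \<in> Rn m" using that KR by (auto simp: LS_def lex_section_def)
    show "lex_le m x x'" "lex_le m x' x" using that KR by (auto simp: LS_def lex_section_def)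
  qed
  define P where "P y \<longleftrightarrow> (\<exists>x\<in>Rn m. LS y x)" for y
  have "semialg P" unfolding P_def by (rule semialg_ex) (intro LSsa evod)
  from semialg_locally_constant[OF this, of d] obtain Q where Q: "polyfun Q" "\<exists>y\<in>Rn d. Q y \<noteq> 0"
    "\<And>b. b \<in> Rn d \<Longrightarrow> Q b \<noteq> 0 \<Longrightarrow> \<exists>\<epsilon>>0. \<forall>y\<in>cube d b \<epsilon>. P y = P b" by blast
  have Pim: "P (\<pi> x)" if x: "x \<in> K" for x
  proof -
    let ?A = "K \<inter> (\<Inter>i<d. {z. \<pi> z i = \<pi> x i})"
    have "closed {z. \<pi> z i = \<pi> x i}" for i
      by (intro closed_Collect_eq continuous_on_const polyfun_continuous \<pi>(1))
    then have "compact ?A" using K(2) by (intro compact_Int_closed closed_INT) auto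
    moreover have "?A \<noteq> {}" using x by auto
    ultimately obtain z where "z \<in> ?A" "\<And>w. w \<in> ?A \<Longrightarrow> lex_le m z w"
      using lex_minimum_exists[of ?A m] by blast
    then have "LS (\<pi> x) z" by (auto simp: LS_def lex_section_def)
    then show ?thesis using KR by (auto simp: P_def LS_def lex_section_def)
  qed
  show ?thesis
  proof (cases "\<forall>x\<in>K. Q (\<pi> x) = 0")
    case True then show ?thesis using Q by blast
  next
    case False
    then obtain x0 where x0: "x0 \<in> K" "Q (\<pi> x0) \<noteq> 0" by blast
    define b where "b = \<pi> x0"
    have b: "b \<in> Rn d" using \<pi>(2) by (simp add: b_def)
    obtain \<epsilon> where \<epsilon>: "\<epsilon> > 0" "\<And>y. y \<in> cube d b \<epsilon> \<Longrightarrow> P y"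
      using Q(3)[of b] b x0 Pim[OF x0(1)] by (auto simp: b_def)
    define \<sigma> where "\<sigma> y = (THE x. LS y x)" for y
    have \<sigma>: "LS y (\<sigma> y)" if "y \<in> cube d b \<epsilon>" for y
    proof -
      have "P y" by (rule \<epsilon>(2)[OF that])
      then obtain x where x: "LS y x" by (auto simp: P_def)
      then have "\<sigma> y = x" unfolding \<sigma>_def using uniq by blast
      then show ?thesis using x by simp
    qed
    define gt where "gt r j y \<longleftrightarrow> (\<exists>x\<in>Rn m. LS y x \<and> r < x j)" for r :: real and j y
    define lt where "lt r j y \<longleftrightarrow> (\<exists>x\<in>Rn m. LS y x \<and> x j < r)" for r :: real and j y
    have semialg_gt_lt: "semialg (gt r j)" "semialg (lt r j)" for r j
      unfolding gt_def lt_def by (rule semialg_ex, intro semialg_and LSsa semialg_less polyfun_trunc polyfun_const evod)+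
    define LC where "LC R Q \<longleftrightarrow> polyfun Q \<and> (\<exists>y\<in>Rn d. Q y \<noteq> 0) \<and>
        (\<forall>b\<in>Rn d. Q b \<noteq> 0 \<longrightarrow> (\<exists>\<epsilon>>0. \<forall>y\<in>cube d b \<epsilon>. R y = R b))" for R :: "(nat \<Rightarrow> real) \<Rightarrow> bool" and Q
    have LC: "LC R (SOME Q. LC R Q)" if "semialg R" for R
      using semialg_locally_constant[OF that, of d] unfolding LC_def by (rule someI_ex)
    define G where "G r j = (SOME Q. LC (gt r j) Q)" for r j
    define L where "L r j = (SOME Q. LC (lt r j) Q)" for r j
    have G: "LC (gt r j) (G r j)" and L: "LC (lt r j) (L r j)" for r j
      unfolding G_def L_def by (rule LC[OF semialg_gt_lt(1)], rule LC[OF semialg_gt_lt(2)])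
    \<comment> \<open>\<open>Cnt y\<close>: \<open>\<sigma>\<close> is continuous at \<open>y\<close>, written with the graph of \<open>\<sigma>\<close>\<close>
    define modulus where "modulus y \<eta> \<delta> \<longleftrightarrow> (\<forall>y'\<in>Rn d. \<forall>x\<in>Rn m. \<forall>x'\<in>Rn m.
        LS y x \<longrightarrow> LS y' x' \<longrightarrow> (\<forall>i<d. \<bar>y' i - y i\<bar> < \<delta>) \<longrightarrow> (\<forall>j<m. \<bar>x' j - x j\<bar> < \<eta>))" for y \<eta> \<delta>
    define Cnt where "Cnt y \<longleftrightarrow> (\<forall>\<eta>. 0 < \<eta> \<longrightarrow> (\<exists>\<delta>. 0 < \<delta> \<and> modulus y \<eta> \<delta>))" for y
    have "semialg Cnt" unfolding Cnt_def modulus_def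
      by (rule semialg_all_real, rule semialg_imp, rule semialg_less, rule polyfun_const, rule evod(2), rule semialg_ex_real, rule semialg_and, rule semialg_less,
          rule polyfun_const, rule evod(2), rule semialg_all, rule semialg_all, rule semialg_all,
          intro semialg_imp LSsa semialg_all_less semialg_abs_less polyfun_diff polyfun_trunc polyfun_even_part polyfun_odd_part polyfun_coord)
    from semialg_locally_constant[OF this, of d] obtain QC where QC: "polyfun QC" "\<exists>y\<in>Rn d. QC y \<noteq> 0"
      "\<And>b. b \<in> Rn d \<Longrightarrow> QC b \<noteq> 0 \<Longrightarrow> \<exists>\<epsilon>>0. \<forall>y\<in>cube d b \<epsilon>. Cnt y = Cnt b" by blast
    define F where "F = insert QC ((\<lambda>(r, j). G r j) ` (\<rat> \<times> {..<m}) \<union> (\<lambda>(r, j). L r j) ` (\<rat> \<times> {..<m}))"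
    have "countable F" unfolding F_def
      by (intro countable_insert countable_Un countable_image countable_SIGMA countable_rat countable_finite) auto
    moreover have "polyfun p \<and> (\<exists>y\<in>Rn d. p y \<noteq> 0)" if "p \<in> F" for p
    proof -
      have "p = QC \<or> (\<exists>r j. p = G r j) \<or> (\<exists>r j. p = L r j)" using that by (auto simp: F_def)
      then show ?thesis using G L QC(1,2) unfolding LC_def by (elim disjE exE) simp_all
    qed
    ultimately obtain c where c: "c \<in> cube d b \<epsilon>" "\<And>p. p \<in> F \<Longrightarrow> p c \<noteq> 0"
      using polynomials_avoid_zero[OF _ _ b \<epsilon>(1), of F] by blast
    have cR: "c \<in> Rn d" using c(1) by (simp add: cube_def)
    have "Cnt c" unfolding Cnt_def
    proof (intro allI impI)
      fix \<eta> :: real assume \<eta>: "0 < \<eta>"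
      define x where "x = \<sigma> c"
      have x: "LS c x" "x \<in> Rn m" using \<sigma>[OF c(1)] KR by (auto simp: x_def LS_def lex_section_def)
      have "\<exists>\<delta>>0. \<forall>y'\<in>cube d c \<delta>. \<forall>x'\<in>Rn m. LS y' x' \<longrightarrow> \<bar>x' j - x j\<bar> < \<eta>" if j: "j < m" for j
      proof -
        obtain r s where r: "r \<in> \<rat>" "x j - \<eta> < r" "r < x j" and s: "s \<in> \<rat>" "x j < s" "s < x j + \<eta>"
          using Rats_dense_in_real[of "x j - \<eta>" "x j"] Rats_dense_in_real[of "x j" "x j + \<eta>"] \<eta> by auto
        have "G r j c \<noteq> 0" "L s j c \<noteq> 0" using r s j by (auto intro!: c(2) simp: F_def)
        then have "\<exists>\<epsilon>>0. \<forall>y\<in>cube d c \<epsilon>. gt r j y = gt r j c" "\<exists>\<epsilon>>0. \<forall>y\<in>cube d c \<epsilon>. lt s j y = lt s j c"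
          using G[of r j] L[of s j] cR unfolding LC_def by simp_all
        then obtain \<delta>1 \<delta>2 where \<delta>: "\<delta>1 > 0" "\<And>y. y \<in> cube d c \<delta>1 \<Longrightarrow> gt r j y = gt r j c"
          "\<delta>2 > 0" "\<And>y. y \<in> cube d c \<delta>2 \<Longrightarrow> lt s j y = lt s j c" by blast
        have "\<bar>x' j - x j\<bar> < \<eta>" if y': "y' \<in> cube d c (min \<delta>1 \<delta>2)" and x': "LS y' x'" for y' x'
        proof -
          have "gt r j c" "lt s j c" using x r s by (auto simp: gt_def lt_def)
          then have "gt r j y'" "lt s j y'"
            using \<delta>(2,4) cube_mono[of "min \<delta>1 \<delta>2" \<delta>1 d c] cube_mono[of "min \<delta>1 \<delta>2" \<delta>2 d c] y' by auto
          then have "r < x' j" "x' j < s" using uniq[OF x'] by (auto simp: gt_def lt_def)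
          then show ?thesis using r s by (auto simp: abs_less_iff)
        qed
        then show ?thesis using \<delta> by (intro exI[of _ "min \<delta>1 \<delta>2"]) auto
      qed
      then obtain D where D: "\<And>j. j < m \<Longrightarrow> D j > 0"
        "\<And>j y' x'. j < m \<Longrightarrow> y' \<in> cube d c (D j) \<Longrightarrow> x' \<in> Rn m \<Longrightarrow> LS y' x' \<Longrightarrow> \<bar>x' j - x j\<bar> < \<eta>" by metis
      define \<delta> where "\<delta> = Min (insert 1 (D ` {..<m}))"
      have "\<delta> > 0" using D(1) by (simp add: \<delta>_def)
      moreover have "\<bar>x' j - x'' j\<bar> < \<eta>" if "y' \<in> Rn d" "x'' \<in> Rn m" "x' \<in> Rn m" "LS c x''" "LS y' x'"
        "\<forall>i<d. \<bar>y' i - c i\<bar> < \<delta>" "j < m" for y' x' x'' j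
      proof -
        have "\<delta> \<le> D j" using that(7) by (simp add: \<delta>_def)
        then have "y' \<in> cube d c (D j)" using that by (force simp: cube_def)
        moreover have "x'' = x" by (rule uniq[OF that(4) x(1)])
        ultimately show ?thesis using D(2) that by blast
      qed
      ultimately show "\<exists>\<delta>. 0 < \<delta> \<and> modulus c \<eta> \<delta>" unfolding modulus_def by blast
    qed
    moreover have "QC c \<noteq> 0" by (rule c(2)) (simp add: F_def)
    ultimately obtain \<rho>1 where \<rho>1: "\<rho>1 > 0" "\<And>y. y \<in> cube d c \<rho>1 \<Longrightarrow> Cnt y" using QC(3)[OF cR] by blast
    obtain \<rho>2 where \<rho>2: "\<rho>2 > 0" "cube d c \<rho>2 \<subseteq> cube d b \<epsilon>" using cube_shrink[OF c(1)] by blast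
    define \<rho> where "\<rho> = min \<rho>1 \<rho>2"
    have \<rho>: "\<rho> > 0" "cube d c \<rho> \<subseteq> cube d b \<epsilon>" "\<And>y. y \<in> cube d c \<rho> \<Longrightarrow> Cnt y"
      using \<rho>1 \<rho>2 cube_mono[of \<rho> \<rho>1 d c] cube_mono[of \<rho> \<rho>2 d c] by (auto simp: \<rho>_def)
    have LS\<sigma>: "LS y (\<sigma> y)" "\<sigma> y \<in> Rn m" if "y \<in> cube d c \<rho>" for y
    proof -
      show "LS y (\<sigma> y)" using \<sigma> \<rho>(2) that by blast
      then show "\<sigma> y \<in> Rn m" using KR by (auto simp: LS_def lex_section_def)
    qed
    have cont: "continuous_on (cube d c \<rho>) \<sigma>"
    proof (rule continuous_on_coordinatewise_then_product)
      fix j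
      show "continuous_on (cube d c \<rho>) (\<lambda>y. \<sigma> y j)"
      proof (cases "j < m")
        case False
        then have "\<sigma> y j = 0" if "y \<in> cube d c \<rho>" for y using LS\<sigma>(2)[OF that] by (simp add: mem_Rn_iff)
        then show ?thesis by (simp cong: continuous_on_cong)
      next
        case True
        show ?thesis unfolding continuous_on_topological
        proof (intro ballI allI impI)
          fix y B assume y: "y \<in> cube d c \<rho>" and B: "open B" "\<sigma> y j \<in> B"
          obtain \<eta> where \<eta>: "\<eta> > 0" "\<And>t. \<bar>t - \<sigma> y j\<bar> < \<eta> \<Longrightarrow> t \<in> B"
            using B unfolding open_dist by (force simp: dist_real_def)
          obtain \<delta> where \<delta>: "\<delta> > 0" "modulus y \<eta> \<delta>"
            using \<rho>(3)[OF y] \<eta>(1) unfolding Cnt_def by blast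
          show "\<exists>A. open A \<and> y \<in> A \<and> (\<forall>y'\<in>cube d c \<rho>. y' \<in> A \<longrightarrow> \<sigma> y' j \<in> B)"
          proof (intro exI[of _ "{y'. \<forall>i<d. \<bar>y' i - y i\<bar> < \<delta>}"] conjI ballI impI)
            fix y' assume y': "y' \<in> cube d c \<rho>" "y' \<in> {y'. \<forall>i<d. \<bar>y' i - y i\<bar> < \<delta>}"
            then have "y' \<in> Rn d" "\<forall>i<d. \<bar>y' i - y i\<bar> < \<delta>" by (auto simp: cube_def)
            then have "\<forall>j<m. \<bar>\<sigma> y' j - \<sigma> y j\<bar> < \<eta>"
              using \<delta>(2) LS\<sigma>[OF y] LS\<sigma>[OF y'(1)] unfolding modulus_def by blast
            then show "\<sigma> y' j \<in> B" using True \<eta>(2) by blast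
          qed (use \<delta>(1) in \<open>auto intro: open_coord_box\<close>)
        qed
      qed
    qed
    have "contains_cell m K d"
      using contains_cell_of_section[OF K(1) \<pi> cR \<rho>(1) _ cont] LS\<sigma>(1) by (simp add: LS_def)
    then show ?thesis using nocell by contradiction
  qed
qed

lemma image_dependent_coords:
  assumes K: "semialgebraic m K" "compact K" "\<not> contains_cell m K (Suc k)"
    and L: "\<And>i. polyfun (\<lambda>x. L x i)"
    and I: "I \<subseteq> {..<n}" "card I = Suc k"
  shows "dependent_coords n I (L ` K)"
proof -
  have "finite I" using I finite_subset by auto
  from ex_bij_betw_nat_finite[OF this] obtain e where "bij_betw e {0..<Suc k} I" using I by auto
  then have e: "bij_betw e {..<Suc k} I" by (simp add: atLeast0LessThan)
  then have eI: "e j \<in> I" if "j < Suc k" for j using that by (auto simp: bij_betw_def)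
  define T where "T u = (\<lambda>j. if j < Suc k then u (e j) else 0)" for u :: "nat \<Rightarrow> real"
  have pfT: "polyfun (\<lambda>x. T (L x) j)" for j by (cases "j < Suc k") (simp_all add: T_def L)
  have "T u \<in> Rn (Suc k)" for u by (simp add: T_def mem_Rn_iff)
  from image_thin_or_contains_cell[OF K(1,2) pfT this K(3)] obtain Q where
    Q: "polyfun Q" "\<exists>y\<in>Rn (Suc k). Q y \<noteq> 0" "\<And>x. x \<in> K \<Longrightarrow> Q (T (L x)) = 0" by blast
  have "(\<exists>i\<in>I. \<forall>u. T u j = u i) \<or> (\<forall>u. T u j = 0)" for j
    using eI by (cases "j < Suc k") (auto simp: T_def)
  from poly_expand[where T = T, OF Q(1) this I(1)] obtain D where
    "in_span UNIV (exponents_on n I D) (monomial n) (\<lambda>u. Q (T u))" ..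
  then obtain a where a: "\<And>u. Q (T u) = (\<Sum>\<gamma>\<in>exponents_on n I D. a \<gamma> * monomial n \<gamma> u)"
    unfolding in_span_def by auto
  obtain y where y: "y \<in> Rn (Suc k)" "Q y \<noteq> 0" using Q(2) by blast
  define u where "u i = y (inv_into {..<Suc k} e i)" for i
  have "inv_into {..<Suc k} e (e j) = j" if "j < Suc k" for j
    using that e by (intro inv_into_f_f) (auto simp: bij_betw_def)
  then have "T u = y" using y(1) by (auto simp: T_def u_def mem_Rn_iff fun_eq_iff)
  then have "(\<Sum>\<gamma>\<in>exponents_on n I D. a \<gamma> * monomial n \<gamma> u) \<noteq> 0" using a[of u] y by simp
  then have "\<exists>\<gamma>\<in>exponents_on n I D. a \<gamma> \<noteq> 0"
    by (metis (no_types, lifting) mult_eq_0_iff sum.neutral)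
  moreover have "\<forall>x\<in>L ` K. (\<Sum>\<gamma>\<in>exponents_on n I D. a \<gamma> * monomial n \<gamma> x) = 0"
    using Q(3) a by auto
  ultimately show ?thesis unfolding dependent_coords_def by blast
qed

section \<open>Projection along a direction that is not a secant\<close>

text \<open>The sum norm, equivalent to the Euclidean norm and more convenient for estimates by coordinates.\<close>

definition l1_norm :: "nat \<Rightarrow> (nat \<Rightarrow> real) \<Rightarrow> real" where
  "l1_norm n z = (\<Sum>i<n. \<bar>z i\<bar>)"

lemma l1_norm_nonneg [simp]: "0 \<le> l1_norm n z" by (simp add: l1_norm_def sum_nonneg)

lemma abs_le_l1_norm: "i < n \<Longrightarrow> \<bar>z i\<bar> \<le> l1_norm n z"
  unfolding l1_norm_def by (rule member_le_sum) auto

lemma L2_set_le_l1_norm: "L2_set z {..<n} \<le> l1_norm n z"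
  unfolding l1_norm_def by (rule L2_set_le_sum_abs)

lemma l1_norm_le_L2_set: "l1_norm n z \<le> real n * L2_set z {..<n}"
proof -
  have "\<bar>z i\<bar> \<le> L2_set z {..<n}" if "i < n" for i
    using member_le_L2_set[of "{..<n}" i "\<lambda>i. \<bar>z i\<bar>"] that by (simp add: L2_set_def)
  then have "l1_norm n z \<le> (\<Sum>i<n. L2_set z {..<n})" unfolding l1_norm_def by (intro sum_mono) auto
  then show ?thesis by simp
qed

lemma l1_norm_triangle: "l1_norm n (\<lambda>i. a i + b i) \<le> l1_norm n a + l1_norm n b"
  unfolding l1_norm_def sum.distrib[symmetric] by (intro sum_mono abs_triangle_ineq)

lemma l1_norm_scale: "l1_norm n (\<lambda>i. t * a i) = \<bar>t\<bar> * l1_norm n a"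
  by (simp add: l1_norm_def abs_mult sum_distrib_left)

text \<open>The intersection of \<open>X\<close> with the closed Euclidean ball of radius \<open>r\<close> about the origin.\<close>

definition piece :: "(nat \<Rightarrow> real) set \<Rightarrow> nat \<Rightarrow> real \<Rightarrow> (nat \<Rightarrow> real) set" where
  "piece X m r = {x \<in> X. (\<Sum>i<m. (x i)\<^sup>2) \<le> r\<^sup>2}"

lemma piece_mono: "0 \<le> r \<Longrightarrow> r \<le> r' \<Longrightarrow> piece X m r \<subseteq> piece X m r'"
  unfolding piece_def using power_mono[of r r' 2] by (auto intro: order_trans)

lemma semialgebraic_piece:
  assumes "semialgebraic m X"
  shows "semialgebraic m (piece X m r)"
proof -
  have "semialgebraic m {x \<in> Rn m. (\<Sum>i<m. (x i)\<^sup>2) \<le> r\<^sup>2}"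
    by (intro semialg_imp_semialgebraic semialg_le polyfun_sum polyfun_power polyfun_coord polyfun_const)
  moreover have "piece X m r = X \<inter> {x \<in> Rn m. (\<Sum>i<m. (x i)\<^sup>2) \<le> r\<^sup>2}"
    using semialgebraic_subset_Rn[OF assms] by (auto simp: piece_def)
  ultimately show ?thesis using semialgebraic_Int[OF assms] by simp
qed

lemma piece_coord_le:
  assumes "x \<in> piece X m r" "0 \<le> r" "i < m"
  shows "\<bar>x i\<bar> \<le> r"
proof -
  have "(x i)\<^sup>2 \<le> (\<Sum>i<m. (x i)\<^sup>2)" using assms(3) by (intro member_le_sum) auto
  also have "\<dots> \<le> r\<^sup>2" using assms(1) by (simp add: piece_def)
  finally show ?thesis using assms(2) by (metis abs_le_square_iff abs_of_nonneg)
qed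

lemma compact_subset_piece:
  assumes "closed S" "S \<subseteq> piece X m r" "X \<subseteq> Rn m" "0 \<le> r"
  shows "compact S"
proof -
  let ?B = "PiE UNIV (\<lambda>i. if i < m then {- r..r} else {0})"
  have "compactin (product_topology (\<lambda>i. euclideanreal) UNIV) ?B"
    by (subst compactin_PiE) (auto simp: compactin_euclidean_iff)
  then have "compact ?B" by (simp add: euclidean_product_topology)
  moreover have "S \<subseteq> ?B"
  proof
    fix x assume "x \<in> S"
    then have x: "x \<in> piece X m r" "x \<in> Rn m" using assms by (auto simp: piece_def)
    have "x i \<in> (if i < m then {- r..r} else {0})" for i
      using piece_coord_le[OF x(1) assms(4), of i] x(2) by (auto simp: mem_Rn_iff abs_le_iff)
    then show "x \<in> ?B" by auto
  qed
  ultimately show ?thesis using compact_Int_closed[OF _ assms(1), of ?B] by (simp add: Int_absorb1)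
qed

lemma compact_piece:
  assumes "closed X" "X \<subseteq> Rn m" "0 \<le> r"
  shows "compact (piece X m r)"
proof (rule compact_subset_piece[OF _ order_refl assms(2,3)])
  have "closed {x :: nat \<Rightarrow> real. (\<Sum>i<m. (x i)\<^sup>2) \<le> r\<^sup>2}"
    by (intro closed_Collect_le polyfun_continuous polyfun_sum polyfun_power polyfun_coord polyfun_const)
  then show "closed (piece X m r)"
    using closed_Int[OF assms(1)] by (simp add: piece_def Collect_conj_eq)
qed

lemma contains_cell_mono: "contains_cell m A d \<Longrightarrow> A \<subseteq> B \<Longrightarrow> contains_cell m B d"
  unfolding contains_cell_def by blast

text \<open>\<open>L\<close> is a polynomial map to \<open>\<real>\<^sup>n\<close> that fixes the origin and is bi-Lipschitz on \<open>K\<close>.\<close>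

definition flattens :: "nat \<Rightarrow> (nat \<Rightarrow> real) set \<Rightarrow> nat \<Rightarrow> ((nat \<Rightarrow> real) \<Rightarrow> nat \<Rightarrow> real) \<Rightarrow> bool" where
  "flattens m K n L \<longleftrightarrow> (\<forall>i. polyfun (\<lambda>x. L x i)) \<and> (\<forall>x. L x \<in> Rn n) \<and> L origin = origin \<and>
     (\<exists>C>0. \<forall>x\<in>K. \<forall>y\<in>K. l1_norm n (\<lambda>i. L x i - L y i) \<le> C * l1_norm m (\<lambda>i. x i - y i) \<and>
        l1_norm m (\<lambda>i. x i - y i) \<le> C * l1_norm n (\<lambda>i. L x i - L y i))"

text \<open>\<open>L\<close> is followed by the linear projection along \<open>v\<close> onto the hyperplane where the last coordinate is zero.\<close>

lemma flattens_step:
  assumes X: "closed X" "semialgebraic m X" and r: "0 < r"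
    and nocell: "\<not> contains_cell m (piece X m r) (Suc k)"
    and n: "2 * k < Suc n" and L: "flattens m (piece X m r) (Suc n) L"
  shows "\<exists>L' r'. 0 < r' \<and> r' \<le> r \<and> flattens m (piece X m r') n L'"
proof -
  have XR: "X \<subseteq> Rn m" by (rule semialgebraic_subset_Rn[OF X(2)])
  let ?K = "piece X m r"
  obtain C where pfL: "\<And>i. polyfun (\<lambda>x. L x i)" and L0: "L origin = origin" and C: "C > 0"
    "\<And>x y. x \<in> ?K \<Longrightarrow> y \<in> ?K \<Longrightarrow> l1_norm (Suc n) (\<lambda>i. L x i - L y i) \<le> C * l1_norm m (\<lambda>i. x i - y i)"
    "\<And>x y. x \<in> ?K \<Longrightarrow> y \<in> ?K \<Longrightarrow> l1_norm m (\<lambda>i. x i - y i) \<le> C * l1_norm (Suc n) (\<lambda>i. L x i - L y i)"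
    using L unfolding flattens_def by blast
  have "dependent_coords (Suc n) I (L ` ?K)" if "I \<subseteq> {..<Suc n}" "card I = Suc k" for I
    using r by (intro image_dependent_coords[OF semialgebraic_piece[OF X(2)] compact_piece[OF X(1) XR] nocell pfL that]) simp
  from differences_algebraic_relation[OF this n] obtain M c where
    c: "\<exists>\<alpha>\<in>exponents (Suc n) (\<lambda>_. M). c \<alpha> \<noteq> 0"
      "\<And>x y. x \<in> L ` ?K \<Longrightarrow> y \<in> L ` ?K \<Longrightarrow>
        (\<Sum>\<alpha>\<in>exponents (Suc n) (\<lambda>_. M). c \<alpha> * monomial (Suc n) \<alpha> (\<lambda>i. x i - y i)) = 0" by blast
  have "\<exists>v \<epsilon>. v \<in> Rn (Suc n) \<and> (\<forall>i<Suc n. v i \<noteq> 0) \<and> \<epsilon> > 0 \<and>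
    (\<forall>x\<in>L ` ?K. \<forall>y\<in>L ` ?K. \<forall>t. t \<noteq> 0 \<and> \<bar>t\<bar> < \<epsilon> \<longrightarrow>
      (\<exists>i<Suc n. \<epsilon> * \<bar>t\<bar> \<le> \<bar>x i - y i - t * v i\<bar>))"
    by (rule secants_avoid_direction[OF c(1)]) (rule c(2))
  then obtain v \<epsilon> where
    v: "\<forall>i<Suc n. v i \<noteq> 0" and \<epsilon>: "\<epsilon> > 0" and
    avoid': "\<forall>x\<in>L ` ?K. \<forall>y\<in>L ` ?K. \<forall>t. t \<noteq> 0 \<and> \<bar>t\<bar> < \<epsilon> \<longrightarrow>
      (\<exists>i<Suc n. \<epsilon> * \<bar>t\<bar> \<le> \<bar>x i - y i - t * v i\<bar>)" by (elim exE conjE)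
  have avoid: "\<exists>i<Suc n. \<epsilon> * \<bar>t\<bar> \<le> \<bar>L x i - L y i - t * v i\<bar>"
    if "x \<in> ?K" "y \<in> ?K" "t \<noteq> 0" "\<bar>t\<bar> < \<epsilon>" for x y t
    using bspec[OF bspec[OF avoid' imageI[OF that(1)]] imageI[OF that(2)]] that(3,4) by blast
  have vn: "v n \<noteq> 0" using v by simp
  define V where "V = l1_norm (Suc n) v"
  have V0: "0 \<le> V" by (simp add: V_def)
  define L' where "L' x = trunc n (\<lambda>i. L x i - (L x n / v n) * v i)" for x
  \<comment> \<open>so small that \<open>t\<close> below satisfies \<open>\<bar>t\<bar> < \<epsilon>\<close>\<close>
  define r' where "r' = min r (\<epsilon> * \<bar>v n\<bar> / (2 * real m * C + 1))"
  define C' where "C' = C * (1 + V / \<bar>v n\<bar> + V / \<epsilon>)"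
  have mC: "0 \<le> 2 * real m * C" using C(1) by simp
  have den: "0 < 2 * real m * C + 1" using mC by linarith
  have "0 < \<epsilon> * \<bar>v n\<bar>" using \<epsilon> vn by simp
  from divide_pos_pos[OF this den] have r': "0 < r'" "r' \<le> r"
    unfolding r'_def using r by linarith+
  have small: "2 * real m * C * r' < \<epsilon> * \<bar>v n\<bar>"
  proof -
    have "r' \<le> \<epsilon> * \<bar>v n\<bar> / (2 * real m * C + 1)" by (simp add: r'_def)
    then have "r' * (2 * real m * C + 1) \<le> \<epsilon> * \<bar>v n\<bar>"
      by (simp only: pos_le_divide_eq[OF den])
    then show ?thesis using r'(1) by (simp add: algebra_simps)
  qed
  have sub: "piece X m r' \<subseteq> ?K" using r' by (intro piece_mono) auto
  have C'1: "C * (1 + V / \<bar>v n\<bar>) \<le> C'" "C * (1 + V / \<epsilon>) \<le> C'" "C' > 0"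
    unfolding C'_def using C(1) V0 \<epsilon> by (auto intro!: mult_left_mono mult_pos_pos add_pos_nonneg)
  have est: "l1_norm n (\<lambda>i. L' x i - L' y i) \<le> C' * l1_norm m (\<lambda>i. x i - y i) \<and>
      l1_norm m (\<lambda>i. x i - y i) \<le> C' * l1_norm n (\<lambda>i. L' x i - L' y i)"
    if x: "x \<in> piece X m r'" and y: "y \<in> piece X m r'" for x y
  proof -
    have K: "x \<in> ?K" "y \<in> ?K" using x y sub by auto
    define w where "w i = L x i - L y i" for i
    define t where "t = w n / v n"
    define D where "D = l1_norm n (\<lambda>i. L' x i - L' y i)"
    have D: "D = l1_norm n (\<lambda>i. w i - t * v i)"
      unfolding D_def l1_norm_def by (intro sum.cong refl) (simp add: L'_def trunc_def w_def t_def diff_divide_distrib algebra_simps)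
    have wn: "w n - t * v n = 0" using vn by (simp add: t_def)
    have D': "D = l1_norm (Suc n) (\<lambda>i. w i - t * v i)" using wn by (simp add: D l1_norm_def)
    have tw: "\<bar>t\<bar> \<le> l1_norm (Suc n) w / \<bar>v n\<bar>"
      unfolding t_def abs_divide using abs_le_l1_norm[of n "Suc n" w] by (intro divide_right_mono) auto
    have wC: "l1_norm (Suc n) w \<le> C * l1_norm m (\<lambda>i. x i - y i)" "l1_norm m (\<lambda>i. x i - y i) \<le> C * l1_norm (Suc n) w"
      using C(2,3)[OF K] by (simp_all add: w_def[abs_def])
    have "D \<le> l1_norm (Suc n) w + l1_norm (Suc n) (\<lambda>i. (- t) * v i)"
      using l1_norm_triangle[of "Suc n" w "\<lambda>i. (- t) * v i"] by (simp add: D')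
    also have "\<dots> = l1_norm (Suc n) w + \<bar>t\<bar> * V" unfolding l1_norm_scale by (simp add: V_def)
    also have "\<dots> \<le> l1_norm (Suc n) w + (l1_norm (Suc n) w / \<bar>v n\<bar>) * V"
      using tw V0 by (intro add_left_mono mult_right_mono)
    also have "\<dots> = l1_norm (Suc n) w * (1 + V / \<bar>v n\<bar>)" by (simp add: algebra_simps)
    also have "\<dots> \<le> (C * l1_norm m (\<lambda>i. x i - y i)) * (1 + V / \<bar>v n\<bar>)"
      using wC(1) V0 by (intro mult_right_mono) auto
    also have "\<dots> = (C * (1 + V / \<bar>v n\<bar>)) * l1_norm m (\<lambda>i. x i - y i)" by simp
    also have "\<dots> \<le> C' * l1_norm m (\<lambda>i. x i - y i)" using C'1 by (intro mult_right_mono) auto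
    finally have upper: "D \<le> C' * l1_norm m (\<lambda>i. x i - y i)" .
    \<comment> \<open>the secant \<open>w\<close> keeps its distance from the line spanned by \<open>v\<close>\<close>
    have tD: "\<epsilon> * \<bar>t\<bar> \<le> D"
    proof (cases "t = 0")
      case True then show ?thesis by (simp add: D)
    next
      case False
      have "\<bar>x i - y i\<bar> \<le> 2 * r'" if "i < m" for i
        using piece_coord_le[OF x _ that] piece_coord_le[OF y _ that] r'(1) by linarith
      then have "l1_norm m (\<lambda>i. x i - y i) \<le> (\<Sum>i<m. 2 * r')" unfolding l1_norm_def by (intro sum_mono) auto
      then have "C * l1_norm m (\<lambda>i. x i - y i) \<le> C * (\<Sum>i<m. 2 * r')" using C(1) by (intro mult_left_mono) auto
      then have "l1_norm (Suc n) w \<le> 2 * real m * C * r'" using wC(1) by (simp add: algebra_simps)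
      then have "l1_norm (Suc n) w / \<bar>v n\<bar> < \<epsilon>" using small vn by (simp add: pos_divide_less_eq)
      then have "\<bar>t\<bar> < \<epsilon>" using tw by simp
      then obtain i where i: "i < Suc n" "\<epsilon> * \<bar>t\<bar> \<le> \<bar>w i - t * v i\<bar>"
        using avoid[of x y t] False K by (auto simp: w_def)
      have "0 < \<epsilon> * \<bar>t\<bar>" using False \<epsilon> by simp
      then have "i \<noteq> n" using i wn by auto
      then show ?thesis using i abs_le_l1_norm[of i n "\<lambda>i. w i - t * v i"] by (simp add: D)
    qed
    have "l1_norm (Suc n) w \<le> l1_norm (Suc n) (\<lambda>i. w i - t * v i) + l1_norm (Suc n) (\<lambda>i. t * v i)"
      using l1_norm_triangle[of "Suc n" "\<lambda>i. w i - t * v i" "\<lambda>i. t * v i"] by simp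
    also have "\<dots> = D + \<bar>t\<bar> * V" unfolding l1_norm_scale D' by (simp add: V_def)
    also have "\<dots> \<le> D + (D / \<epsilon>) * V"
      using tD \<epsilon> V0 by (intro add_left_mono mult_right_mono) (auto simp: pos_le_divide_eq mult.commute)
    also have "\<dots> = (1 + V / \<epsilon>) * D" by (simp add: algebra_simps)
    finally have "C * l1_norm (Suc n) w \<le> C * ((1 + V / \<epsilon>) * D)" using C(1) by (intro mult_left_mono) auto
    also have "\<dots> = (C * (1 + V / \<epsilon>)) * D" by simp
    also have "\<dots> \<le> C' * D" using C'1 by (intro mult_right_mono) (auto simp: D)
    finally have "l1_norm m (\<lambda>i. x i - y i) \<le> C' * D" using wC(2) by simp
    then show ?thesis using upper by (simp add: D_def)
  qed
  have "flattens m (piece X m r') n L'"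
    unfolding flattens_def
  proof (intro conjI allI)
    show "polyfun (\<lambda>x. L' x i)" for i unfolding L'_def
      by (intro polyfun_trunc polyfun_diff polyfun_mult polyfun_divide_const polyfun_const pfL)
    show "L' x \<in> Rn n" for x by (simp add: L'_def)
    show "L' origin = origin" using L0 by (simp add: L'_def trunc_def origin_def fun_eq_iff)
  qed (use est C'1(3) in blast)
  then show ?thesis using r' by blast
qed

lemma flattens_exists:
  assumes X: "closed X" "semialgebraic m X" and r: "0 < r"
    and nocell: "\<not> contains_cell m (piece X m r) (Suc k)"
  shows "\<exists>L r'. 0 < r' \<and> flattens m (piece X m r') (2 * k) L"
proof -
  have XR: "X \<subseteq> Rn m" by (rule semialgebraic_subset_Rn[OF X(2)])
  \<comment> \<open>on \<open>X\<close> this is the inclusion of \<open>\<real>\<^sup>m\<close> into \<open>\<real>\<^sup>n\<close>\<close>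
  have start: "flattens m (piece X m r) n (trunc n)" if "m \<le> n" for n
  proof -
    have "l1_norm n (\<lambda>i. trunc n x i - trunc n y i) = l1_norm m (\<lambda>i. x i - y i)"
      if "x \<in> piece X m r" "y \<in> piece X m r" for x y
    proof -
      have "x \<in> Rn m" "y \<in> Rn m" using that XR by (auto simp: piece_def)
      then show ?thesis unfolding l1_norm_def using \<open>m \<le> n\<close>
        by (intro sum.mono_neutral_cong_right) (auto simp: trunc_def mem_Rn_iff)
    qed
    moreover have "polyfun (\<lambda>x. trunc n x i)" for i by (rule polyfun_trunc) (rule polyfun_coord)
    moreover have "trunc n origin = origin" by (simp add: trunc_def origin_def fun_eq_iff)
    ultimately show ?thesis unfolding flattens_def by (auto intro!: exI[of _ 1])
  qed
  have "\<exists>L r'. 0 < r' \<and> r' \<le> r \<and> flattens m (piece X m r') n L" if "2 * k \<le> n" "n \<le> max m (2 * k)" for n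
    using that(2,1)
  proof (induction n rule: inc_induct)
    case base
    then show ?case using start[of "max m (2 * k)"] r by (intro exI[of _ "trunc (max m (2 * k))"] exI[of _ r]) simp
  next
    case (step n)
    then obtain L r1 where L: "0 < r1" "r1 \<le> r" "flattens m (piece X m r1) (Suc n) L" by auto
    have "\<not> contains_cell m (piece X m r1) (Suc k)"
      using nocell contains_cell_mono[OF _ piece_mono] L by (meson less_imp_le)
    from flattens_step[OF X L(1) this _ L(3)] step.prems obtain L' r' where
      "0 < r'" "r' \<le> r1" "flattens m (piece X m r') n L'" by auto
    then show ?case using L(2) by (meson order_trans)
  qed
  from this[of "2 * k"] show ?thesis by auto
qed

text \<open>
  On \<open>X \<inter> U\<close>, where \<open>U\<close> is the open ball, the map is onto \<open>Y \<inter> V\<close>: here \<open>Y\<close> is the image of the closed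
  ball in \<open>X\<close>, and \<open>V\<close> is the complement of the image of the bounding sphere.
\<close>

lemma flattens_embedding:
  assumes X: "closed_semialgebraic_germ m X" and r: "0 < r" and L: "flattens m (piece X m r) n L"
  shows "bilipschitz_semialgebraic_embedding m n X L"
proof -
  have sX: "semialgebraic m X" and clX: "closed X" and oX: "origin \<in> X"
    using X by (auto simp: closed_semialgebraic_germ_def closedin_Euclidean_space_iff)
  have XR: "X \<subseteq> Rn m" by (rule semialgebraic_subset_Rn[OF sX])
  let ?K = "piece X m r"
  obtain C where pfL: "\<And>i. polyfun (\<lambda>x. L x i)" and LR: "\<And>x. L x \<in> Rn n" and L0: "L origin = origin" and C: "C > 0"
    "\<And>x y. x \<in> ?K \<Longrightarrow> y \<in> ?K \<Longrightarrow> l1_norm n (\<lambda>i. L x i - L y i) \<le> C * l1_norm m (\<lambda>i. x i - y i)"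
    "\<And>x y. x \<in> ?K \<Longrightarrow> y \<in> ?K \<Longrightarrow> l1_norm m (\<lambda>i. x i - y i) \<le> C * l1_norm n (\<lambda>i. L x i - L y i)"
    using L unfolding flattens_def by blast
  have contL: "continuous_on S L" for S by (rule continuous_on_coordinatewise_then_product)
       (rule continuous_on_subset[OF polyfun_continuous[OF pfL]], simp)
  define q where "q x = (\<Sum>i<m. (x i)\<^sup>2)" for x :: "nat \<Rightarrow> real"
  have pfq: "polyfun q" unfolding q_def by (intro polyfun_sum polyfun_power polyfun_coord)
  have inj: "inj_on L ?K"
  proof (rule inj_onI)
    fix x y assume xy: "x \<in> ?K" "y \<in> ?K" "L x = L y"
    then have "l1_norm m (\<lambda>i. x i - y i) \<le> 0" using C(3)[OF xy(1,2)] by (simp add: l1_norm_def)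
    then have "x i = y i" if "i < m" for i
      using abs_le_l1_norm[OF that, of "\<lambda>i. x i - y i"] by simp
    moreover have "x \<in> Rn m" "y \<in> Rn m" using xy XR by (auto simp: piece_def)
    ultimately show "x = y" by (metis ext mem_Rn_iff not_le)
  qed
  define U where "U = {x \<in> Rn m. q x < r\<^sup>2}"
  define Z where "Z = L ` {x \<in> X. q x = r\<^sup>2}"
  define V where "V = Rn n - Z"
  define Y where "Y = L ` ?K"
  have UK: "X \<inter> U \<subseteq> ?K" by (auto simp: U_def piece_def q_def)
  have opU: "openin (Euclidean_space m) U"
  proof -
    have "open {x. q x < r\<^sup>2}" by (intro open_Collect_less polyfun_continuous[OF pfq] continuous_on_const)
    then have "openin (top_of_set (Rn m)) (Rn m \<inter> {x. q x < r\<^sup>2})" by (rule openin_open_Int)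
    moreover have "Rn m \<inter> {x. q x < r\<^sup>2} = U" by (auto simp: U_def)
    ultimately show ?thesis
      using subtopology_Euclidean_space[of "Rn m" m] subtopology_topspace[of "Euclidean_space m"] by simp
  qed
  have oU: "origin \<in> U" using r by (simp add: U_def q_def origin_def mem_Rn_iff)
  have "compact {x \<in> X. q x = r\<^sup>2}"
  proof (rule compact_subset_piece[OF _ _ XR, where r = r])
    have "closed {x. q x = r\<^sup>2}" by (intro closed_Collect_eq polyfun_continuous[OF pfq] continuous_on_const)
    then show "closed {x \<in> X. q x = r\<^sup>2}" using closed_Int[OF clX] by (simp add: Collect_conj_eq)
  qed (use r in \<open>auto simp: piece_def q_def\<close>)
  then have "compact Z" unfolding Z_def by (intro compact_continuous_image contL)
  then have "closedin (Euclidean_space n) Z"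
    using LR by (auto simp: closedin_Euclidean_space_iff compact_imp_closed Z_def)
  then have opV: "openin (Euclidean_space n) V"
    unfolding V_def by (intro openin_diff openin_topspace)
  have YV: "Y \<inter> V = L ` (X \<inter> U)"
  proof (intro set_eqI iffI)
    fix y assume "y \<in> Y \<inter> V"
    then obtain x where x: "x \<in> ?K" "y = L x" "y \<notin> Z" by (auto simp: Y_def V_def)
    then have "q x \<noteq> r\<^sup>2" by (auto simp: Z_def piece_def)
    then show "y \<in> L ` (X \<inter> U)" using x XR by (auto simp: U_def piece_def q_def)
  next
    fix y assume "y \<in> L ` (X \<inter> U)"
    then obtain x where x: "x \<in> X \<inter> U" "y = L x" by blast
    have "y \<notin> Z"
    proof
      assume "y \<in> Z"
      then obtain z where z: "z \<in> X" "q z = r\<^sup>2" "L x = L z" using x by (auto simp: Z_def)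
      have "x \<in> ?K" using x UK by blast
      moreover have "z \<in> ?K" using z by (simp add: piece_def q_def)
      ultimately have "x = z" by (rule inj_onD[OF inj, OF z(3)])
      then show False using x z by (simp add: U_def)
    qed
    then show "y \<in> Y \<inter> V" using x UK LR by (auto simp: Y_def V_def)
  qed
  have oV: "origin \<in> V"
  proof -
    have "origin \<in> L ` (X \<inter> U)" using oX oU L0 by (metis IntI imageI)
    then show ?thesis using YV by blast
  qed
  have injU: "inj_on L (X \<inter> U)" using inj UK by (rule inj_on_subset)
  have bij: "bij_betw L (X \<inter> U) (Y \<inter> V)" using injU YV by (simp add: bij_betw_def)
  define g where "g = inv_into (X \<inter> U) L"
  have g: "g y \<in> X \<inter> U" "L (g y) = y" if "y \<in> Y \<inter> V" for y
  proof -
    have "y \<in> L ` (X \<inter> U)" using that YV by simp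
    then show "g y \<in> X \<inter> U" "L (g y) = y" unfolding g_def by (rule inv_into_into, rule f_inv_into_f)
  qed
  have sU: "semialgebraic m U" unfolding U_def
    by (intro semialg_imp_semialgebraic semialg_less pfq polyfun_const)
  have sXU: "semialgebraic m (X \<inter> U)" by (rule semialgebraic_Int[OF sX sU])
  have sY: "semialgebraic n Y" unfolding Y_def by (rule semialgebraic_image[OF semialgebraic_piece[OF sX] pfL LR])
  have sYV: "semialgebraic n (Y \<inter> V)" unfolding YV by (rule semialgebraic_image[OF sXU pfL LR])
  have "compact Y" unfolding Y_def using r by (intro compact_continuous_image contL compact_piece clX XR) simp
  then have germY: "closed_semialgebraic_germ n Y"
    using sY LR YV oX oU L0 unfolding closed_semialgebraic_germ_def closedin_Euclidean_space_iff
    by (auto simp: compact_imp_closed Y_def intro!: image_eqI[of origin L origin] subsetD[OF UK])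
  have eqL: "(\<forall>i<n. L x i = y i) \<longleftrightarrow> y = L x" if "y \<in> Rn n" for x y
  proof
    assume "\<forall>i<n. L x i = y i"
    then show "y = L x" using that LR[of x] by (intro ext) (metis mem_Rn_iff not_le)
  qed simp
  have pfs: "polyfun (\<lambda>e. trunc p (\<lambda>i. e (s + i)) j)" for p s j by (rule polyfun_trunc) (rule polyfun_coord)
  have pfLT: "polyfun (\<lambda>e. L (T e) i)" if "\<And>i. polyfun (\<lambda>e. T e i)" for T i
    by (rule polyfun_compose[OF pfL, where T = T]) (rule that)
  have mapL: "semialgebraic_map m n (X \<inter> U) L"
  proof (rule semialgebraic_mapI[OF sXU LR, where R = "\<lambda>x y. \<forall>i<n. L x i = y i"])
    show "semialg (\<lambda>e. \<forall>i<n. L (trunc m e) i = trunc n (\<lambda>i. e (m + i)) i)"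
      by (intro semialg_all_less semialg_eq pfs pfLT polyfun_trunc polyfun_coord)
  qed (rule eqL)
  have mapg: "semialgebraic_map n m (Y \<inter> V) g"
  proof (rule semialgebraic_mapI[OF sYV, where R = "\<lambda>y x. x \<in> X \<inter> U \<and> (\<forall>i<n. L x i = y i)"])
    show "g y \<in> Rn m" if "y \<in> Y \<inter> V" for y using g(1)[OF that] XR by auto
    show "x \<in> X \<inter> U \<and> (\<forall>i<n. L x i = y i) \<longleftrightarrow> x = g y" if "y \<in> Y \<inter> V" for x y
    proof -
      have "y \<in> Rn n" using that semialgebraic_subset_Rn[OF sYV] by blast
      then show ?thesis using eqL[of y x] g[OF that] inj_onD[OF injU, of x "g y"] eqL[of y "g y"] by auto
    qed
    have "semialg (\<lambda>e. trunc m (\<lambda>i. e (n + i)) \<in> X \<inter> U)" by (rule semialg_mem[OF sXU]) (rule polyfun_coord)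
    moreover have "semialg (\<lambda>e. \<forall>i<n. L (trunc m (\<lambda>i. e (n + i))) i = trunc n e i)"
      by (intro semialg_all_less semialg_eq pfs pfLT polyfun_trunc polyfun_coord)
    ultimately show "semialg (\<lambda>e. trunc m (\<lambda>i. e (n + i)) \<in> X \<inter> U \<and>
        (\<forall>i<n. L (trunc m (\<lambda>i. e (n + i))) i = trunc n e i))" by (rule semialg_and)
  qed
  have lipL: "L2_set (\<lambda>i. L x i - L y i) {..<n} \<le> (C * real m) * L2_set (\<lambda>i. x i - y i) {..<m}"
    if "x \<in> ?K" "y \<in> ?K" for x y
  proof -
    have "L2_set (\<lambda>i. L x i - L y i) {..<n} \<le> C * l1_norm m (\<lambda>i. x i - y i)"
      using C(2)[OF that] L2_set_le_l1_norm order_trans by blast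
    also have "\<dots> \<le> C * (real m * L2_set (\<lambda>i. x i - y i) {..<m})"
      using C(1) l1_norm_le_L2_set by (intro mult_left_mono) auto
    finally show ?thesis by (simp add: mult.assoc)
  qed
  have lipg: "L2_set (\<lambda>i. x i - y i) {..<m} \<le> (C * real n) * L2_set (\<lambda>i. L x i - L y i) {..<n}"
    if "x \<in> ?K" "y \<in> ?K" for x y
  proof -
    have "L2_set (\<lambda>i. x i - y i) {..<m} \<le> C * l1_norm n (\<lambda>i. L x i - L y i)"
      using C(3)[OF that] L2_set_le_l1_norm order_trans by blast
    also have "\<dots> \<le> C * (real n * L2_set (\<lambda>i. L x i - L y i) {..<n})"
      using C(1) l1_norm_le_L2_set by (intro mult_left_mono) auto
    finally show ?thesis by (simp add: mult.assoc)
  qed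
  have "Lipschitz_continuous_map (submetric (Rn_metric m) (X \<inter> U)) (submetric (Rn_metric n) (Y \<inter> V)) L"
    unfolding Lipschitz_continuous_map_def
  proof (intro conjI exI[of _ "C * real m"] ballI)
    show "L \<in> mspace (submetric (Rn_metric m) (X \<inter> U)) \<rightarrow> mspace (submetric (Rn_metric n) (Y \<inter> V))"
      using YV LR by auto
  qed (use lipL UK in auto)
  moreover have "Lipschitz_continuous_map (submetric (Rn_metric n) (Y \<inter> V)) (submetric (Rn_metric m) (X \<inter> U)) g"
    unfolding Lipschitz_continuous_map_def
  proof (intro conjI exI[of _ "C * real n"] ballI)
    show "g \<in> mspace (submetric (Rn_metric n) (Y \<inter> V)) \<rightarrow> mspace (submetric (Rn_metric m) (X \<inter> U))"
      using g(1) XR by auto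
    fix x y assume "x \<in> mspace (submetric (Rn_metric n) (Y \<inter> V))" "y \<in> mspace (submetric (Rn_metric n) (Y \<inter> V))"
    then have xy: "x \<in> Y \<inter> V" "y \<in> Y \<inter> V" by auto
    have "g x \<in> ?K" "g y \<in> ?K" using g(1)[OF xy(1)] g(1)[OF xy(2)] UK by auto
    from lipg[OF this] show "mdist (submetric (Rn_metric m) (X \<inter> U)) (g x) (g y) \<le>
        (C * real n) * mdist (submetric (Rn_metric n) (Y \<inter> V)) x y"
      by (simp add: g(2)[OF xy(1)] g(2)[OF xy(2)])
  qed
  ultimately show ?thesis
    unfolding bilipschitz_semialgebraic_embedding_def
    using L0 germY opU oU opV oV bij mapL mapg unfolding g_def by blast
qed

theorem theorem5p4:
  fixes m k :: nat and X :: "(nat \<Rightarrow> real) set"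
  assumes "closed_semialgebraic_germ m X"
    and "germ_has_dimension m X k"
  shows "\<exists>f. bilipschitz_semialgebraic_embedding m (2 * k) X f"
proof -
  have sX: "semialgebraic m X" and clX: "closed X"
    using assms(1) by (auto simp: closed_semialgebraic_germ_def closedin_Euclidean_space_iff)
  have XR: "X \<subseteq> Rn m" by (rule semialgebraic_subset_Rn[OF sX])
  obtain b where b: "b > 0" "\<And>r. 0 < r \<Longrightarrow> r < b \<Longrightarrow> has_dimension m (X \<inter> mball_of (Rn_metric m) origin r) k"
    using assms(2) unfolding germ_has_dimension_def eventually_at_right_field by auto
  define r where "r = b / 4"
  have r: "0 < r" "2 * r < b" using b(1) by (auto simp: r_def)
  have "\<not> contains_cell m (X \<inter> mball_of (Rn_metric m) origin (2 * r)) (Suc k)"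
    using b(2)[of "2 * r"] r unfolding has_dimension_def by force
  moreover have "piece X m r \<subseteq> X \<inter> mball_of (Rn_metric m) origin (2 * r)"
  proof
    fix x assume x: "x \<in> piece X m r"
    have "L2_set (\<lambda>i. origin i - x i) {..<m} = sqrt (\<Sum>i<m. (x i)\<^sup>2)"
      by (simp add: L2_set_def origin_def)
    also have "\<dots> \<le> sqrt (r\<^sup>2)" using x by (simp add: piece_def del: real_sqrt_abs)
    also have "\<dots> < 2 * r" using r by simp
    finally show "x \<in> X \<inter> mball_of (Rn_metric m) origin (2 * r)"
      using x XR by (auto simp: piece_def in_mball_of origin_def mem_Rn_iff)
  qed
  ultimately have "\<not> contains_cell m (piece X m r) (Suc k)"
    using contains_cell_mono by blast
  from flattens_exists[OF clX sX r(1) this] obtain L r' where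
    "0 < r'" "flattens m (piece X m r') (2 * k) L" by blast
  then show ?thesis using flattens_embedding[OF assms(1)] by blast
qed

end
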